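(* Let $g_\theta$ and $g_\kappa$ both have radius of convergence $R>0$ and be holomorphic in some domain $\Delta_0$. Assume $g_\kappa^{\{1\}}(R)<1$ and that, for some $\theta^*\ge0$ and $\delta>0$, as $z\to R$ with $z\in\Delta_0$, $$g_\theta(z)=-\theta^*\log(1-z/R)+O\big((1-z/R)^\delta\big),\qquad g_\kappa(z)=g_\kappa(R)-g_\kappa^{\{1\}}(R)(1-z/R)+O\big((1-z/R)^{1+\delta}\big).$$ Let $f:\Delta_0\to\mathbb C$ be holomorphic with $f(z)=(1-z/R)^{-\beta}\{1+O((1-z/R)^\delta)\}$ as $z\to R$, $z\in\Delta_0$, for some $\beta\ge0$. Then, provided $v\theta^*+\beta>0$, as $N\to\infty$, $$[z^N]\big[f(z)\exp\{vG_N(z)\}\big]\sim\frac{\exp\{Nv\,g_\kappa(R)\}\cdot\{N(1-vg_\kappa^{\{1\}}(R))\}^{v\theta^*+\beta-1}}{R^N\,\Gamma(v\theta^*+\beta)},$$ uniformly in $v\in[v_1,v_2]$ for any $0<v_1<1<v_2<1/g_\kappa^{\{1\}}(R)$. In particular, for $\theta^*>0$, $$H_N\sim\frac{\exp\{Ng_\kappa(R)\}\cdot\{N(1-g_\kappa^{\{1\}}(R))\}^{\theta^*-1}}{R^N\,\Gamma(\theta^* )},\qquad N\to\infty.$$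
   Context: $(\theta_j)_{j\ge1}$, $(\kappa_j)_{j\ge1}$ are sequences of nonnegative reals; $g_\theta(z)=\sum_{j\ge1}\theta_jz^j/j$, $g_\kappa(z)=\sum_{j\ge1}\kappa_jz^j/j$, $G_N=g_\theta+Ng_\kappa$. $[z^N]F(z)$ is the coefficient of $z^N$ in the power series of $F$ at $0$. $H_N=\frac1{N!}\sum_{\sigma\in S_N}\prod_{j=1}^N(\theta_j+N\kappa_j)^{C_j(\sigma)}$, $C_j(\sigma)$ the number of $j$-cycles of $\sigma$. $g^{\{n\}}(z)=z^ng^{(n)}(z)$, $g_\kappa^{\{n\}}(R):=\lim_{r\uparrow R}g_\kappa^{\{n\}}(r)$. Domain: for $\eta>0$, $\varphi\in(0,\pi/2)$, $\Delta_0=\{z\in\mathbb C:|z|<R|1+\eta e^{i\varphi}|,\ z\ne R,\ |\arg(z-R)|>\varphi\}$ ("some $\Delta_0$" = for some such $\eta,\varphi$). Logs and non-integer powers of $1-z/R$ use principal branches. Standing assumption: $(\kappa_j)$ is non-arithmetic (no integer $j_0>1$ such that $\kappa_j\ne0$ implies $j_0\mid j$) and $\kappa_j>0$ for some $j\ge2$. Uniform asymptotic equivalence means the ratio tends to $1$ uniformly in $v$. *)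

theory Defs
  imports "HOL-Analysis.Analysis" "HOL-Combinatorics.Combinatorics" "HOL-Library.Landau_Symbols"
begin

text \<open>Power series g_a(z) = sum_{j>=1} a_j z^j / j (the j = 0 term vanishes since a 0 / 0 = 0).\<close>
definition gser :: "(nat \<Rightarrow> real) \<Rightarrow> complex \<Rightarrow> complex" where
  "gser a z = (\<Sum>j. complex_of_real (a j / real j) * z ^ j)"

definition Delta0 :: "real \<Rightarrow> real \<Rightarrow> real \<Rightarrow> complex set" where
  "Delta0 R \<eta> \<phi> = {z. norm z < R * norm (1 + complex_of_real \<eta> * exp (\<i> * complex_of_real \<phi>))
                        \<and> z \<noteq> complex_of_real R \<and> \<bar>Arg (z - complex_of_real R)\<bar> > \<phi>}"

definition zcoeff :: "nat \<Rightarrow> (complex \<Rightarrow> complex) \<Rightarrow> complex" where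
  "zcoeff N F = (deriv ^^ N) F 0 / of_nat (fact N)"

definition cycnum :: "nat \<Rightarrow> nat \<Rightarrow> (nat \<Rightarrow> nat) \<Rightarrow> nat" where
  "cycnum N j \<sigma> = card {orbit \<sigma> x | x. x \<in> {1..N} \<and> card (orbit \<sigma> x) = j}"

definition HN :: "(nat \<Rightarrow> real) \<Rightarrow> (nat \<Rightarrow> real) \<Rightarrow> nat \<Rightarrow> real" where
  "HN \<theta> \<kappa> N = (1 / fact N) * (\<Sum>\<sigma> \<in> {\<sigma>. \<sigma> permutes {1..N}}.
       \<Prod>j=1..N. (\<theta> j + real N * \<kappa> j) ^ cycnum N j \<sigma>)"

end

theory Submission
  imports Defs "HOL-Complex_Analysis.Complex_Analysis" "HOL-Real_Asymp.Real_Asymp"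
begin

text \<open>
  In the variable \<open>u\<close> with \<open>z = R e\<^sup>u\<close>, the coefficient is an integral over a vertical segment of
  length \<open>2\<pi>\<close> at abscissa \<open>-1/M\<close>, where \<open>M = N (1 - v c)\<close>. By periodicity and Cauchy's theorem on the
  two convex halves \<open>log_sector k B (\<plusminus>1)\<close> of the plane outside a cone, the segment is deformed into two
  rays leaving \<open>-1/M\<close>, followed by a part on which the integrand is exponentially small: on the
  imaginary axis because \<open>Re (g\<^sub>\<kappa> (R e\<^bsup>iy\<^esup>)) < g\<^sub>\<kappa> (R)\<close> for a non-arithmetic sequence, and from there to
  the rays by a Cauchy estimate for the derivative. After scaling by \<open>M\<close>, the rays yield the Hankel
  integral for \<open>1/\<Gamma>\<close> by dominated convergence; its value is found by running the same argument
  backwards on the binomial series. Uniformity in \<open>v\<close> follows since \<open>v\<close> may vary with \<open>N\<close>.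
  The statement on \<open>H\<^sub>N\<close> is the case \<open>f = 1\<close>, \<open>v = 1\<close>: both \<open>H\<^sub>N\<close> and the coefficients of \<open>exp G\<^sub>N\<close>
  satisfy \<open>n h\<^sub>n = \<Sum> a\<^sub>j h\<^bsub>n-j\<^esub>\<close>, the former by opening up the cycle through a marked point.
\<close>


text \<open>Put \<open>H u = g\<^sub>\<kappa> (R * exp u) - g\<^sub>\<kappa> (R)\<close>. The
  exponent \<open>N * (v * H u - u)\<close> is close to \<open>- M * u\<close> near 0, because
  \<open>H u\<close> is close to \<open>c * u\<close> and \<open>v * c < 1\<close>. So there is no
  saddle point: the singularity at 0 dominates, at scale \<open>1/M\<close>. The obstacle is the
  passage from that scale to the rest of the contour. The hypotheses give only
  \<open>H u - c * u = o(u)\<close>, and the negativity of \<open>Re (H u)\<close> on the imaginary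
  axis comes without a rate as the point approaches 0. Hence the rays are followed up to a small
  height independent of \<open>N\<close>, where the error \<open>o(u)\<close> costs only part of the
  exponential decay. On the way back to the axis it is the derivative of the error that has to be
  controlled, not its size. The rays have slope \<open>k + 1\<close>, where \<open>k\<close> is the
  slope of the removed cone, so that discs for the Cauchy estimate fit between ray and cone. Limits
  are stated as differences tending to 0, because the exponent
  \<open>v * \<theta>s + \<beta>\<close> moves with \<open>N\<close>; a ratio is formed only at the
  end, with the help of a bound for \<open>Gamma\<close>.\<close>

section \<open>Logarithmic sectors\<close>

text \<open>Despite its name a convex polygon: with \<open>s = \<plusminus>1\<close>, its image under \<open>exp\<close> misses the cone
  with vertex 1 and half-angle \<open>arctan k\<close>.\<close>

definition log_sector :: "real \<Rightarrow> real \<Rightarrow> real \<Rightarrow> complex set" where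
  "log_sector k B s = {u. Re u < B \<and> s * Im u < 3 * pi / 2 \<and> k * Re u < s * Im u}"

lemma log_sector_eq_halfspaces:
  "log_sector k B s = {u. inner 1 u < B} \<inter> {u. inner (Complex 0 s) u < 3 * pi / 2}
     \<inter> {u. inner (Complex k (- s)) u < 0}"
  by (auto simp: log_sector_def inner_complex_def)

lemma open_log_sector: "open (log_sector k B s)"
  unfolding log_sector_eq_halfspaces by (intro open_Int open_halfspace_lt)

lemma convex_log_sector: "convex (log_sector k B s)"
  unfolding log_sector_eq_halfspaces by (intro convex_Int convex_halfspace_lt)

text \<open>With \<open>q = 1 / k\<close> this concerns the logarithmic spiral
  \<open>exp (q * y + \<i> * y)\<close>, the image of the line of slope \<open>k\<close>. It stays
  on one side of its tangent at 1, the line \<open>Re - q * Im = 1\<close>, which carries an edge of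
  the cone.\<close>

lemma exp_mult_cos_minus_sin_le_1:
  fixes q y :: real
  assumes "0 \<le> y" "y \<le> pi"
  shows "exp (q * y) * (cos y - q * sin y) \<le> 1"
proof -
  let ?g = "\<lambda>y. exp (q * y) * (cos y - q * sin y)"
  have "?g y \<le> ?g 0"
  proof (rule DERIV_nonpos_imp_nonincreasing[OF assms(1)])
    fix x assume x: "0 \<le> x" "x \<le> y"
    have "(?g has_real_derivative - ((1 + q\<^sup>2) * exp (q * x) * sin x)) (at x)"
      by (auto intro!: derivative_eq_intros simp: algebra_simps power2_eq_square)
    moreover have "0 \<le> sin x" using x assms by (intro sin_ge_zero) auto
    ultimately show "\<exists>d. (?g has_real_derivative d) (at x) \<and> d \<le> 0"
      by (intro exI conjI) (auto intro!: mult_nonneg_nonneg add_nonneg_nonneg)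
  qed
  then show ?thesis by simp
qed

text \<open>A point of the cone has \<open>exp x * cos y \<ge> 1\<close>, which forces
  \<open>x \<ge> 0\<close> and then \<open>0 < y \<le> pi\<close>. There \<open>x < q * y\<close>
  gives it a smaller modulus than the spiral has at the same argument, so it lies strictly on the
  wrong side of the tangent that bounds the cone.\<close>

lemma exp_log_sector_avoids_cone:
  assumes u: "u \<in> log_sector k B s" and s: "s = 1 \<or> s = -1" and k: "k > 0"
  shows "\<not> \<bar>Im (exp u)\<bar> \<le> k * (Re (exp u) - 1)"
proof
  assume le: "\<bar>Im (exp u)\<bar> \<le> k * (Re (exp u) - 1)"
  define x y where "x = Re u" and "y = s * Im u"
  have xy: "y < 3 * pi / 2" "k * x < y" using u by (auto simp: log_sector_def x_def y_def)
  have re: "Re (exp u) = exp x * cos y" using s by (auto simp: Re_exp x_def y_def)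
  have im: "\<bar>Im (exp u)\<bar> = exp x * \<bar>sin y\<bar>" using s by (auto simp: Im_exp x_def y_def abs_mult)
  have "0 \<le> k * (exp x * cos y - 1)" using le im re
    by (metis abs_ge_zero order_trans)
  then have c1: "1 \<le> exp x * cos y" using k by (simp add: zero_le_mult_iff)
  have x0: "x \<ge> 0"
  proof (rule ccontr)
    assume "\<not> x \<ge> 0"
    then have "exp x < 1" by simp
    moreover have "exp x * cos y \<le> exp x" using mult_left_mono[of "cos y" 1 "exp x"] by simp
    ultimately show False using c1 by linarith
  qed
  then have y0: "y > 0" using xy(2) k by (meson le_less_trans mult_nonneg_nonneg less_imp_le)
  have cpos: "cos y > 0" using c1 by (metis exp_gt_zero less_le_trans zero_less_mult_pos zero_less_one)
  \<comment> \<open>The bound \<open>3 * pi / 2\<close> in \<open>log_sector\<close> exceeds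
    \<open>pi\<close>, so that points of height \<open>\<plusminus>pi\<close> can be interior, and
    is small enough that \<open>cos\<close> is negative from \<open>pi\<close> up to it.\<close>
  have y1: "y \<le> pi"
  proof (rule ccontr)
    assume "\<not> y \<le> pi"
    then have "cos (y - pi) > 0" using xy by (intro cos_gt_zero_pi) auto
    then show False using cpos by simp
  qed
  define q where "q = 1 / k"
  have "exp x * sin y \<le> k * (exp x * cos y - 1)"
    using le im re by (smt (verit) abs_ge_self exp_ge_zero mult_left_mono)
  then have a: "1 \<le> exp x * (cos y - q * sin y)" using k by (simp add: q_def field_simps)
  then have pos: "cos y - q * sin y > 0" by (metis exp_gt_zero less_le_trans zero_less_mult_pos zero_less_one)
  have "x < q * y" using xy k by (simp add: q_def field_simps)
  then have "exp x * (cos y - q * sin y) < exp (q * y) * (cos y - q * sin y)" using pos by simp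
  also have "\<dots> \<le> 1" using y0 y1 by (intro exp_mult_cos_minus_sin_le_1) auto
  finally show False using a by simp
qed

text \<open>The branch cut, where \<open>exp u\<close> is real and at least 1, is the axis of the
  excluded cone. Hence \<open>Ln (1 - exp u)\<close> is holomorphic on the whole sector.\<close>

lemma exp_log_sector_notin_nonpos:
  assumes u: "u \<in> log_sector k B s" and s: "s = 1 \<or> s = -1" and k: "k > 0"
  shows "1 - exp u \<notin> \<real>\<^sub>\<le>\<^sub>0"
  using exp_log_sector_avoids_cone[OF assms] k
  by (auto simp: complex_nonpos_Reals_iff mult_nonneg_nonneg)

section \<open>The domain \<open>Delta0\<close> in the logarithmic variable\<close>

lemma Arg_le_imp_cone:
  assumes "\<bar>Arg w\<bar> \<le> \<phi>" "\<phi> < pi / 2" "w \<noteq> 0"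
  shows "\<bar>Im w\<bar> \<le> tan \<phi> * Re w"
proof -
  have w: "w = of_real (cmod w) * exp (\<i> * of_real (Arg w))"
    using Arg_eq[OF assms(3)] .
  have re: "Re w = cmod w * cos (Arg w)" by (subst w) (simp add: Re_exp)
  have im: "Im w = cmod w * sin (Arg w)" by (subst w) (simp add: Im_exp)
  have c: "cos (Arg w) > 0" using assms by (intro cos_gt_zero_pi) auto
  have "\<bar>tan (Arg w)\<bar> \<le> tan \<phi>"
    using assms by (smt (verit) tan_minus tan_mono_le)
  then have "\<bar>sin (Arg w)\<bar> \<le> tan \<phi> * cos (Arg w)"
    using c by (simp add: tan_def field_simps abs_mult)
  then have "cmod w * \<bar>sin (Arg w)\<bar> \<le> cmod w * (tan \<phi> * cos (Arg w))" by (intro mult_left_mono) auto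
  then show ?thesis by (simp add: re im abs_mult mult_ac)
qed

text \<open>The second part makes the bound \<open>B\<close> of the sectors positive:
  \<open>B\<close> will be the logarithm of the outer radius of the domain divided by
  \<open>R\<close>.\<close>

lemma ball_subset_Delta0:
  assumes "R > 0" "\<eta> > 0" "0 < \<phi>" "\<phi> < pi / 2"
  shows "ball 0 R \<subseteq> Delta0 R \<eta> \<phi>"
    and "0 < ln (norm (1 + complex_of_real \<eta> * exp (\<i> * complex_of_real \<phi>)))"
proof -
  let ?n = "norm (1 + complex_of_real \<eta> * exp (\<i> * complex_of_real \<phi>))"
  have "1 < Re (1 + complex_of_real \<eta> * exp (\<i> * complex_of_real \<phi>))"
    using assms cos_gt_zero_pi[of \<phi>] by (simp add: Re_exp)
  also have "\<dots> \<le> ?n" by (rule complex_Re_le_cmod)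
  finally have n: "1 < ?n" .
  then show "0 < ln ?n" by (rule ln_gt_zero)
  show "ball 0 R \<subseteq> Delta0 R \<eta> \<phi>"
  proof
    fix z :: complex assume "z \<in> ball 0 R"
    then have z: "cmod z < R" by simp
    have "Re z < R" using z complex_Re_le_cmod[of z] by linarith
    then have ne: "z - complex_of_real R \<noteq> 0" and re: "Re (z - of_real R) < 0" by auto
    have t: "tan \<phi> > 0" using assms by (intro tan_gt_zero) auto
    have "\<not> \<bar>Arg (z - complex_of_real R)\<bar> \<le> \<phi>"
      using Arg_le_imp_cone[OF _ assms(4) ne] re t
      by (smt (verit) mult_less_0_iff)
    moreover have "R * 1 < R * ?n" using n assms by (intro mult_strict_left_mono) auto
    ultimately show "z \<in> Delta0 R \<eta> \<phi>" using z ne by (auto simp: Delta0_def)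
  qed
qed

lemma exp_log_sector_in_Delta0:
  assumes "R > 0" "\<eta> > 0" "0 < \<phi>" "\<phi> < pi / 2"
    and "u \<in> log_sector (tan \<phi>) (ln (norm (1 + complex_of_real \<eta> * exp (\<i> * complex_of_real \<phi>)))) s"
    and "s = 1 \<or> s = -1"
  shows "of_real R * exp u \<in> Delta0 R \<eta> \<phi>"
proof -
  let ?n = "norm (1 + complex_of_real \<eta> * exp (\<i> * complex_of_real \<phi>))"
  have t: "tan \<phi> > 0" using assms by (intro tan_gt_zero) auto
  note nc = exp_log_sector_avoids_cone[OF assms(5,6) t]
  have n0: "?n > 0" using ball_subset_Delta0(2)[OF assms(1-4)]
    by (metis ln_0 less_irrefl norm_eq_zero zero_less_norm_iff)
  have "Re u < ln ?n" using assms(5) by (simp add: log_sector_def)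
  then have "exp (Re u) < ?n" using n0 by (metis exp_less_mono exp_ln)
  then have 1: "norm (of_real R * exp u) < R * ?n" using assms(1) by (simp add: norm_mult)
  have ne: "exp u \<noteq> 1" using nc by auto
  have ne': "of_real R * exp u - complex_of_real R \<noteq> 0" using ne assms(1) by auto
  have "\<not> \<bar>Arg (of_real R * exp u - complex_of_real R)\<bar> \<le> \<phi>"
  proof
    assume "\<bar>Arg (of_real R * exp u - complex_of_real R)\<bar> \<le> \<phi>"
    from Arg_le_imp_cone[OF this assms(4) ne'] have "R * \<bar>Im (exp u)\<bar> \<le> R * (tan \<phi> * (Re (exp u) - 1))"
      using assms(1) by (simp add: abs_mult algebra_simps)
    then show False using nc assms(1) by simp
  qed
  then show ?thesis using 1 ne' by (auto simp: Delta0_def)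
qed

section \<open>Cycle sums of permutations\<close>

lemma prod_pow_cycnum:
  fixes a :: "nat \<Rightarrow> 'a::comm_semiring_1"
  assumes p: "p permutes {1..N}"
  shows "(\<Prod>j=1..N. a j ^ cycnum N j p) = (\<Prod>C\<in>orbit p ` {1..N}. a (card C))"
proof -
  have perm: "permutation p" using p by (auto simp: permutation_permutes)
  have card: "card C \<in> {1..N}" if C: "C \<in> orbit p ` {1..N}" for C
  proof -
    obtain x where x: "x \<in> {1..N}" "C = orbit p x" using C by (auto elim!: imageE)
    have "C \<subseteq> {1..N}" using permutes_orbit_subset[OF p x(1)] x by simp
    moreover have "C \<noteq> {}" using x permutation_self_in_orbit[OF perm] by auto
    ultimately show ?thesis
      using card_mono[of "{1..N}" C] by (auto simp: Suc_le_eq card_gt_0_iff intro: finite_subset)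
  qed
  have "(\<Prod>C\<in>orbit p ` {1..N}. a (card C)) =
      (\<Prod>j\<in>{1..N}. \<Prod>C\<in>{C\<in>orbit p ` {1..N}. card C = j}. a (card C))"
    using card by (intro prod.group[symmetric]) auto
  also have "\<dots> = (\<Prod>j\<in>{1..N}. a j ^ cycnum N j p)"
  proof (rule prod.cong[OF refl])
    fix j
    have "{C\<in>orbit p ` {1..N}. card C = j} = {orbit p x | x. x \<in> {1..N} \<and> card (orbit p x) = j}"
      by auto
    then have "cycnum N j p = card {C\<in>orbit p ` {1..N}. card C = j}"
      unfolding cycnum_def by simp
    moreover have "(\<Prod>C\<in>{C\<in>orbit p ` {1..N}. card C = j}. a (card C)) =
        (\<Prod>C\<in>{C\<in>orbit p ` {1..N}. card C = j}. a j)"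
      by (rule prod.cong) auto
    ultimately show "(\<Prod>C\<in>{C\<in>orbit p ` {1..N}. card C = j}. a (card C)) = a j ^ cycnum N j p"
      by simp
  qed
  finally show ?thesis by simp
qed

text \<open>The ground set is arbitrary because the recursion deletes points from it. Cycles are
  orbits as sets, so the image removes repetitions and each cycle contributes once.\<close>

definition cycle_sum :: "(nat \<Rightarrow> 'b::comm_ring_1) \<Rightarrow> 'a set \<Rightarrow> 'b" where
  "cycle_sum a S = (\<Sum>p | p permutes S. \<Prod>C\<in>orbit p ` S. a (card C))"

text \<open>Only permutations whose cycle through \<open>x\<close> has length \<open>j\<close> are counted, and that cycle carries no weight.\<close>

definition marked_sum :: "(nat \<Rightarrow> 'b::comm_ring_1) \<Rightarrow> nat \<Rightarrow> 'a set \<Rightarrow> 'a \<Rightarrow> 'b" where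
  "marked_sum a j S x =
     (\<Sum>p | p permutes S \<and> card (orbit p x) = j. \<Prod>C\<in>orbit p ` (S - orbit p x). a (card C))"

text \<open>Here \<open>q\<close> fixes \<open>y\<close>, and \<open>p\<close> arises by inserting
  \<open>y\<close> directly after \<open>x\<close> into the cycle of \<open>x\<close>:
  \<open>x\<close> goes to \<open>y\<close> and \<open>y\<close> to \<open>q x\<close>, while all
  other points move as under \<open>q\<close>. Composing with the same transposition deletes
  \<open>y\<close> again.\<close>

context
  fixes S :: "'a set" and p q :: "'a \<Rightarrow> 'a" and x y :: 'a
  assumes fin: "finite S" and xS: "x \<in> S" and yS: "y \<in> S" and xy: "x \<noteq> y"
    and q: "q permutes (S - {y})" and p_def: "p = q \<circ> Transposition.transpose x y"
begin

lemma insert_in_cycle_apply: "p x = y" "p y = q x" "z \<noteq> x \<Longrightarrow> z \<noteq> y \<Longrightarrow> p z = q z"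
  using q by (auto simp: p_def permutes_def Transposition.transpose_def)

lemma insert_in_cycle_permutes: "p permutes S"
  unfolding p_def
  by (intro permutes_compose permutes_swap_id xS yS permutes_subset[OF q]) auto

lemma orbit_insert_in_cycle: "orbit p x = insert y (orbit q x)"
proof
  have sub: "orbit q x \<subseteq> S - {y}" using permutes_orbit_subset[OF q] xS xy by auto
  show "orbit p x \<subseteq> insert y (orbit q x)"
  proof
    fix w assume "w \<in> orbit p x"
    then show "w \<in> insert y (orbit q x)"
    proof induction
      case (step w)
      consider "w = x" | "w = y" | "w \<noteq> x" "w \<noteq> y" by blast
      then show ?case
      proof cases
        case 3
        then have "w \<in> orbit q x" using step by simp
        then show ?thesis using insert_in_cycle_apply(3)[OF 3] by (simp add: orbit.step)
      qed (use insert_in_cycle_apply orbit.base[of q x] in auto)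
    qed (simp add: insert_in_cycle_apply)
  qed
  have y: "y \<in> orbit p x" using orbit.base[of p x] by (simp add: insert_in_cycle_apply)
  have qx: "q x \<in> orbit p x" using orbit.step[OF y] by (simp add: insert_in_cycle_apply)
  have "w \<in> orbit p x" if "w \<in> orbit q x" for w
    using that
  proof induction
    case (step w)
    then have "w \<noteq> y" using sub by auto
    with step show ?case using insert_in_cycle_apply(3)[of w] qx
      by (metis orbit.step)
  qed (rule qx)
  then show "insert y (orbit q x) \<subseteq> orbit p x" using y by auto
qed

lemma card_orbit_insert_in_cycle: "card (orbit p x) = Suc (card (orbit q x))"
proof -
  have "orbit q x \<subseteq> S - {y}" using permutes_orbit_subset[OF q] xS xy by auto
  moreover from this have "finite (orbit q x)" using fin by (auto intro: finite_subset)
  ultimately show ?thesis by (subst orbit_insert_in_cycle) (auto simp: card_insert_if)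
qed

lemma orbit_insert_in_cycle_other:
  assumes "z \<notin> orbit p x" "z \<in> S"
  shows "orbit p z = orbit q z"
proof -
  have perm: "permutation q" using q fin by (auto simp: permutation_permutes)
  have z: "z \<in> S - {y}" "z \<notin> orbit q x" using assms by (auto simp: orbit_insert_in_cycle)
  have sub: "orbit q z \<subseteq> S - {y}" using permutes_orbit_subset[OF q z(1)] .
  have "x \<notin> orbit q z"
    using orbit_swap[OF permutation_self_in_orbit[OF perm], of x z] z by auto
  then have eq: "q w = p w" if "w \<in> orbit q z" for w
    using that sub insert_in_cycle_apply(3)[of w] by fastforce
  have "q \<in> orbit q z \<rightarrow> orbit q z" by (simp add: orbit.step)
  then have "orbit q z = orbit p z"
    by (rule orbit_cong0[OF permutation_self_in_orbit[OF perm]]) (rule eq)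
  then show ?thesis by simp
qed

lemma prod_insert_in_cycle:
  "(\<Prod>C\<in>orbit p ` (S - orbit p x). a (card C)) =
   (\<Prod>C\<in>orbit q ` (S - {y} - orbit q x). a (card C))"
proof (rule prod.cong[OF _ refl])
  have "orbit p ` (S - orbit p x) = orbit q ` (S - orbit p x)"
    using orbit_insert_in_cycle_other by (intro image_cong refl) auto
  moreover have "orbit q ` (S - orbit p x) = orbit q ` (S - {y} - orbit q x)"
    by (rule arg_cong[of _ _ "image (orbit q)"]) (auto simp: orbit_insert_in_cycle)
  ultimately show "orbit p ` (S - orbit p x) = orbit q ` (S - {y} - orbit q x)"
    by (rule trans)
qed

end

lemma marked_sum_1:
  assumes "finite S" "x \<in> S"
  shows "marked_sum a 1 S x = cycle_sum a (S - {x})"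
proof -
  have eq: "{p. p permutes S \<and> card (orbit p x) = 1} = {p. p permutes (S - {x})}"
  proof (intro set_eqI iffI CollectI; elim CollectE)
    fix p assume p: "p permutes S \<and> card (orbit p x) = 1"
    then have "x \<in> orbit p x" using assms by (intro permutation_self_in_orbit) (auto simp: permutation_permutes)
    moreover obtain y where "orbit p x = {y}" using p by (meson card_1_singletonE)
    ultimately have "orbit p x = {x}" by (metis singletonD)
    then have "p x = x" by (simp only: orbit_eq_singleton_iff)
    show "p permutes (S - {x})" by (rule permutes_superset[of p S]) (use p \<open>p x = x\<close> in simp_all)
  next
    fix p assume p: "p permutes (S - {x})"
    then have "p x = x" by (auto simp: permutes_def)
    then have "orbit p x = {x}" by (simp add: orbit_eq_singleton_iff)
    then show "p permutes S \<and> card (orbit p x) = 1" using permutes_subset[OF p, of S] by auto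
  qed
  show ?thesis unfolding marked_sum_def cycle_sum_def eq
  proof (rule sum.cong[OF refl])
    fix p assume "p \<in> {p. p permutes (S - {x})}"
    then have "p x = x" by (auto simp: permutes_def)
    then have "orbit p x = {x}" by (simp add: orbit_eq_singleton_iff)
    then show "(\<Prod>C\<in>orbit p ` (S - orbit p x). a (card C)) = (\<Prod>C\<in>orbit p ` (S - {x}). a (card C))"
      by simp
  qed
qed

text \<open>A permutation whose cycle through \<open>x\<close> has length at least 2 is determined
  by \<open>y = p x\<close> and by the permutation of \<open>S - {y}\<close> left when
  \<open>y\<close> is deleted from the cycle. This shortens the cycle by one and keeps the weights
  of all others. The bound on \<open>j\<close> makes the cycle long enough for
  \<open>p x \<noteq> x\<close>.\<close>

lemma marked_sum_Suc:
  assumes fin: "finite S" and x: "x \<in> S" and j: "j \<ge> 1"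
  shows "marked_sum a (Suc j) S x = (\<Sum>y\<in>S - {x}. marked_sum a j (S - {y}) x)"
proof -
  have ap: "p x \<in> S - {x}" if p: "p permutes S" "card (orbit p x) = Suc j" for p
  proof -
    have "p x \<noteq> x"
    proof
      assume "p x = x"
      then have "orbit p x = {x}" by (simp add: orbit_eq_singleton_iff)
      then show False using p j by simp
    qed
    then show ?thesis using p x by (auto simp: permutes_in_image)
  qed
  have inv: "(p \<circ> Transposition.transpose x (p x)) permutes (S - {p x})" if p: "p permutes S" for p
  proof (rule permutes_superset[of _ S])
    show "p \<circ> Transposition.transpose x (p x) permutes S"
      using p x by (intro permutes_compose permutes_swap_id) (auto simp: permutes_in_image)
  qed auto
  have "(\<Sum>y\<in>S - {x}. marked_sum a j (S - {y}) x) =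
     (\<Sum>(y, q)\<in>(SIGMA y:S - {x}. {q. q permutes (S - {y}) \<and> card (orbit q x) = j}).
         \<Prod>C\<in>orbit q ` (S - {y} - orbit q x). a (card C))"
    unfolding marked_sum_def using fin
    by (intro sum.Sigma) (auto intro: finite_subset[OF _ finite_permutations])
  also have "\<dots> = marked_sum a (Suc j) S x"
    unfolding marked_sum_def
  proof (rule sum.reindex_bij_witness[of _ "\<lambda>p. (p x, p \<circ> Transposition.transpose x (p x))" "\<lambda>(y, q). q \<circ> Transposition.transpose x y"], goal_cases)
    case (1 b)
    then obtain y q where b: "b = (y, q)" "y \<in> S - {x}" "q permutes (S - {y})" by auto
    have "q y = y" using b by (auto simp: permutes_def)
    then show ?case using b by (auto simp: fun_eq_iff)
  next
    case (2 b)
    then obtain y q where b: "b = (y, q)" "y \<in> S - {x}" "q permutes (S - {y})" "card (orbit q x) = j" by auto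
    have y: "y \<in> S" "x \<noteq> y" using b by auto
    show ?case
      using insert_in_cycle_permutes[OF fin x y b(3) refl] card_orbit_insert_in_cycle[OF fin x y b(3) refl] b(1,4)
      by simp
  next
    case (3 p)
    then show ?case by (auto simp: fun_eq_iff)
  next
    case (4 p)
    then have p: "p permutes S" "card (orbit p x) = Suc j" by auto
    have "p = (p \<circ> Transposition.transpose x (p x)) \<circ> Transposition.transpose x (p x)" by (simp add: fun_eq_iff)
    from card_orbit_insert_in_cycle[OF fin x _ _ inv[OF p(1)] this] ap[OF p] p(2)
    have "card (orbit (p \<circ> Transposition.transpose x (p x)) x) = j" by auto
    then show ?case using ap[OF p] inv[OF p(1)] by simp
  next
    case (5 b)
    then obtain y q where b: "b = (y, q)" "y \<in> S - {x}" "q permutes (S - {y})" by auto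
    have y: "y \<in> S" "x \<noteq> y" using b by auto
    show ?case using prod_insert_in_cycle[OF fin x y b(3) refl] b(1) by simp
  qed
  finally show ?thesis by simp
qed

lemma cycle_sum_conv_marked_sum:
  assumes fin: "finite S" and x: "x \<in> S"
  shows "cycle_sum a S = (\<Sum>j=1..card S. a j * marked_sum a j S x)"
proof -
  have card: "card (orbit p x) \<in> {1..card S}" if "p permutes S" for p
  proof -
    have "x \<in> orbit p x" using fin that by (intro permutation_self_in_orbit) (auto simp: permutation_permutes)
    moreover have "orbit p x \<subseteq> S" using permutes_orbit_subset[OF that x] .
    ultimately show ?thesis using fin card_mono[of S "orbit p x"]
      by (auto simp: Suc_le_eq card_gt_0_iff intro: finite_subset)
  qed
  have split: "(\<Prod>C\<in>orbit p ` S. a (card C)) =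
      a (card (orbit p x)) * (\<Prod>C\<in>orbit p ` (S - orbit p x). a (card C))" if p: "p permutes S" for p
  proof -
    have perm: "permutation p" using fin p by (auto simp: permutation_permutes)
    have self: "z \<in> orbit p z" for z by (rule permutation_self_in_orbit[OF perm])
    have "orbit p z \<in> insert (orbit p x) (orbit p ` (S - orbit p x))" if "z \<in> S" for z
      using that orbit_cyclic_eq3[OF cyclic_on_orbit'[OF perm], of z x]
      by (cases "z \<in> orbit p x") auto
    then have "orbit p ` S = insert (orbit p x) (orbit p ` (S - orbit p x))" using x by auto
    moreover have "orbit p x \<notin> orbit p ` (S - orbit p x)" using self by auto
    ultimately show ?thesis using fin by simp
  qed
  have "cycle_sum a S = (\<Sum>j=1..card S. \<Sum>p | p \<in> {p. p permutes S} \<and> card (orbit p x) = j.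
      \<Prod>C\<in>orbit p ` S. a (card C))"
    unfolding cycle_sum_def using card fin
    by (intro sum.group[symmetric]) (auto simp: finite_permutations)
  also have "\<dots> = (\<Sum>j=1..card S. a j * marked_sum a j S x)"
    unfolding marked_sum_def sum_distrib_left by (intro sum.cong) (auto simp: split)
  finally show ?thesis .
qed

text \<open>Let \<open>n = card S\<close>. A cycle of length \<open>j\<close> through a marked point
  can be chosen in \<open>(n-1)...(n-j+1)\<close> ways, and the rest contributes
  \<open>(n-j)!\<close> times \<open>c (n-j)\<close>. The product of the counts is
  \<open>(n-1)!\<close> for every \<open>j\<close>, which leaves exactly the recursion of
  \<open>c\<close>.\<close>

lemma cycle_sum_eq:
  fixes a c :: "nat \<Rightarrow> 'b::field_char_0"
  assumes c0: "c 0 = 1" and c: "\<And>n. of_nat (Suc n) * c (Suc n) = (\<Sum>i\<le>n. a (Suc i) * c (n - i))"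
    and fin: "finite S"
  shows "cycle_sum a S = fact (card S) * c (card S)"
  using fin
proof (induction "card S" arbitrary: S rule: less_induct)
  case less
  show ?case
  proof (cases "S = {}")
    case True
    then show ?thesis using c0 by (simp add: cycle_sum_def)
  next
    case False
    then obtain x where x: "x \<in> S" by auto
    \<comment> \<open>The induction on \<open>j\<close> deletes points, hence the claim for all
      subsets \<open>T\<close>. Only its base case calls the outer hypothesis, for
      \<open>T - {y}\<close>, which is smaller than \<open>S\<close> even when
      \<open>T = S\<close>.\<close>
    have marked: "marked_sum a j T y = fact (card T - 1) * c (card T - j)"
      if "T \<subseteq> S" "y \<in> T" "1 \<le> j" "j \<le> card T" for j T y
      using that(3,1,2,4)
    proof (induction j arbitrary: T rule: dec_induct)
      case base
      then have "finite T" using less.prems by (auto intro: finite_subset)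
      then have "card (T - {y}) < card T" "card T \<le> card S" and card: "card (T - {y}) = card T - 1"
        using base less.prems by (auto intro: card_mono psubset_card_mono simp: card_Diff1_less)
      then have "cycle_sum a (T - {y}) = fact (card (T - {y})) * c (card (T - {y}))"
        using \<open>finite T\<close> by (intro less.hyps) auto
      then show ?case unfolding marked_sum_1[OF \<open>finite T\<close> base(2)] card .
    next
      case (step j)
      have fT: "finite T" using step less.prems by (auto intro: finite_subset)
      have "marked_sum a (Suc j) T y = (\<Sum>z\<in>T - {y}. marked_sum a j (T - {z}) y)"
        using marked_sum_Suc[OF fT \<open>y \<in> T\<close>] step by simp
      also have "\<dots> = (\<Sum>z\<in>T - {y}. fact (card T - 2) * c (card T - Suc j))"
      proof (rule sum.cong[OF refl])
        fix z assume z: "z \<in> T - {y}"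
        then have "card (T - {z}) = card T - 1" using fT by (simp add: card_Diff_singleton)
        moreover have "T - {z} \<subseteq> S" "y \<in> T - {z}" "j \<le> card T - 1" using step.prems z by auto
        ultimately show "marked_sum a j (T - {z}) y = fact (card T - 2) * c (card T - Suc j)"
          using step.IH[of "T - {z}"] by (simp add: numeral_2_eq_2)
      qed
      also have "\<dots> = of_nat (card T - 1) * (fact (card T - 2) * c (card T - Suc j))"
        using fT step by (simp add: card_Diff_singleton)
      also have "\<dots> = fact (card T - 1) * c (card T - Suc j)"
      proof -
        have "(fact (card T - 1) :: 'b) = of_nat (card T - 1) * fact (card T - 2)"
          using step by (subst fact_reduce) (auto simp: numeral_2_eq_2)
        then show ?thesis by (simp add: mult.assoc)
      qed
      finally show ?case .
    qed
    obtain n where n: "card S = Suc n" using False less.prems by (metis card_eq_0_iff not0_implies_Suc)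
    have "cycle_sum a S = (\<Sum>j=1..card S. a j * (fact (card S - 1) * c (card S - j)))"
      unfolding cycle_sum_conv_marked_sum[OF less.prems x]
      by (intro sum.cong refl arg_cong2[where f = "(*)"] marked) (use x in auto)
    also have "\<dots> = fact n * (\<Sum>i\<le>n. a (Suc i) * c (n - i))"
      unfolding n sum_distrib_left
      by (rule sum.reindex_bij_witness[of _ Suc "\<lambda>j. j - 1"]) (auto simp: mult_ac)
    also have "\<dots> = fact (card S) * c (card S)"
      by (subst c[symmetric]) (simp add: n algebra_simps)
    finally show ?thesis .
  qed
qed

section \<open>The exponential formula for the generating function\<close>

lemma fps_nth_exp_compose_rec:
  fixes a :: "nat \<Rightarrow> 'b::field_char_0"
  defines "A \<equiv> Abs_fps (\<lambda>j. a j / of_nat j)"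
  shows "of_nat (Suc n) * fps_nth (fps_exp 1 oo A) (Suc n) =
           (\<Sum>i\<le>n. a (Suc i) * fps_nth (fps_exp 1 oo A) (n - i))"
proof -
  have A0: "fps_nth A 0 = 0" by (simp add: A_def)
  have "of_nat (Suc n) * fps_nth (fps_exp 1 oo A) (Suc n) = fps_nth (fps_deriv (fps_exp 1 oo A)) n"
    by simp
  also have "fps_deriv (fps_exp 1 oo A) = fps_deriv A * (fps_exp 1 oo A)"
    by (subst fps_compose_deriv[OF A0]) (simp add: mult.commute)
  also have "fps_nth \<dots> n = (\<Sum>i\<le>n. a (Suc i) * fps_nth (fps_exp 1 oo A) (n - i))"
    unfolding fps_mult_nth atMost_atLeast0
    by (intro sum.cong refl) (simp add: A_def del: of_nat_Suc)
  finally show ?thesis .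
qed

lemma gser_eq_eval_fps:
  "gser a z = eval_fps (Abs_fps (\<lambda>j. complex_of_real (a j) / of_nat j)) z"
  by (simp add: gser_def eval_fps_def)

lemma has_fps_expansion_gser:
  assumes "conv_radius (\<lambda>j. a j / real j) = ereal R" "R > 0"
  shows "gser a has_fps_expansion Abs_fps (\<lambda>j. complex_of_real (a j) / of_nat j)"
proof -
  have "fps_conv_radius (Abs_fps (\<lambda>j. complex_of_real (a j) / of_nat j)) = ereal R"
    unfolding fps_conv_radius_def assms(1)[symmetric] conv_radius_altdef by (simp add: norm_divide)
  then show ?thesis using assms by (auto simp: has_fps_expansion_def gser_eq_eval_fps)
qed

text \<open>The weights \<open>\<theta> j + N * \<kappa> j\<close> depend on \<open>N\<close>, so
  they are frozen in \<open>a\<close> and the recursion runs over ground sets of every size with the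
  same weights; only then is the size set to \<open>N\<close>.\<close>

lemma HN_eq_zcoeff:
  assumes th: "conv_radius (\<lambda>j. \<theta> j / real j) = ereal R" and ka: "conv_radius (\<lambda>j. \<kappa> j / real j) = ereal R"
    and R: "R > 0"
  shows "complex_of_real (HN \<theta> \<kappa> N) = zcoeff N (\<lambda>z. exp (gser \<theta> z + of_nat N * gser \<kappa> z))"
proof -
  define a where "a = (\<lambda>j. complex_of_real (\<theta> j) + of_nat N * of_real (\<kappa> j))"
  define A where "A = Abs_fps (\<lambda>j. a j / of_nat j)"
  define c where "c = fps_nth (fps_exp 1 oo A)"
  have "complex_of_real (HN \<theta> \<kappa> N) = (1 / fact N) * cycle_sum a {1..N}"
    unfolding HN_def cycle_sum_def of_real_mult of_real_sum
  proof (intro arg_cong2[where f = "(*)"] sum.cong refl)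
    fix p assume "p \<in> {p. p permutes {1..N}}"
    then have "(\<Prod>j=1..N. a j ^ cycnum N j p) = (\<Prod>C\<in>orbit p ` {1..N}. a (card C))"
      by (intro prod_pow_cycnum) simp
    then show "complex_of_real (\<Prod>j=1..N. (\<theta> j + real N * \<kappa> j) ^ cycnum N j p) = \<dots>"
      by (simp add: a_def)
  qed simp
  also have "cycle_sum a {1..N} = fact N * c N"
    using cycle_sum_eq[of c a "{1..N}"] fps_nth_exp_compose_rec[of _ a]
    by (simp add: c_def A_def)
  also have "1 / fact N * (fact N * c N) = c N" by simp
  also have "c N = zcoeff N (\<lambda>z. exp (gser \<theta> z + of_nat N * gser \<kappa> z))"
  proof -
    have "A = Abs_fps (\<lambda>j. complex_of_real (\<theta> j) / of_nat j)
        + fps_const (of_nat N) * Abs_fps (\<lambda>j. complex_of_real (\<kappa> j) / of_nat j)"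
      by (rule fps_ext) (simp add: A_def a_def add_divide_distrib)
    then have "(\<lambda>z. gser \<theta> z + of_nat N * gser \<kappa> z) has_fps_expansion A"
      using has_fps_expansion_gser[OF th R] has_fps_expansion_gser[OF ka R]
      by (auto intro!: fps_expansion_intros)
    then have "((\<lambda>x. exp x) \<circ> (\<lambda>z. gser \<theta> z + of_nat N * gser \<kappa> z)) has_fps_expansion (fps_exp 1 oo A)"
      by (intro has_fps_expansion_compose fps_expansion_intros) (simp_all add: A_def)
    then show ?thesis
      by (simp add: c_def zcoeff_def o_def fps_nth_fps_expansion)
  qed
  finally show ?thesis .
qed

section \<open>Contour integrals in the logarithmic variable\<close>

text \<open>\<open>circlepath\<close> starts at angle 0, the direction of the singularity. The shift
  moves that direction to the middle of the interval, so that the circle is cut at the opposite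
  point instead.\<close>

lemma has_integral_periodic_shift:
  fixes f :: "real \<Rightarrow> complex"
  assumes per: "\<And>t. f (t + 2 * pi) = f t" and I: "(f has_integral I) {0..2 * pi}"
  shows "(f has_integral I) {-pi..pi}"
proof -
  have int: "f integrable_on {0..2 * pi}" using I by blast
  then obtain I1 I2 where I1: "(f has_integral I1) {0..pi}" and I2: "(f has_integral I2) {pi..2 * pi}"
    using integrable_subinterval_real[OF int, of 0 pi] integrable_subinterval_real[OF int, of pi "2 * pi"]
    by (auto simp: integrable_on_def)
  have "I = I1 + I2"
    using has_integral_combine[OF _ _ I1 I2] I by (auto intro: has_integral_unique)
  have "((\<lambda>t. f (t + 2 * pi)) has_integral I2) {-pi..0}"
    using I2 has_integral_shift_real_ivl_iff[of f I2 pi "2 * pi" "2 * pi"] by simp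
  then have "(f has_integral I2) {-pi..0}" using per by simp
  from has_integral_combine[OF _ _ this I1] \<open>I = I1 + I2\<close> show ?thesis by (simp add: add.commute)
qed

text \<open>Cauchy's formula on the circle of radius \<open>R * exp a\<close> with
  \<open>z = R * exp u\<close>: the form \<open>dz / z ^ (n + 1)\<close> becomes
  \<open>exp (- n * u) du / R ^ n\<close>. The abscissa \<open>a\<close> is free and may therefore
  depend on \<open>n\<close>.\<close>

lemma zcoeff_contour_integral:
  assumes hol: "F holomorphic_on ball 0 R" and R: "R > 0" and a: "a < 0"
  shows "((\<lambda>u. F (of_real R * exp u) * exp (- of_nat n * u)) has_contour_integral
           (2 * pi * \<i> * of_real (R ^ n) * zcoeff n F)) (linepath (Complex a (- pi)) (Complex a pi))"
proof -
  define r where "r = R * exp a"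
  have r: "0 < r" "r < R" using R a by (auto simp: r_def)
  define I where "I = (2 * pi * \<i>) / fact n * (deriv ^^ n) F 0"
  define \<Phi> where "\<Phi> = (\<lambda>u. F (of_real R * exp u) * exp (- of_nat n * u))"
  have "((\<lambda>u. F u / (u - 0) ^ Suc n) has_contour_integral I) (circlepath 0 r)"
    unfolding I_def
  proof (rule Cauchy_has_contour_integral_higher_derivative_circlepath)
    show "continuous_on (cball 0 r) F"
      using r by (intro holomorphic_on_imp_continuous_on holomorphic_on_subset[OF hol]) auto
    show "F holomorphic_on ball 0 r" using r by (intro holomorphic_on_subset[OF hol]) auto
  qed (use r in auto)
  then have "((\<lambda>t. F (r * cis t) / (r * cis t) ^ Suc n * r * \<i> * cis t) has_integral I) {0..2 * pi}"
    unfolding circlepath_def by (subst (asm) has_contour_integral_part_circlepath_iff) auto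
  then have "((\<lambda>t. - \<i> * of_real (R ^ n) * (F (r * cis t) / (r * cis t) ^ Suc n * r * \<i> * cis t))
       has_integral - \<i> * of_real (R ^ n) * I) {0..2 * pi}"
    by (rule has_integral_mult_right)
  also have "(\<lambda>t. - \<i> * of_real (R ^ n) * (F (r * cis t) / (r * cis t) ^ Suc n * r * \<i> * cis t))
      = (\<lambda>t. \<Phi> (Complex a t))"
  proof
    fix t
    have e: "exp (Complex a t) = exp a * cis t" by (simp add: exp_eq_polar)
    have "exp (- of_nat n * Complex a t) = 1 / exp (Complex a t) ^ n"
      by (simp add: exp_minus exp_of_nat_mult inverse_eq_divide)
    then show "- \<i> * of_real (R ^ n) * (F (r * cis t) / (r * cis t) ^ Suc n * r * \<i> * cis t) = \<Phi> (Complex a t)"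
      using R by (simp add: \<Phi>_def e r_def mult.assoc power_mult_distrib field_simps)
  qed
  finally have "((\<lambda>t. \<Phi> (Complex a t)) has_integral - \<i> * of_real (R ^ n) * I) {0..2 * pi}" .
  then have "((\<lambda>t. \<Phi> (Complex a t)) has_integral - \<i> * of_real (R ^ n) * I) {-pi..pi}"
  proof (rule has_integral_periodic_shift[rotated])
    fix t
    have e: "exp (Complex a (t + 2 * pi)) = exp (Complex a t)"
      by (simp add: exp_eq_polar cis.ctr)
    then have "exp (- of_nat n * Complex a (t + 2 * pi)) = exp (- of_nat n * Complex a t)"
      by (simp add: exp_minus exp_of_nat_mult)
    then show "\<Phi> (Complex a (t + 2 * pi)) = \<Phi> (Complex a t)" by (simp add: \<Phi>_def e)
  qed
  then have "(\<Phi> has_contour_integral (of_real (R ^ n) * I)) (linepath (Complex a (- pi)) (Complex a pi))"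
    by (subst has_contour_integral_linepath_same_Re_iff[of _ a _ "-pi" pi]) (auto simp: mult.assoc)
  moreover have "of_real (R ^ n) * I = 2 * pi * \<i> * of_real (R ^ n) * zcoeff n F"
    by (simp add: I_def zcoeff_def)
  ultimately show ?thesis unfolding \<Phi>_def by metis
qed

lemma contour_integral_linepath_translate:
  assumes "\<And>u. f (u + c) = f u"
  shows "contour_integral (linepath (a + c) (b + c)) f = contour_integral (linepath a b) f"
proof -
  have "linepath (a + c) (b + c) x = linepath a b x + c" for x
    by (simp add: linepath_def algebra_simps flip: scaleR_add_left)
  then show ?thesis by (simp add: contour_integral_integral assms)
qed

text \<open>Each half is convex, so \<open>\<Phi>\<close> has a primitive there and integrals depend
  only on the end points. The polygon from \<open>a\<close> over \<open>p s\<close> and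
  \<open>q s\<close> to \<open>Complex x0 (s * pi)\<close> is closed by a horizontal segment to
  \<open>Complex a (s * pi)\<close>; the two such segments differ by the period and cancel. The sign
  \<open>s\<close> accounts for the lower half being traversed towards \<open>a\<close>.\<close>

lemma contour_integral_log_sector:
  assumes hol: "\<And>s. s \<in> {1, -1} \<Longrightarrow> \<Phi> holomorphic_on log_sector k B s"
    and per: "\<And>u. \<Phi> (u + 2 * pi * \<i>) = \<Phi> u" and k: "k > 0"
    and a: "a < 0" "a < B" and x0: "x0 < B" "k * x0 < pi"
    and p: "\<And>s. s \<in> {1, -1} \<Longrightarrow> p s \<in> log_sector k B s"
    and q: "\<And>s. s \<in> {1, -1} \<Longrightarrow> q s \<in> log_sector k B s"
  shows "contour_integral (linepath (Complex a (- pi)) (Complex a pi)) \<Phi> =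
    (\<Sum>s\<in>{1, -1}. of_real s * (contour_integral (linepath (of_real a) (p s)) \<Phi> +
        contour_integral (linepath (p s) (q s)) \<Phi> + contour_integral (linepath (q s) (Complex x0 (s * pi))) \<Phi>))"
proof -
  have "\<exists>G. \<forall>u\<in>log_sector k B s. (G has_field_derivative \<Phi> u) (at u within log_sector k B s)"
    if "s \<in> {1, -1}" for s
    using holomorphic_convex_primitive'[OF convex_log_sector open_log_sector hol[OF that]] by metis
  then obtain G where G: "\<And>s u. s \<in> {1, -1} \<Longrightarrow> u \<in> log_sector k B s \<Longrightarrow>
      (G s has_field_derivative \<Phi> u) (at u within log_sector k B s)" by metis
  have line: "(\<Phi> has_contour_integral (G s z - G s w)) (linepath w z)"
    if "s \<in> {1, -1}" "w \<in> log_sector k B s" "z \<in> log_sector k B s" for s w z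
  proof -
    have "path_image (linepath w z) \<subseteq> log_sector k B s"
      using that convex_log_sector by (auto simp: closed_segment_subset)
    from contour_integral_primitive[OF G[OF that(1)] valid_path_linepath this] show ?thesis by simp
  qed
  have mem: "of_real a \<in> log_sector k B s" "Complex a (s * pi) \<in> log_sector k B s"
    "Complex x0 (s * pi) \<in> log_sector k B s" if "s \<in> {1, -1}" for s
  proof -
    have ka: "k * a < 0" using a k by (simp add: mult_pos_neg)
    show "of_real a \<in> log_sector k B s" "Complex a (s * pi) \<in> log_sector k B s"
      "Complex x0 (s * pi) \<in> log_sector k B s"
      using that a x0 ka less_trans[OF ka pi_gt_zero] by (auto simp: log_sector_def)
  qed
  have seg: "contour_integral (linepath w z) \<Phi> = G s z - G s w"
    if "s \<in> {1, -1}" "w \<in> log_sector k B s" "z \<in> log_sector k B s" for s w z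
    using line[OF that] by (rule contour_integral_unique)
  have split: "contour_integral (linepath (Complex a (- pi)) (Complex a pi)) \<Phi> =
      contour_integral (linepath (Complex a (- pi)) (of_real a)) \<Phi> +
      contour_integral (linepath (of_real a) (Complex a pi)) \<Phi>"
  proof (rule contour_integral_split_linepath)
    have "closed_segment (Complex a (- pi)) (Complex a pi) \<subseteq> log_sector k B 1 \<union> log_sector k B (-1)"
    proof
      fix u assume "u \<in> closed_segment (Complex a (- pi)) (Complex a pi)"
      then have "Re u = a" "Im u \<in> {-pi..pi}"
        by (auto simp: closed_segment_same_Re closed_segment_eq_real_ivl)
      moreover have "k * a < 0" using a k by (simp add: mult_pos_neg)
      ultimately show "u \<in> log_sector k B 1 \<union> log_sector k B (-1)"
        using a pi_gt_zero by (auto simp: log_sector_def simp del: pi_gt_zero)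
    qed
    moreover have "continuous_on (log_sector k B 1 \<union> log_sector k B (-1)) \<Phi>"
      by (intro continuous_on_open_Un open_log_sector holomorphic_on_imp_continuous_on hol) auto
    ultimately show "continuous_on (closed_segment (Complex a (- pi)) (Complex a pi)) \<Phi>"
      by (rule continuous_on_subset[rotated])
    show "complex_of_real a \<in> closed_segment (Complex a (- pi)) (Complex a pi)"
      by (auto simp: closed_segment_same_Re closed_segment_eq_real_ivl)
  qed
  have trans: "contour_integral (linepath (Complex a pi) (Complex x0 pi)) \<Phi> =
      contour_integral (linepath (Complex a (- pi)) (Complex x0 (- pi))) \<Phi>"
  proof -
    have "Complex y pi = Complex y (- pi) + 2 * pi * \<i>" for y by (simp add: complex_eq_iff)
    then show ?thesis using contour_integral_linepath_translate[of \<Phi> "2 * pi * \<i>", OF per] by metis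
  qed
  have "G 1 (Complex x0 pi) - G 1 (Complex a pi) = G (-1) (Complex x0 (-pi)) - G (-1) (Complex a (-pi))"
    using trans seg[of 1 "Complex a pi" "Complex x0 pi"] seg[of "-1" "Complex a (-pi)" "Complex x0 (-pi)"]
      mem[of 1] mem[of "-1"] by simp
  then show ?thesis
    unfolding split using mem[of 1] mem[of "-1"] p[of 1] p[of "-1"] q[of 1] q[of "-1"]
    by (simp add: seg[of 1] seg[of "-1"] algebra_simps)
qed

text \<open>Dominated convergence after extending \<open>g n\<close> by 0. The comparison function
  depends on \<open>n\<close> too, because the exponent of the kernel will, so the claim is about
  the difference of the integrals.\<close>

lemma integral_ray_limit:
  fixes g h :: "nat \<Rightarrow> real \<Rightarrow> complex" and L :: "nat \<Rightarrow> real"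
  assumes g: "\<And>n. continuous_on {0..L n} (g n)" and L: "filterlim L at_top sequentially"
    and gb: "\<And>n t. 0 \<le> t \<Longrightarrow> t \<le> L n \<Longrightarrow> norm (g n t) \<le> C * exp (- b * t)"
    and h: "\<And>n. continuous_on {0..} (h n)"
    and hb: "\<And>n t. 0 \<le> t \<Longrightarrow> norm (h n t) \<le> C * exp (- b * t)" and b: "b > 0"
    and lim: "\<And>t. t \<ge> 0 \<Longrightarrow> (\<lambda>n. g n t - h n t) \<longlonglongrightarrow> 0"
  shows "(\<lambda>n. integral {0..L n} (g n) - integral {0..} (h n)) \<longlonglongrightarrow> 0"
proof -
  define g' where "g' = (\<lambda>n t. if t \<in> {0..L n} then g n t else 0)"
  have exp: "(\<lambda>t. C * exp (- b * t)) integrable_on {0..}" for C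
    using integrable_on_exp_minus_to_infinity[OF b, of 0] by (intro integrable_on_mult_right) auto
  have "norm (h 0 0) \<le> C" using hb[of 0 0] by simp
  then have C: "C \<ge> 0" by (rule order_trans[OF norm_ge_zero])
  have hi: "h n integrable_on {0..}" for n
  proof (rule measurable_bounded_by_integrable_imp_integrable[OF _ exp[of C]])
    show "h n \<in> borel_measurable (lebesgue_on {0..})"
      by (rule continuous_imp_measurable_on_sets_lebesgue[OF h]) auto
  qed (use hb in auto)
  have sub: "{0..L n} \<inter> {0..} = {0..L n}" for n by auto
  have gi: "g' n integrable_on {0..}" and gint: "integral {0..} (g' n) = integral {0..L n} (g n)" for n
  proof -
    have "(g n has_integral integral {0..L n} (g n)) {0..L n}"
      by (intro integrable_integral integrable_continuous_real g)
    then have "(g' n has_integral integral {0..L n} (g n)) {0..}"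
      unfolding g'_def by (subst has_integral_restrict_Int) (simp add: sub)
    then show "g' n integrable_on {0..}" "integral {0..} (g' n) = integral {0..L n} (g n)"
      by (auto simp: integral_unique integrable_on_def)
  qed
  have "(\<lambda>n. integral {0..} (\<lambda>t. g' n t - h n t)) \<longlonglongrightarrow> integral {0::real..} (\<lambda>t. 0::complex)"
  proof (rule dominated_convergence(2)[of "\<lambda>n t. g' n t - h n t" "{0..}" "\<lambda>t. 2 * C * exp (- b * t)"])
    show "(\<lambda>t. g' n t - h n t) integrable_on {0..}" for n using gi hi by (intro integrable_diff)
    show "(\<lambda>t. 2 * C * exp (- b * t)) integrable_on {0..}" by (rule exp)
    show "norm (g' n t - h n t) \<le> 2 * C * exp (- b * t)" if "t \<in> {0..}" for n t
    proof -
      have "norm (g' n t) \<le> C * exp (- b * t)" using gb[of t n] C that by (auto simp: g'_def)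
      then show ?thesis using hb[of t n] that norm_triangle_ineq4[of "g' n t" "h n t"] by simp
    qed
    show "(\<lambda>n. g' n t - h n t) \<longlonglongrightarrow> 0" if "t \<in> {0..}" for t
    proof (rule Lim_transform_eventually[OF lim])
      show "\<forall>\<^sub>F n in sequentially. g n t - h n t = g' n t - h n t"
        using filterlim_at_top[THEN iffD1, OF L, rule_format, of t] that
        by (auto elim!: eventually_mono simp: g'_def)
    qed (use that in auto)
  qed
  moreover have "integral {0..} (\<lambda>t. g' n t - h n t) = integral {0..L n} (g n) - integral {0..} (h n)" for n
    using integral_diff[OF gi hi] gint by simp
  ultimately show ?thesis by simp
qed

section \<open>The Hankel integral\<close>

text \<open>A ray in the scaled variable \<open>w = M * u\<close>, in which the start
  \<open>u = -1/M\<close> becomes -1.\<close>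

definition ray :: "real \<Rightarrow> real \<Rightarrow> real \<Rightarrow> complex" where
  "ray m s t = of_real t * Complex 1 (s * m) - 1"

text \<open>With \<open>x = - w\<close> this is the classical integrand
  \<open>exp x * x powr (- \<alpha>)\<close>. Starting at -1 keeps the path away from the
  singularity at 0.\<close>

definition hankel_kernel :: "real \<Rightarrow> real \<Rightarrow> real \<Rightarrow> real \<Rightarrow> complex" where
  "hankel_kernel m s \<alpha> t = exp (- ray m s t) * (- ray m s t) powr (- of_real \<alpha>)"

text \<open>The path comes in along the lower ray and leaves along the upper one: \<open>s\<close>
  is the orientation and \<open>Complex 1 (s * m)\<close> the derivative of
  \<open>ray m s\<close>.\<close>

definition hankel :: "real \<Rightarrow> real \<Rightarrow> complex" where
  "hankel m \<alpha> = (\<Sum>s\<in>{1, -1}. of_real s * Complex 1 (s * m) * integral {0..} (hankel_kernel m s \<alpha>))"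

lemma Re_ray [simp]: "Re (ray m s t) = t - 1" and Im_ray [simp]: "Im (ray m s t) = s * m * t"
  by (simp_all add: ray_def)

lemma norm_ray_ge:
  assumes "1 \<le> m" "s \<in> {1, -1}" "t \<ge> 0"
  shows "1 / 2 \<le> norm (ray m s t)"
proof (cases "t \<le> 1 / 2")
  case True
  then show ?thesis using abs_Re_le_cmod[of "ray m s t"] by simp
next
  case False
  have "1 * t \<le> m * t" using assms by (intro mult_right_mono) auto
  then have "1 / 2 \<le> m * t" using False by linarith
  moreover have "\<bar>Im (ray m s t)\<bar> = m * t" using assms by (auto simp: abs_mult)
  ultimately have "1 / 2 \<le> \<bar>Im (ray m s t)\<bar>" by simp
  then show ?thesis using abs_Im_le_cmod[of "ray m s t"] by simp
qed

lemma norm_ray_le: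
  assumes "0 \<le> m" "s \<in> {1, -1}" "t \<ge> 0"
  shows "norm (ray m s t) \<le> 1 + (1 + m) * t"
proof -
  have "norm (Complex 1 (s * m)) \<le> 1 + m"
    using norm_triangle_ineq[of 1 "\<i> * of_real (s * m)"] assms
    by (auto simp: Complex_eq norm_mult simp flip: of_real_mult)
  then have "norm (of_real t * Complex 1 (s * m)) \<le> t * (1 + m)"
    using assms by (simp add: norm_mult mult_left_mono)
  then show ?thesis unfolding ray_def
    using norm_triangle_ineq4[of "of_real t * Complex 1 (s * m)" 1] by (simp add: mult.commute)
qed

lemma minus_ray_notin_nonpos:
  assumes "1 \<le> m" "s \<in> {1, -1}" "t \<ge> 0"
  shows "- ray m s t \<notin> \<real>\<^sub>\<le>\<^sub>0"
  using assms by (auto simp: complex_nonpos_Reals_iff)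

lemma norm_powr_neg_le:
  fixes z :: complex
  assumes "1 / a \<le> norm z" "1 \<le> a" "0 \<le> \<alpha>" "\<alpha> \<le> A"
  shows "norm (z powr (- of_real \<alpha>)) \<le> a powr A"
proof -
  have "norm (z powr (- of_real \<alpha>)) = norm z powr (- \<alpha>)"
    using norm_powr_real_powr'[of "- of_real \<alpha>" z] by simp
  also have "\<dots> \<le> (1 / a) powr (- \<alpha>)" using assms by (intro powr_mono2') auto
  also have "\<dots> = a powr \<alpha>" using assms by (simp add: powr_minus_divide powr_divide)
  also have "\<dots> \<le> a powr A" using assms by (intro powr_mono) auto
  finally show ?thesis .
qed

lemma norm_hankel_kernel_le:
  assumes "1 \<le> m" "s \<in> {1, -1}" "t \<ge> 0" "0 \<le> \<alpha>" "\<alpha> \<le> A"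
  shows "norm (hankel_kernel m s \<alpha> t) \<le> exp 1 * 2 powr A * exp (- t)"
proof -
  have "norm (hankel_kernel m s \<alpha> t) = exp (1 - t) * norm ((- ray m s t) powr (- of_real \<alpha>))"
    by (simp add: hankel_kernel_def norm_mult)
  also have "\<dots> \<le> exp (1 - t) * 2 powr A"
    using norm_ray_ge[OF assms(1-3)] assms by (intro mult_left_mono norm_powr_neg_le) auto
  also have "\<dots> = exp 1 * 2 powr A * exp (- t)" by (simp add: exp_diff exp_minus field_simps)
  finally show ?thesis .
qed

lemma continuous_on_ray [continuous_intros]: "continuous_on S (ray m s)"
  unfolding ray_def by (intro continuous_intros)

lemma continuous_on_hankel_kernel:
  assumes "1 \<le> m" "s \<in> {1, -1}"
  shows "continuous_on {0..} (hankel_kernel m s \<alpha>)"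
  unfolding hankel_kernel_def
proof (intro continuous_intros)
  show "{0..} \<subseteq> {t. 0 \<le> Re (- ray m s t) \<or> Im (- ray m s t) \<noteq> 0}" using assms by auto
  show "0 < Re (- complex_of_real \<alpha>)" if "t \<in> {0..}" "- ray m s t = 0" for t
    using that minus_ray_notin_nonpos[OF assms, of t] by auto
qed

lemma contour_integral_ray:
  fixes T M :: real
  assumes cont: "continuous_on (closed_segment (of_real (- 1 / M)) (ray m s (T * M) / of_real M)) \<Phi>"
    and TM: "T > 0" "M > 0"
  shows "contour_integral (linepath (of_real (- 1 / M)) (ray m s (T * M) / of_real M)) \<Phi> =
    Complex 1 (s * m) / of_real M * integral {0..T * M} (\<lambda>t. \<Phi> (ray m s t / of_real M))"
proof -
  let ?p = "ray m s (T * M) / of_real M" and ?a = "complex_of_real (- 1 / M)"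
  define f where "f = (\<lambda>t. \<Phi> (ray m s t / of_real M) * (of_real T * Complex 1 (s * m)))"
  define I where "I = contour_integral (linepath ?a ?p) \<Phi>"
  have "(\<Phi> has_contour_integral I) (linepath ?a ?p)"
    unfolding I_def by (intro has_contour_integral_integral contour_integrable_continuous_linepath cont)
  then have "((\<lambda>x. \<Phi> (linepath ?a ?p x) * (?p - ?a)) has_integral I) {0..1}"
    by (simp only: has_contour_integral_linepath)
  moreover have "?p - ?a = of_real T * Complex 1 (s * m)"
    using TM by (simp add: ray_def field_simps)
  moreover have "linepath ?a ?p x = ray m s (T * M * x) / of_real M" for x
    using TM by (simp add: linepath_def ray_def scaleR_conv_of_real field_simps)
  ultimately have "((\<lambda>x. f (T * M * x)) has_integral I) {0..1}" by (simp add: f_def)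
  moreover have "(\<lambda>x. x / (T * M)) ` {0..T * M} = {0..1}" using TM by simp
  ultimately have "(f has_integral \<bar>T * M\<bar> *\<^sub>R I) {0..T * M}"
    using has_integral_stretch_real_iff[of "T * M" f I 0 "T * M"] TM by simp
  then have "of_real (T * M) * I = integral {0..T * M} f"
    using TM by (simp add: integral_unique scaleR_conv_of_real)
  also have "\<dots> = integral {0..T * M} (\<lambda>t. \<Phi> (ray m s t / of_real M)) * (of_real T * Complex 1 (s * m))"
    unfolding f_def by simp
  finally show ?thesis using TM unfolding I_def by (simp add: field_simps)
qed

text \<open>The slope \<open>m\<close> exceeds \<open>k\<close> and the ray starts to the left of
  the origin, so it is strictly inside the slanted edge of the sector from its first point
  on.\<close>

lemma ray_in_log_sector:
  assumes k: "k > 0" and m: "m = k + 1" and M: "M > 0" and s: "s \<in> {1, -1}"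
    and t: "0 \<le> t" "t \<le> T * M" and T: "T < B" "m * T < pi"
  shows "ray m s t / of_real M \<in> log_sector k B s"
proof -
  define x y where "x = t / M" and "y = 1 / M"
  have x: "0 \<le> x" "x \<le> T" and y: "y > 0" using t M by (auto simp: x_def y_def field_simps)
  have "ray m s t / of_real M = Complex (x - y) (s * (m * x))"
    by (simp add: complex_eq_iff diff_divide_distrib x_def y_def)
  moreover have "k * (x - y) < m * x"
  proof -
    have "k * (x - y) < k * x" using k y by simp
    also have "\<dots> \<le> m * x" using m x by (intro mult_right_mono) auto
    finally show ?thesis .
  qed
  moreover have "x - y < B" using x y T by linarith
  moreover have "m * x < 3 * pi / 2"
  proof -
    have "m * x \<le> m * T" using m k x by (intro mult_left_mono) auto
    then show ?thesis using T pi_gt_zero by linarith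
  qed
  ultimately show ?thesis using s by (auto simp: log_sector_def)
qed

text \<open>Abstract form of the contour argument. The path follows a ray up to real part
  \<open>T - 1 / M n\<close>, goes horizontally to the abscissa \<open>x0\<close> and vertically to
  height \<open>s * pi\<close>. The ray is treated by \<open>near_lim\<close> and
  \<open>near_bound\<close>, the other two sides by \<open>far\<close>. The abscissa is a parameter
  because its two uses differ: it is 0 if the integrand decays on the imaginary axis, and positive
  if \<open>exp (- n * u)\<close> alone provides the decay.\<close>

lemma hankel_limit:
  fixes \<Phi> :: "nat \<Rightarrow> complex \<Rightarrow> complex" and M \<alpha> eps :: "nat \<Rightarrow> real" and k B T x0 :: real
  defines "m \<equiv> k + 1"
  assumes k: "k > 0"
    and hol: "\<And>n s. s \<in> {1, -1} \<Longrightarrow> \<Phi> n holomorphic_on log_sector k B s"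
    and per: "\<And>n u. \<Phi> n (u + 2 * pi * \<i>) = \<Phi> n u"
    and M: "filterlim M at_top sequentially"
    and \<alpha>: "\<And>n. 0 \<le> \<alpha> n" "\<And>n. \<alpha> n \<le> A"
    and T: "0 < T" "T < B" "m * T < pi" and x0: "0 \<le> x0" "x0 < T"
    and near_lim: "\<And>s t. s \<in> {1, -1} \<Longrightarrow> t \<ge> 0 \<Longrightarrow>
       (\<lambda>n. of_real (M n powr (- \<alpha> n)) * \<Phi> n (ray m s t / of_real (M n)) - hankel_kernel m s (\<alpha> n) t) \<longlonglongrightarrow> 0"
    and b: "0 < b" "b \<le> 1"
    and near_bound: "\<forall>\<^sub>F n in sequentially. \<forall>s\<in>{1, -1}. \<forall>t\<in>{0..T * M n}.
       norm (of_real (M n powr (- \<alpha> n)) * \<Phi> n (ray m s t / of_real (M n))) \<le> C * exp (- b * t)"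
    and eps: "eps \<longlonglongrightarrow> 0"
    and far: "\<forall>\<^sub>F n in sequentially. \<forall>s\<in>{1, -1}.
       (\<forall>x\<in>{x0..T}. M n powr (1 - \<alpha> n) * norm (\<Phi> n (Complex x (s * (m * T)))) \<le> eps n) \<and>
       (\<forall>y\<in>{m * T..pi}. M n powr (1 - \<alpha> n) * norm (\<Phi> n (Complex x0 (s * y))) \<le> eps n)"
  shows "(\<lambda>n. of_real (M n powr (1 - \<alpha> n)) * contour_integral
      (linepath (Complex (- 1 / M n) (- pi)) (Complex (- 1 / M n) pi)) (\<Phi> n) - hankel m (\<alpha> n)) \<longlonglongrightarrow> 0"
proof -
  have m: "m \<ge> 1" "k < m" using k by (auto simp: m_def)
  \<comment> \<open>Then \<open>T - 1 / M n \<ge> x0\<close>, so the horizontal side stays within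
    the range where \<open>far\<close> applies, although its corner \<open>p n s\<close> moves with
    \<open>n\<close>.\<close>
  have "\<forall>\<^sub>F n in sequentially. M n \<ge> 1 / (T - x0)"
    using M by (auto simp: filterlim_at_top)
  define P where "P = (\<lambda>n. 1 / (T - x0) \<le> M n \<and>
     (\<forall>s\<in>{1, -1}. \<forall>t\<in>{0..T * M n}.
       norm (of_real (M n powr (- \<alpha> n)) * \<Phi> n (ray m s t / of_real (M n))) \<le> C * exp (- b * t)) \<and>
     (\<forall>s\<in>{1, -1}.
       (\<forall>x\<in>{x0..T}. M n powr (1 - \<alpha> n) * norm (\<Phi> n (Complex x (s * (m * T)))) \<le> eps n) \<and>
       (\<forall>y\<in>{m * T..pi}. M n powr (1 - \<alpha> n) * norm (\<Phi> n (Complex x0 (s * y))) \<le> eps n)))"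
  have "\<forall>\<^sub>F n in sequentially. P n"
    unfolding P_def by (intro eventually_conj \<open>\<forall>\<^sub>F n in sequentially. M n \<ge> 1 / (T - x0)\<close> near_bound far)
  then obtain n0 where "\<And>n. n \<ge> n0 \<Longrightarrow> P n"
    by (auto simp only: eventually_sequentially)
  note n0' = this[unfolded P_def]
  have n0:
    "\<And>n. n \<ge> n0 \<Longrightarrow> 1 / (T - x0) \<le> M n"
    "\<And>n s t. n \<ge> n0 \<Longrightarrow> s \<in> {1, -1} \<Longrightarrow> 0 \<le> t \<Longrightarrow> t \<le> T * M n \<Longrightarrow>
       norm (of_real (M n powr (- \<alpha> n)) * \<Phi> n (ray m s t / of_real (M n))) \<le> C * exp (- b * t)"
    "\<And>n s x. n \<ge> n0 \<Longrightarrow> s \<in> {1, -1} \<Longrightarrow> x0 \<le> x \<Longrightarrow> x \<le> T \<Longrightarrow>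
       M n powr (1 - \<alpha> n) * norm (\<Phi> n (Complex x (s * (m * T)))) \<le> eps n"
    "\<And>n s y. n \<ge> n0 \<Longrightarrow> s \<in> {1, -1} \<Longrightarrow> m * T \<le> y \<Longrightarrow> y \<le> pi \<Longrightarrow>
       M n powr (1 - \<alpha> n) * norm (\<Phi> n (Complex x0 (s * y))) \<le> eps n"
    subgoal for n by (rule n0'[THEN conjunct1])
    subgoal for n s t by (rule n0'[THEN conjunct2, THEN conjunct1, THEN bspec, THEN bspec]) simp_all
    subgoal for n s x by (rule n0'[THEN conjunct2, THEN conjunct2, THEN bspec, THEN conjunct1, THEN bspec]) simp_all
    subgoal for n s y by (rule n0'[THEN conjunct2, THEN conjunct2, THEN bspec, THEN conjunct2, THEN bspec]) simp_all
    done
  have Mpos: "M n > 0" if "n \<ge> n0" for n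
    by (rule less_le_trans[OF _ n0(1)[OF that]]) (use x0 in simp)
  define p where "p = (\<lambda>n s. ray m s (T * M n) / of_real (M n))"
  define q where "q = (\<lambda>s. Complex x0 (s * (m * T)))"
  define r where "r = (\<lambda>s. Complex x0 (s * pi))"
  have p_eq: "p n s = Complex (T - 1 / M n) (s * (m * T))" if "n \<ge> n0" for n s
    using Mpos[OF that] by (simp add: p_def complex_eq_iff field_simps)
  have mT: "k * x < m * T" if "x \<le> T" for x
  proof -
    have "k * x \<le> k * T" using k that by (intro mult_left_mono) auto
    also have "\<dots> < m * T" using m T by (intro mult_strict_right_mono) auto
    finally show ?thesis .
  qed
  have mT3: "m * T < 3 * pi / 2" using T(3) pi_gt_zero by linarith
  have p_mem: "p n s \<in> log_sector k B s" if "n \<ge> n0" "s \<in> {1, -1}" for n s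
    unfolding p_def
    using T Mpos[OF that(1)] by (intro ray_in_log_sector[OF k _ Mpos[OF that(1)] that(2) _ _ T(2,3)]) (auto simp: m_def)
  have q_mem: "q s \<in> log_sector k B s" if "s \<in> {1, -1}" for s
    using mT[of x0] T x0 that mT3 by (auto simp: log_sector_def q_def)
  have a_neg: "- 1 / M n < 0" "- 1 / M n < B" if "n \<ge> n0" for n
  proof -
    show *: "- 1 / M n < 0" using Mpos[OF that] by simp
    show "- 1 / M n < B" using * T by linarith
  qed
  have a_mem: "of_real (- 1 / M n) \<in> log_sector k B s" if "n \<ge> n0" "s \<in> {1, -1}" for n s
    using a_neg[OF that(1)] mult_pos_neg[OF k a_neg(1)[OF that(1)]] by (auto simp: log_sector_def)
  have seg_in: "closed_segment u v \<subseteq> log_sector k B s"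
    if "u \<in> log_sector k B s" "v \<in> log_sector k B s" for u v s
    using that convex_log_sector by (simp add: closed_segment_subset)
  have cont: "continuous_on (log_sector k B s) (\<Phi> n)" if "s \<in> {1, -1}" for s n
    using hol[OF that] by (rule holomorphic_on_imp_continuous_on)
  define E where "E = (\<lambda>n s. contour_integral (linepath (p n s) (q s)) (\<Phi> n) + contour_integral (linepath (q s) (r s)) (\<Phi> n))"
  define J where "J = (\<lambda>n s. integral {0..T * M n} (\<lambda>t. of_real (M n powr (- \<alpha> n)) * \<Phi> n (ray m s t / of_real (M n))))"
  have main: "of_real (M n powr (1 - \<alpha> n)) * contour_integral
      (linepath (Complex (- 1 / M n) (- pi)) (Complex (- 1 / M n) pi)) (\<Phi> n) =
      (\<Sum>s\<in>{1, -1}. of_real s * (Complex 1 (s * m) * J n s + of_real (M n powr (1 - \<alpha> n)) * E n s))"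
    if n: "n \<ge> n0" for n
  proof -
    note Mp = Mpos[OF n]
    have "contour_integral (linepath (Complex (- 1 / M n) (- pi)) (Complex (- 1 / M n) pi)) (\<Phi> n) =
       (\<Sum>s\<in>{1, -1}. of_real s * (contour_integral (linepath (of_real (- 1 / M n)) (p n s)) (\<Phi> n) +
        contour_integral (linepath (p n s) (q s)) (\<Phi> n) + contour_integral (linepath (q s) (Complex x0 (s * pi))) (\<Phi> n)))"
    proof (rule contour_integral_log_sector[where k = k and B = B])
      show "- 1 / M n < 0" "- 1 / M n < B" using a_neg[OF n] .
      show "k * x0 < pi" using mT[of x0] x0 T by simp
    qed (use hol per k x0 T p_mem[OF n] q_mem in auto)
    also have "\<dots> = (\<Sum>s\<in>{1, -1}. of_real s * (contour_integral (linepath (of_real (- 1 / M n)) (p n s)) (\<Phi> n) + E n s))"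
      unfolding E_def r_def by (simp add: add.assoc)
    finally have eq: "contour_integral (linepath (Complex (- 1 / M n) (- pi)) (Complex (- 1 / M n) pi)) (\<Phi> n) = \<dots>" .
    \<comment> \<open>Of the factor \<open>M n powr (1 - \<alpha> n)\<close>, one power of
      \<open>M n\<close> cancels the Jacobian of the scaling and the rest normalises the
      integrand.\<close>
    have J: "of_real (M n powr (1 - \<alpha> n)) * contour_integral (linepath (of_real (- 1 / M n)) (p n s)) (\<Phi> n)
        = Complex 1 (s * m) * J n s" if s: "s \<in> {1, -1}" for s
    proof -
      have "M n powr (1 - \<alpha> n) = M n * M n powr (- \<alpha> n)"
        using Mp by (simp add: powr_diff powr_minus_divide)
      moreover have "contour_integral (linepath (of_real (- 1 / M n)) (p n s)) (\<Phi> n) =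
         Complex 1 (s * m) / of_real (M n) * integral {0..T * M n} (\<lambda>t. \<Phi> n (ray m s t / of_real (M n)))"
        unfolding p_def
        by (rule contour_integral_ray[OF continuous_on_subset[OF cont[OF s]]])
          (use seg_in[OF a_mem[OF n s] p_mem[OF n s]] Mp T in \<open>auto simp: p_def\<close>)
      ultimately show ?thesis using Mp unfolding J_def by simp
    qed
    show ?thesis unfolding eq sum_distrib_left
    proof (rule sum.cong[OF refl])
      fix s :: real assume s: "s \<in> {1, -1}"
      show "of_real (M n powr (1 - \<alpha> n)) * (of_real s *
          (contour_integral (linepath (of_real (- 1 / M n)) (p n s)) (\<Phi> n) + E n s)) =
          of_real s * (Complex 1 (s * m) * J n s + of_real (M n powr (1 - \<alpha> n)) * E n s)"
        unfolding J[OF s, symmetric] by (simp only: algebra_simps)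
    qed
  qed
  have E: "(\<lambda>n. of_real (M n powr (1 - \<alpha> n)) * E n s) \<longlonglongrightarrow> 0" if s: "s \<in> {1, -1}" for s
  proof (rule Lim_null_comparison)
    show "(\<lambda>n. eps n * (T + pi)) \<longlonglongrightarrow> 0" using tendsto_mult_left_zero[OF eps] .
    show "\<forall>\<^sub>F n in sequentially. norm (of_real (M n powr (1 - \<alpha> n)) * E n s) \<le> eps n * (T + pi)"
      unfolding eventually_sequentially
    proof (intro exI allI impI)
      fix n assume n: "n \<ge> n0"
      note Mp = Mpos[OF n]
      define P where "P = M n powr (1 - \<alpha> n)"
      have P: "P > 0" using Mp by (simp add: P_def)
      have nonneg: "eps n / P \<ge> 0"
      proof -
        have "0 \<le> M n powr (1 - \<alpha> n) * norm (\<Phi> n (Complex T (s * (m * T))))" by simp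
        also have "\<dots> \<le> eps n" using n0(3)[OF n s, of T] x0 by simp
        finally show ?thesis using P by simp
      qed
      have r_mem: "r s \<in> log_sector k B s"
        using mT[of x0] T x0 s pi_gt_zero by (auto simp: log_sector_def r_def)
      have iM: "1 / M n \<le> T - x0" using n0(1)[OF n] Mp x0 by (simp add: field_simps)
      have "norm (contour_integral (linepath (p n s) (q s)) (\<Phi> n)) \<le> eps n / P * norm (q s - p n s)"
      proof (rule contour_integral_bound_linepath[OF _ nonneg])
        show "\<Phi> n contour_integrable_on linepath (p n s) (q s)"
          by (intro contour_integrable_continuous_linepath continuous_on_subset[OF cont[OF s]]
              seg_in p_mem q_mem n s)
        fix u assume u: "u \<in> closed_segment (p n s) (q s)"
        have "u = Complex (Re u) (s * (m * T))" "Re u \<in> closed_segment (T - 1 / M n) x0"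
          using u unfolding p_eq[OF n] q_def by (auto simp: closed_segment_same_Im complex_eq_iff)
        moreover from this have "x0 \<le> Re u" "Re u \<le> T"
          using iM x0 Mp less_imp_le[OF Mp] by (auto simp: closed_segment_eq_real_ivl split: if_splits)
            (smt (verit) divide_nonneg_nonneg)+
        ultimately have "P * norm (\<Phi> n u) \<le> eps n" using n0(3)[OF n s, of "Re u"] by (simp add: P_def)
        then show "norm (\<Phi> n u) \<le> eps n / P" using P by (simp add: field_simps)
      qed
      also have "\<dots> \<le> eps n / P * T"
      proof (rule mult_left_mono[OF _ nonneg])
        have "q s - p n s = of_real (x0 - (T - 1 / M n))" by (simp add: p_eq[OF n] q_def complex_eq_iff)
        then have "norm (q s - p n s) = \<bar>x0 - (T - 1 / M n)\<bar>" by (simp only: norm_of_real)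
        then show "norm (q s - p n s) \<le> T" using iM x0 a_neg(1)[OF n] by linarith
      qed
      finally have 1: "norm (contour_integral (linepath (p n s) (q s)) (\<Phi> n)) \<le> eps n / P * T" .
      have "norm (contour_integral (linepath (q s) (r s)) (\<Phi> n)) \<le> eps n / P * norm (r s - q s)"
      proof (rule contour_integral_bound_linepath[OF _ nonneg])
        show "\<Phi> n contour_integrable_on linepath (q s) (r s)"
          by (intro contour_integrable_continuous_linepath continuous_on_subset[OF cont[OF s]]
              seg_in r_mem q_mem s)
        fix u assume u: "u \<in> closed_segment (q s) (r s)"
        have "u = Complex x0 (s * (s * Im u))" "s * Im u \<in> {m * T..pi}"
          using u s T unfolding r_def q_def
          by (auto simp: closed_segment_same_Re complex_eq_iff closed_segment_eq_real_ivl split: if_splits)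
        then have "P * norm (\<Phi> n u) \<le> eps n" using n0(4)[OF n s, of "s * Im u"] by (simp add: P_def)
        then show "norm (\<Phi> n u) \<le> eps n / P" using P by (simp add: field_simps)
      qed
      also have "\<dots> \<le> eps n / P * pi"
      proof (rule mult_left_mono[OF _ nonneg])
        have "r s - q s = \<i> * of_real (s * (pi - m * T))" by (simp add: r_def q_def complex_eq_iff algebra_simps)
        then show "norm (r s - q s) \<le> pi" using T m s by (simp only: norm_mult norm_of_real) (auto simp: abs_mult)
      qed
      finally have 2: "norm (contour_integral (linepath (q s) (r s)) (\<Phi> n)) \<le> eps n / P * pi" .
      have "norm (E n s) \<le> eps n / P * (T + pi)"
        unfolding E_def using norm_triangle_le[OF add_mono[OF 1 2]] by (simp add: distrib_left)
      then have "P * norm (E n s) \<le> P * (eps n / P * (T + pi))" using P by (intro mult_left_mono) auto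
      then show "norm (of_real (M n powr (1 - \<alpha> n)) * E n s) \<le> eps n * (T + pi)"
        using P by (simp add: P_def norm_mult)
    qed
  qed
  have J: "(\<lambda>n. J n s - integral {0..} (hankel_kernel m s (\<alpha> n))) \<longlonglongrightarrow> 0" if s: "s \<in> {1, -1}" for s
  \<comment> \<open>The bounds hold from \<open>n0\<close> on, but dominated convergence asks for
    them at every index. The constant \<open>C'\<close> serves both integrands;
    \<open>b \<le> 1\<close> lets \<open>exp (- b * t)\<close> dominate the decay
    \<open>exp (- t)\<close> of the kernel.\<close>
  proof (rule LIMSEQ_offset)
    define C' where "C' = max C (exp 1 * 2 powr A)"
    show "(\<lambda>n. J (n + n0) s - integral {0..} (hankel_kernel m s (\<alpha> (n + n0)))) \<longlonglongrightarrow> 0"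
      unfolding J_def
    proof (rule integral_ray_limit[where C = C' and b = b])
      fix n
      have n: "n + n0 \<ge> n0" by simp
      note Mp = Mpos[OF n]
      have "ray m s t / of_real (M (n + n0)) \<in> log_sector k B s" if "t \<in> {0..T * M (n + n0)}" for t
        using that by (intro ray_in_log_sector[OF k _ Mp s _ _ T(2,3)]) (auto simp: m_def)
      then show "continuous_on {0..T * M (n + n0)} (\<lambda>t. of_real (M (n + n0) powr (- \<alpha> (n + n0))) *
          \<Phi> (n + n0) (ray m s t / of_real (M (n + n0))))"
        using Mp by (intro continuous_intros continuous_on_compose2[OF cont[OF s]]) auto
    next
      show "filterlim (\<lambda>n. T * M (n + n0)) at_top sequentially"
        using T by (intro filterlim_tendsto_pos_mult_at_top[OF tendsto_const] filterlim_compose[OF M] filterlim_add_const_nat_at_top) auto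
    next
      fix n t assume t: "0 \<le> t" "t \<le> T * M (n + n0)"
      from n0(2)[OF _ s this] show "norm (of_real (M (n + n0) powr (- \<alpha> (n + n0))) *
          \<Phi> (n + n0) (ray m s t / of_real (M (n + n0)))) \<le> C' * exp (- b * t)"
        by (rule order_trans) (auto simp: C'_def)
    next
      fix n and t :: real assume t: "0 \<le> t"
      have "norm (hankel_kernel m s (\<alpha> (n + n0)) t) \<le> exp 1 * 2 powr A * exp (- t)"
        by (rule norm_hankel_kernel_le[OF m(1) s t \<alpha>])
      also have "\<dots> \<le> C' * exp (- b * t)"
        using b t by (intro mult_mono) (auto simp: C'_def mult_left_le_one_le le_max_iff_disj)
      finally show "norm (hankel_kernel m s (\<alpha> (n + n0)) t) \<le> C' * exp (- b * t)" .
    next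
      fix t :: real assume "t \<ge> 0"
      from LIMSEQ_ignore_initial_segment[OF near_lim[OF s this], of n0]
      show "(\<lambda>n. of_real (M (n + n0) powr (- \<alpha> (n + n0))) * \<Phi> (n + n0) (ray m s t / of_real (M (n + n0)))
         - hankel_kernel m s (\<alpha> (n + n0)) t) \<longlonglongrightarrow> 0" .
    qed (use b continuous_on_hankel_kernel[OF m(1) s] in auto)
  qed
  have "(\<lambda>n. \<Sum>s\<in>{1, -1}. of_real s * (Complex 1 (s * m) * (J n s - integral {0..} (hankel_kernel m s (\<alpha> n)))
      + of_real (M n powr (1 - \<alpha> n)) * E n s)) \<longlonglongrightarrow> (\<Sum>s\<in>{1, -1}. of_real s * (Complex 1 (s * m) * 0 + 0))"
    by (intro tendsto_sum tendsto_intros J E)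
  then have "(\<lambda>n. \<Sum>s\<in>{1, -1}. of_real s * (Complex 1 (s * m) * (J n s - integral {0..} (hankel_kernel m s (\<alpha> n)))
      + of_real (M n powr (1 - \<alpha> n)) * E n s)) \<longlonglongrightarrow> 0" by simp
  then show ?thesis
  proof (rule Lim_transform_eventually)
    show "\<forall>\<^sub>F n in sequentially. (\<Sum>s\<in>{1, -1}. of_real s * (Complex 1 (s * m) * (J n s - integral {0..} (hankel_kernel m s (\<alpha> n)))
      + of_real (M n powr (1 - \<alpha> n)) * E n s)) = of_real (M n powr (1 - \<alpha> n)) * contour_integral
      (linepath (Complex (- 1 / M n) (- pi)) (Complex (- 1 / M n) pi)) (\<Phi> n) - hankel m (\<alpha> n)"
      unfolding eventually_sequentially
      by (intro exI[of _ n0] allI impI, subst main) (auto simp: hankel_def algebra_simps)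
  qed
qed

section \<open>Integrands of exponential form\<close>

lemma tendsto_bounded_mult_zero:
  fixes f g :: "nat \<Rightarrow> 'a::real_normed_algebra"
  assumes g: "g \<longlonglongrightarrow> 0" and f: "\<And>n. norm (f n) \<le> C"
  shows "(\<lambda>n. f n * g n) \<longlonglongrightarrow> 0"
proof (rule Lim_null_comparison)
  have "norm (f n * g n) \<le> C * norm (g n)" for n
    using norm_mult_ineq[of "f n" "g n"] mult_right_mono[OF f[of n] norm_ge_zero[of "g n"]] by linarith
  then show "\<forall>\<^sub>F n in sequentially. norm (f n * g n) \<le> C * norm (g n)" by simp
  show "(\<lambda>n. C * norm (g n)) \<longlonglongrightarrow> 0" using tendsto_mult_right_zero[OF tendsto_norm_zero[OF g]] .
qed

text \<open>By \<open>H_lim\<close> the exponent \<open>n * (v n * H u - u)\<close> is about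
  \<open>- M n * u\<close>, which is the origin of the scale \<open>M\<close>; \<open>F\<close> and
  \<open>G\<close> contribute powers of \<open>1 - exp u\<close> that add up to the exponent
  \<open>- \<alpha> n\<close>. In \<open>far\<close> the bound \<open>T0\<close> is universally
  quantified, since how small \<open>T\<close> must be is decided inside the proof, by the radius
  within which the three local expansions are good.\<close>

lemma hankel_limit_exp:
  fixes F G H :: "complex \<Rightarrow> complex" and v :: "nat \<Rightarrow> real" and k B c \<theta> \<beta> v1 v2 \<mu>0 :: real
  defines "M \<equiv> \<lambda>n. real n * (1 - v n * c)" and "\<alpha> \<equiv> \<lambda>n. v n * \<theta> + \<beta>"
    and "\<Phi> \<equiv> \<lambda>n u. F u * exp (of_real (v n) * G u + of_nat n * (of_real (v n) * H u) - of_nat n * u)"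
  assumes k: "k > 0" and B: "B > 0"
    and F: "\<And>s. s \<in> {1, -1} \<Longrightarrow> F holomorphic_on log_sector k B s"
    and G: "\<And>s. s \<in> {1, -1} \<Longrightarrow> G holomorphic_on log_sector k B s"
    and H: "\<And>s. s \<in> {1, -1} \<Longrightarrow> H holomorphic_on log_sector k B s"
    and per: "\<And>u. F (u + 2 * pi * \<i>) = F u" "\<And>u. G (u + 2 * pi * \<i>) = G u" "\<And>u. H (u + 2 * pi * \<i>) = H u"
    and F_lim: "\<And>s. s \<in> {1, -1} \<Longrightarrow>
       ((\<lambda>u. F u * (1 - exp u) powr of_real \<beta>) \<longlongrightarrow> 1) (at 0 within log_sector k B s)"
    and G_lim: "\<And>s. s \<in> {1, -1} \<Longrightarrow>
       ((\<lambda>u. G u + of_real \<theta> * Ln (1 - exp u)) \<longlongrightarrow> 0) (at 0 within log_sector k B s)"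
    and H_lim: "\<And>s. s \<in> {1, -1} \<Longrightarrow>
       ((\<lambda>u. (H u - of_real c * u) / u) \<longlongrightarrow> 0) (at 0 within log_sector k B s)"
    and v: "\<And>n. v1 \<le> v n" "\<And>n. v n \<le> v2" "0 \<le> v1" and \<mu>: "\<mu>0 > 0" "\<And>n. \<mu>0 \<le> 1 - v n * c"
    and \<theta>: "\<theta> \<ge> 0" and \<beta>: "\<beta> \<ge> 0"
    and far: "\<And>T0. T0 > 0 \<Longrightarrow> \<exists>T x0 \<rho>. 0 < T \<and> T < T0 \<and> 0 \<le> x0 \<and> x0 < T \<and> \<rho> > 0 \<and>
       (\<forall>s\<in>{1, -1}. \<forall>w\<in>{v1..v2}.
         (\<forall>x\<in>{x0..T}. w * Re (H (Complex x (s * ((k + 1) * T)))) - x \<le> - \<rho>) \<and>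
         (\<forall>y\<in>{(k + 1) * T..pi}. w * Re (H (Complex x0 (s * y))) - x0 \<le> - \<rho>))"
  shows "(\<lambda>n. of_real (M n powr (1 - \<alpha> n)) * contour_integral
      (linepath (Complex (- 1 / M n) (- pi)) (Complex (- 1 / M n) pi)) (\<Phi> n) - hankel (k + 1) (\<alpha> n)) \<longlonglongrightarrow> 0"
proof -
  define m where "m = k + 1"
  have m: "m \<ge> 1" "k < m" using k by (auto simp: m_def)
  define \<mu>1 where "\<mu>1 = 1 + v2 * \<bar>c\<bar>"
  have v0: "0 \<le> v n" for n using v(1)[of n] v(3) by linarith
  have v2_nonneg: "0 \<le> v2" using v0[of 0] v(2)[of 0] by linarith
  have \<mu>1: "1 - v n * c \<le> \<mu>1" for n
  proof -
    have "\<bar>v n * c\<bar> \<le> v2 * \<bar>c\<bar>" using v0[of n] v(2)[of n] by (simp add: abs_mult mult_right_mono)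
    then show ?thesis by (simp add: \<mu>1_def abs_le_iff)
  qed
  define A where "A = v2 * \<theta> + \<beta>"
  have \<alpha>: "0 \<le> \<alpha> n" "\<alpha> n \<le> A" for n
    using v0[of n] v(2)[of n] \<theta> \<beta> by (auto simp: \<alpha>_def A_def mult_right_mono)
  have M_ge: "real n * \<mu>0 \<le> M n" and M_le: "M n \<le> real n * \<mu>1" for n
    using \<mu>(2)[of n] \<mu>1[of n] by (auto simp: M_def mult_left_mono)
  have M: "filterlim M at_top sequentially"
  proof (rule filterlim_at_top_mono)
    show "filterlim (\<lambda>n. real n * \<mu>0) at_top sequentially"
      using \<mu> by (intro filterlim_at_top_mult_tendsto_pos[OF tendsto_const]) (auto simp: filterlim_real_sequentially)
  qed (use M_ge in auto)
  have Mpos: "M n > 0" if "n > 0" for n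
    using M_ge[of n] \<mu> that by (intro less_le_trans[OF _ M_ge]) auto
  have n_eq: "real n = M n / (1 - v n * c)" for n
    using \<mu>(1) \<mu>(2)[of n] by (simp add: M_def)

  define e1 where "e1 = (\<lambda>u. G u + of_real \<theta> * Ln (1 - exp u))"
  define e2 where "e2 = (\<lambda>u. H u - of_real c * u)"
  define a where "a = (\<lambda>u. F u * (1 - exp u) powr of_real \<beta>)"
  \<comment> \<open>An exact model in \<open>M n * u\<close> and \<open>M n * (1 - exp u)\<close>
    times corrections: \<open>a\<close> tends to 1, \<open>e1\<close> tends to 0, and
    \<open>e2\<close> is \<open>o(u)\<close>.\<close>
  have factor: "of_real (M n powr (- \<alpha> n)) * \<Phi> n u =
      exp (- of_real (M n) * u) * (of_real (M n) * (1 - exp u)) powr (- of_real (\<alpha> n)) *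
      a u * exp (of_real (v n) * e1 u + of_nat n * (of_real (v n) * e2 u))"
    if u: "u \<in> log_sector k B s" and s: "s \<in> {1, -1}" and n: "n > 0" for n u s
  proof -
    have ne: "1 - exp u \<noteq> 0" using exp_log_sector_notin_nonpos[OF u _ k] s by auto
    define l where "l = Ln (1 - exp u)"
    have "of_real (M n powr (- \<alpha> n)) = exp (- of_real (\<alpha> n) * complex_of_real (ln (M n)))"
      using Mpos[OF n] by (simp add: powr_def flip: exp_of_real)
    moreover have "F u = a u * exp (- of_real \<beta> * l)"
      using ne by (simp add: a_def powr_def l_def mult.assoc flip: exp_add)
    moreover have "(of_real (M n) * (1 - exp u)) powr (- of_real (\<alpha> n)) = exp (- of_real (\<alpha> n) * (of_real (ln (M n)) + l))"
      using Mpos[OF n] ne by (simp add: powr_def Ln_times_of_real Ln_of_real l_def)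
    ultimately show ?thesis
      by (simp add: \<Phi>_def e1_def e2_def l_def[symmetric] M_def \<alpha>_def algebra_simps flip: exp_add)
  qed

  have near_lim: "(\<lambda>n. of_real (M n powr (- \<alpha> n)) * \<Phi> n (ray m s t / of_real (M n)) - hankel_kernel m s (\<alpha> n) t) \<longlonglongrightarrow> 0"
    if s: "s \<in> {1, -1}" and t: "t \<ge> 0" for s t
  proof -
    define w where "w = ray m s t"
    have w: "- w \<notin> \<real>\<^sub>\<le>\<^sub>0" "w \<noteq> 0" using minus_ray_notin_nonpos[OF m(1) s t] by (auto simp: w_def)
    define u where "u = (\<lambda>n. w / of_real (M n))"
    define T where "T = min (B / 2) (pi / (2 * m))"
    have T: "T > 0" "T < B" using B m by (auto simp: T_def min_less_iff_disj)
    have "m * T \<le> m * (pi / (2 * m))" using m by (intro mult_left_mono) (auto simp: T_def)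
    also have "\<dots> < pi" using m by simp
    finally have T': "m * T < pi" .
    have ev: "\<forall>\<^sub>F n in sequentially. n > 0 \<and> u n \<in> log_sector k B s"
    proof -
      have "\<forall>\<^sub>F n in sequentially. M n \<ge> t / T" using M by (auto simp: filterlim_at_top)
      then show ?thesis using eventually_gt_at_top[of 0]
      proof eventually_elim
        case (elim n)
        then have "t \<le> T * M n" using T by (simp add: field_simps)
        from ray_in_log_sector[OF k m_def Mpos[OF elim(2)] s t this T(2) T'] elim(2)
        show ?case by (simp add: u_def w_def)
      qed
    qed
    have u0: "u \<longlonglongrightarrow> 0" unfolding u_def
      by (rule tendsto_divide_0[OF tendsto_const]) (rule filterlim_compose[OF filterlim_of_real_at_infinity M])
    have une: "\<forall>\<^sub>F n in sequentially. u n \<noteq> 0"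
      using eventually_gt_at_top[of 0]
    proof eventually_elim
      case (elim n)
      have "complex_of_real (M n) \<noteq> 0" using Mpos[OF elim] by simp
      then show ?case using w(2) by (simp add: u_def)
    qed
    have "\<forall>\<^sub>F n in sequentially. u n \<in> log_sector k B s \<and> u n \<noteq> 0"
      using ev une by eventually_elim simp
    with u0 have lim: "filterlim u (at 0 within log_sector k B s) sequentially"
      unfolding filterlim_at by (intro conjI)
    have lim': "filterlim u (at 0) sequentially"
      by (rule filterlim_atI[OF u0 une])
    have a: "(\<lambda>n. a (u n)) \<longlonglongrightarrow> 1" unfolding a_def by (rule filterlim_compose[OF F_lim[OF s] lim])
    have "(\<lambda>n. e1 (u n)) \<longlonglongrightarrow> 0" unfolding e1_def by (rule filterlim_compose[OF G_lim[OF s] lim])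
    then have e1: "(\<lambda>n. of_real (v n) * e1 (u n)) \<longlonglongrightarrow> 0"
      by (rule tendsto_bounded_mult_zero[where C = v2]) (use v0 v2_nonneg v(2) in auto)
    \<comment> \<open>The large factor \<open>n\<close> is harmless: since
      \<open>n = M n / (1 - v n * c)\<close> and \<open>M n * u n = w\<close>, the term
      \<open>n * e2 (u n)\<close> is a bounded multiple of \<open>e2 (u n) / u n\<close>.\<close>
    have "(\<lambda>n. e2 (u n) / u n) \<longlonglongrightarrow> 0" unfolding e2_def by (rule filterlim_compose[OF H_lim[OF s] lim])
    then have "(\<lambda>n. (of_real (v n / (1 - v n * c)) * w) * (e2 (u n) / u n)) \<longlonglongrightarrow> 0"
    proof (rule tendsto_bounded_mult_zero[where C = "v2 / \<mu>0 * norm w"])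
      fix n
      have "\<bar>v n / (1 - v n * c)\<bar> \<le> v2 / \<mu>0"
        using v0[of n] v(2)[of n] \<mu>(1) \<mu>(2)[of n] by (simp add: frac_le)
      then show "norm (of_real (v n / (1 - v n * c)) * w) \<le> v2 / \<mu>0 * norm w"
        unfolding norm_mult norm_of_real by (intro mult_right_mono) auto
    qed
    then have e2: "(\<lambda>n. of_nat n * (of_real (v n) * e2 (u n))) \<longlonglongrightarrow> 0"
    proof (rule Lim_transform_eventually)
      show "\<forall>\<^sub>F n in sequentially. (of_real (v n / (1 - v n * c)) * w) * (e2 (u n) / u n) = of_nat n * (of_real (v n) * e2 (u n))"
        using eventually_gt_at_top[of 0]
      proof eventually_elim
        case (elim n)
        have ne: "1 - v n * c \<noteq> 0" using \<mu>(1) \<mu>(2)[of n] by auto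
        have "complex_of_nat n = of_real (M n) / of_real (1 - v n * c)"
          using n_eq[of n] by (metis of_real_divide of_real_of_nat_eq)
        moreover have "complex_of_real (M n) \<noteq> 0" using Mpos[OF elim] by auto
        moreover have "complex_of_real (1 - v n * c) \<noteq> 0" using ne by (simp only: of_real_eq_0_iff not_False_eq_True)
        ultimately show ?case using w(2) by (simp only: u_def of_real_divide) (simp add: field_simps)
      qed
    qed
    have "(\<lambda>n. - w * ((exp (u n) - 1) / u n)) \<longlonglongrightarrow> - w * 1"
      by (intro tendsto_intros filterlim_compose[OF lim_exp_minus_1 lim'])
    then have "(\<lambda>n. - w * ((exp (u n) - 1) / u n)) \<longlonglongrightarrow> - w" by simp
    then have "(\<lambda>n. of_real (M n) * (1 - exp (u n))) \<longlonglongrightarrow> - w"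
    proof (rule Lim_transform_eventually)
      show "\<forall>\<^sub>F n in sequentially. - w * ((exp (u n) - 1) / u n) = of_real (M n) * (1 - exp (u n))"
        using eventually_gt_at_top[of 0]
      proof eventually_elim
        case (elim n)
        have "complex_of_real (M n) \<noteq> 0" using Mpos[OF elim] by simp
        then show ?case using w(2) by (simp add: u_def field_simps)
      qed
    qed
    \<comment> \<open>As \<open>\<alpha> n\<close> need not converge, the two powers are compared
      through the difference of their logarithms, which tends to 0 and is multiplied by a bounded
      exponent.\<close>
    then have "(\<lambda>n. Ln (of_real (M n) * (1 - exp (u n))) - Ln (- w)) \<longlonglongrightarrow> Ln (- w) - Ln (- w)"
      by (intro tendsto_intros w)
    then have "(\<lambda>n. - of_real (\<alpha> n) * (Ln (of_real (M n) * (1 - exp (u n))) - Ln (- w))) \<longlonglongrightarrow> 0"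
      by (intro tendsto_bounded_mult_zero[where C = A]) (use \<alpha> in auto)
    then have "(\<lambda>n. exp (- of_real (\<alpha> n) * (Ln (of_real (M n) * (1 - exp (u n))) - Ln (- w))) * a (u n) *
        exp (of_real (v n) * e1 (u n) + of_nat n * (of_real (v n) * e2 (u n)))) \<longlonglongrightarrow> exp 0 * 1 * exp (0 + 0)"
      by (intro tendsto_intros a e1 e2)
    then have "(\<lambda>n. exp (- of_real (\<alpha> n) * (Ln (of_real (M n) * (1 - exp (u n))) - Ln (- w))) * a (u n) *
        exp (of_real (v n) * e1 (u n) + of_nat n * (of_real (v n) * e2 (u n))) - 1) \<longlonglongrightarrow> 0"
      by (auto dest: LIM_zero)
    then have "(\<lambda>n. hankel_kernel m s (\<alpha> n) t * (exp (- of_real (\<alpha> n) * (Ln (of_real (M n) * (1 - exp (u n))) - Ln (- w))) * a (u n) *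
        exp (of_real (v n) * e1 (u n) + of_nat n * (of_real (v n) * e2 (u n))) - 1)) \<longlonglongrightarrow> 0"
      by (rule tendsto_bounded_mult_zero) (rule norm_hankel_kernel_le[OF m(1) s t \<alpha>])
    then show ?thesis
    proof (rule Lim_transform_eventually)
      show "\<forall>\<^sub>F n in sequentially. hankel_kernel m s (\<alpha> n) t * (exp (- of_real (\<alpha> n) * (Ln (of_real (M n) * (1 - exp (u n))) - Ln (- w))) * a (u n) *
        exp (of_real (v n) * e1 (u n) + of_nat n * (of_real (v n) * e2 (u n))) - 1) =
        of_real (M n powr (- \<alpha> n)) * \<Phi> n (ray m s t / of_real (M n)) - hankel_kernel m s (\<alpha> n) t"
        using ev
      proof eventually_elim
        case (elim n)
        then have n: "n > 0" and un: "u n \<in> log_sector k B s" by auto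
        have "1 - exp (u n) \<noteq> 0" using exp_log_sector_notin_nonpos[OF un _ k] s by auto
        moreover have "complex_of_real (M n) \<noteq> 0" using Mpos[OF n] by auto
        ultimately have ne: "of_real (M n) * (1 - exp (u n)) \<noteq> 0" by simp
        have hk: "hankel_kernel m s (\<alpha> n) t = exp (- w) * exp (- of_real (\<alpha> n) * Ln (- w))"
          using w by (simp add: hankel_kernel_def powr_def w_def)
        have Mu: "of_real (M n) * u n = w" using Mpos[OF n] by (simp add: u_def)
        have pw: "(of_real (M n) * (1 - exp (u n))) powr (- of_real (\<alpha> n)) =
           exp (- of_real (\<alpha> n) * Ln (- w)) * exp (- of_real (\<alpha> n) * (Ln (of_real (M n) * (1 - exp (u n))) - Ln (- w)))"
          using ne by (simp add: powr_def algebra_simps flip: exp_add)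
        have "of_real (M n powr (- \<alpha> n)) * \<Phi> n (u n) = hankel_kernel m s (\<alpha> n) t *
          (exp (- of_real (\<alpha> n) * (Ln (of_real (M n) * (1 - exp (u n))) - Ln (- w))) * a (u n) *
           exp (of_real (v n) * e1 (u n) + of_nat n * (of_real (v n) * e2 (u n))))"
          unfolding factor[OF un s n] pw hk using Mu by (simp add: mult.assoc)
        then show ?case by (simp add: u_def w_def right_diff_distrib)
      qed
    qed
  qed

  \<comment> \<open>Chosen so that \<open>n * v n * norm (e2 u) \<le> norm w / (2 * (1 + m)) \<le> 1
    + t / 2\<close> along the ray: the error consumes at most half of the decay
    \<open>exp (- t)\<close>.\<close>
  define \<epsilon> where "\<epsilon> = \<mu>0 / (2 * (1 + v2) * (1 + m))"
  have \<epsilon>: "\<epsilon> > 0" using \<mu> v0 v2_nonneg m by (simp add: \<epsilon>_def)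
  have "\<exists>r>0. \<forall>u\<in>log_sector k B s. u \<noteq> 0 \<and> norm u < r \<longrightarrow>
     norm (a u) \<le> 2 \<and> norm (e1 u) \<le> 1 \<and> norm (e2 u) \<le> \<epsilon> * norm u \<and> norm u / 2 \<le> norm (1 - exp u)"
    if s: "s \<in> {1, -1}" for s
  proof -
    have "\<forall>\<^sub>F u in at 0 within log_sector k B s. dist (a u) 1 < 1"
      using F_lim[OF s] unfolding a_def by (rule tendstoD) simp
    moreover have "\<forall>\<^sub>F u in at 0 within log_sector k B s. dist (e1 u) 0 < 1"
      using G_lim[OF s] unfolding e1_def by (rule tendstoD) simp
    moreover have "\<forall>\<^sub>F u in at 0 within log_sector k B s. dist (e2 u / u) 0 < \<epsilon>"
      using H_lim[OF s] \<epsilon> unfolding e2_def by (rule tendstoD)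
    moreover have "\<forall>\<^sub>F u::complex in at 0 within log_sector k B s. dist ((exp u - 1) / u) 1 < 1 / 2"
      using tendsto_mono[OF at_le[OF subset_UNIV] lim_exp_minus_1] by (rule tendstoD) simp
    ultimately have "\<forall>\<^sub>F u in at 0 within log_sector k B s. dist (a u) 1 < 1 \<and> dist (e1 u) 0 < 1 \<and>
        dist (e2 u / u) 0 < \<epsilon> \<and> dist ((exp u - 1) / u) 1 < 1 / 2"
      by eventually_elim simp
    then obtain r where r: "r > 0" "\<And>u. u \<in> log_sector k B s \<Longrightarrow> u \<noteq> 0 \<Longrightarrow> dist u 0 < r \<Longrightarrow> dist (a u) 1 < 1 \<and> dist (e1 u) 0 < 1 \<and>
        dist (e2 u / u) 0 < \<epsilon> \<and> dist ((exp u - 1) / u) 1 < 1 / 2"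
      unfolding eventually_at by metis
    show ?thesis
    proof (intro exI[of _ r] conjI ballI impI r(1); elim conjE)
      fix u assume u: "u \<in> log_sector k B s" "u \<noteq> 0" "norm u < r"
      have d: "dist (a u) 1 < 1" "dist (e1 u) 0 < 1" "dist (e2 u / u) 0 < \<epsilon>" "dist ((exp u - 1) / u) 1 < 1 / 2"
        using r(2)[OF u(1,2)] u(3) by auto
      show "norm (a u) \<le> 2" using d(1) norm_triangle_sub[of "a u" 1] by (simp add: dist_norm)
      show "norm (e1 u) \<le> 1" using d(2) by simp
      show "norm (e2 u) \<le> \<epsilon> * norm u" using d(3) u(2) by (simp add: norm_divide field_simps)
      have "1 / 2 \<le> norm ((exp u - 1) / u)"
        using d(4) norm_triangle_sub[of 1 "(exp u - 1) / u"] by (simp add: dist_norm norm_minus_commute)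
      then show "norm u / 2 \<le> norm (1 - exp u)"
        using u(2) by (simp add: norm_divide norm_minus_commute field_simps)
    qed
  qed
  from this[of 1] this[of "-1"] obtain r1 r2 where r: "r1 > 0" "r2 > 0"
    "\<forall>u\<in>log_sector k B 1. u \<noteq> 0 \<and> norm u < r1 \<longrightarrow>
     norm (a u) \<le> 2 \<and> norm (e1 u) \<le> 1 \<and> norm (e2 u) \<le> \<epsilon> * norm u \<and> norm u / 2 \<le> norm (1 - exp u)"
    "\<forall>u\<in>log_sector k B (-1). u \<noteq> 0 \<and> norm u < r2 \<longrightarrow>
     norm (a u) \<le> 2 \<and> norm (e1 u) \<le> 1 \<and> norm (e2 u) \<le> \<epsilon> * norm u \<and> norm u / 2 \<le> norm (1 - exp u)"
    by auto
  define r where "r = min r1 r2"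
  have r0: "r > 0" using r by (simp add: r_def)
  have near: "norm (a u) \<le> 2" "norm (e1 u) \<le> 1" "norm (e2 u) \<le> \<epsilon> * norm u" "norm u / 2 \<le> norm (1 - exp u)"
    if "s \<in> {1, -1}" "u \<in> log_sector k B s" "u \<noteq> 0" "norm u < r" for s u
    using that r(3,4) by (auto simp: r_def)

  \<comment> \<open>The last bound keeps the scaled ray within the radius \<open>r\<close>: its
    points have norm at most \<open>1 / M n + (1 + m) * T\<close>, and both summands are eventually
    below \<open>r / 2\<close>.\<close>
  define T0 where "T0 = min B (min (pi / m) (r / (2 * (1 + m))))"
  have "T0 > 0" using B m r0 pi_gt_zero by (auto simp: T0_def)
  from far[OF this] obtain T x0 \<rho> where T: "0 < T" "T < T0" and x0: "0 \<le> x0" "x0 < T" and \<rho>: "\<rho> > 0"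
    and far': "\<And>s w x. s \<in> {1, -1} \<Longrightarrow> w \<in> {v1..v2} \<Longrightarrow> x \<in> {x0..T} \<Longrightarrow> w * Re (H (Complex x (s * (m * T)))) - x \<le> - \<rho>"
      "\<And>s w y. s \<in> {1, -1} \<Longrightarrow> w \<in> {v1..v2} \<Longrightarrow> y \<in> {m * T..pi} \<Longrightarrow> w * Re (H (Complex x0 (s * y))) - x0 \<le> - \<rho>"
    unfolding m_def by metis
  have TB: "T < B" "T < pi / m" "T < r / (2 * (1 + m))" using T by (auto simp: T0_def)
  have T1: "m * T < pi" and T2: "(1 + m) * T < r / 2" using TB m by (auto simp: field_simps)

  \<comment> \<open>\<open>4 powr A\<close> comes from
    \<open>M n * norm (1 - exp u) \<ge> norm w / 2 \<ge> 1 / 4\<close>, the 2 from \<open>a\<close>,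
    \<open>exp v2\<close> from \<open>e1\<close>, and the two factors \<open>exp 1\<close> from
    \<open>exp (1 - t)\<close> and from the bound \<open>1 + t / 2\<close> of the \<open>e2\<close>
    term.\<close>
  define C where "C = 4 powr A * 2 * exp 1 * exp v2 * exp 1"
  have near_bound: "\<forall>\<^sub>F n in sequentially. \<forall>s\<in>{1, -1}. \<forall>t\<in>{0..T * M n}.
       norm (of_real (M n powr (- \<alpha> n)) * \<Phi> n (ray m s t / of_real (M n))) \<le> C * exp (- (1 / 2) * t)"
  proof -
    have "\<forall>\<^sub>F n in sequentially. M n \<ge> 2 / r + 1" using M by (auto simp: filterlim_at_top)
    then show ?thesis using eventually_gt_at_top[of 0]
    proof eventually_elim
      case (elim n)
      note Mp = Mpos[OF elim(2)]
      have invM: "1 / M n < r / 2"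
      proof -
        have "2 / r < M n" using elim(1) by linarith
        then show ?thesis using r0 Mp by (simp add: field_simps)
      qed
      show ?case
      proof (intro ballI)
        fix s t :: real assume s: "s \<in> {1, -1}" and t: "t \<in> {0..T * M n}"
        then have t0: "t \<ge> 0" by simp
        define w where "w = ray m s t"
        define u where "u = w / of_real (M n)"
        have w1: "1 / 2 \<le> norm w" and w2: "norm w \<le> 1 + (1 + m) * t"
          using norm_ray_ge[OF m(1) s t0] norm_ray_le[of m s t] m s t0 by (auto simp: w_def)
        have u: "u \<in> log_sector k B s"
          using ray_in_log_sector[OF k m_def Mp s t0 _ TB(1) T1] t by (simp add: u_def w_def)
        have nu: "norm u = norm w / M n" using Mp by (simp add: u_def norm_divide)
        have u_ne: "u \<noteq> 0" using nu w1 Mp by auto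
        have "norm w / M n \<le> (1 + (1 + m) * t) / M n" using w2 Mp by (intro divide_right_mono) auto
        also have "\<dots> \<le> (1 + (1 + m) * (T * M n)) / M n" using t m Mp by (intro divide_right_mono add_left_mono mult_left_mono) auto
        also have "\<dots> = 1 / M n + (1 + m) * T" using Mp by (simp add: field_simps)
        also have "\<dots> < r" using invM T2 by linarith
        finally have ur: "norm u < r" using nu by simp
        note nr = near[OF s u u_ne ur]
        have b1: "norm ((of_real (M n) * (1 - exp u)) powr (- of_real (\<alpha> n))) \<le> 4 powr A"
        proof (rule norm_powr_neg_le[OF _ _ \<alpha>])
          have "norm w / 2 = M n * (norm u / 2)" using nu Mp by simp
          also have "\<dots> \<le> M n * norm (1 - exp u)" using nr(4) Mp by (intro mult_left_mono) auto
          also have "\<dots> = norm (of_real (M n) * (1 - exp u))" using Mp by (simp add: norm_mult)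
          finally show "1 / 4 \<le> norm (of_real (M n) * (1 - exp u))" using w1 by linarith
        qed simp
        have b2: "norm (exp (- of_real (M n) * u)) \<le> exp 1 * exp (- t)"
        proof -
          have "of_real (M n) * u = w" using Mp by (simp add: u_def)
          then have "norm (exp (- of_real (M n) * u)) = exp (1 - t)" by (simp add: w_def)
          then show ?thesis by (simp add: exp_diff exp_minus field_simps)
        qed
        have b3: "norm (exp (of_real (v n) * e1 u + of_nat n * (of_real (v n) * e2 u))) \<le> exp v2 * exp 1 * exp (t / 2)"
        proof -
          have "norm (of_real (v n) * e1 u) \<le> v2 * 1"
            unfolding norm_mult using v0[of n] v(2)[of n] nr(2) by (intro mult_mono) auto
          moreover have "norm (of_nat n * (of_real (v n) * e2 u)) \<le> 1 + t / 2"
          proof -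
            have "norm (of_nat n * (of_real (v n) * e2 u)) = real n * (v n * norm (e2 u))"
              using v0[of n] by (simp add: norm_mult)
            also have "\<dots> \<le> real n * (v2 * (\<epsilon> * norm u))"
              using v0[of n] v(2)[of n] nr(3) by (intro mult_left_mono mult_mono) auto
            also have "\<dots> = (v2 * \<epsilon> / (1 - v n * c)) * norm w"
              using Mp by (subst n_eq) (simp add: nu)
            also have "\<dots> \<le> (v2 * \<epsilon> / \<mu>0) * norm w"
              using v0 v2_nonneg \<epsilon> \<mu>(1) \<mu>(2)[of n] by (intro mult_right_mono divide_left_mono mult_pos_pos) auto
            also have "v2 * \<epsilon> / \<mu>0 = v2 / (1 + v2) / (2 * (1 + m))"
              using \<mu>(1) by (simp add: \<epsilon>_def) (simp add: algebra_simps)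
            also have "\<dots> * norm w \<le> 1 / (2 * (1 + m)) * norm w"
              using v0 v2_nonneg m by (intro mult_right_mono divide_right_mono) (auto simp: divide_simps)
            also have "\<dots> \<le> 1 / (2 * (1 + m)) * (1 + (1 + m) * t)"
              using w2 m by (intro mult_left_mono) auto
            also have "\<dots> = 1 / (2 * (1 + m)) + t / 2" using m by (simp add: field_simps)
            also have "\<dots> \<le> 1 + t / 2" using m by (simp add: field_simps)
            finally show ?thesis .
          qed
          ultimately have "norm (of_real (v n) * e1 u + of_nat n * (of_real (v n) * e2 u)) \<le> v2 + 1 + t / 2"
            by (intro order_trans[OF norm_triangle_ineq]) linarith
          then have "norm (exp (of_real (v n) * e1 u + of_nat n * (of_real (v n) * e2 u))) \<le> exp (v2 + 1 + t / 2)"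
            by (intro order_trans[OF norm_exp]) simp
          then show ?thesis by (simp add: exp_add)
        qed
        have "norm (of_real (M n powr (- \<alpha> n)) * \<Phi> n u) \<le>
           (exp 1 * exp (- t)) * 4 powr A * 2 * (exp v2 * exp 1 * exp (t / 2))"
          unfolding factor[OF u s elim(2)] norm_mult by (intro mult_mono mult_nonneg_nonneg b1 b2 b3 nr(1)) auto
        also have "\<dots> = C * (exp (- t) * exp (t / 2))" by (simp add: C_def)
        also have "exp (- t) * exp (t / 2) = exp (- (1 / 2) * t)" by (simp flip: exp_add)
        finally show "norm (of_real (M n powr (- \<alpha> n)) * \<Phi> n (ray m s t / of_real (M n))) \<le> C * exp (- (1 / 2) * t)"
          by (simp add: u_def w_def)
      qed
    qed
  qed

  \<comment> \<open>The far sides do not depend on \<open>n\<close>; by compactness \<open>F\<close>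
    and \<open>G\<close> are bounded there, and the decay comes from \<open>v n * H u - u\<close>
    alone.\<close>
  define Q where "Q = (\<lambda>s. (\<lambda>x. Complex x (s * (m * T))) ` {x0..T} \<union> (\<lambda>y. Complex x0 (s * y)) ` {m * T..pi})"
  have Q_sub: "Q s \<subseteq> log_sector k B s" if "s \<in> {1, -1}" for s
  proof -
    have kx: "k * x < m * T" if "x \<le> T" for x
    proof -
      have "k * x \<le> k * T" using k that by (intro mult_left_mono) auto
      also have "\<dots> < m * T" using m T by (intro mult_strict_right_mono) auto
      finally show ?thesis .
    qed
    have pi3: "y < 3 * pi / 2" if "y \<le> pi" for y using that pi_gt_zero by linarith
    show ?thesis
    proof
      fix u assume "u \<in> Q s"
      then consider x where "u = Complex x (s * (m * T))" "x \<le> T" | y where "u = Complex x0 (s * y)" "m * T \<le> y" "y \<le> pi"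
        unfolding Q_def Un_iff image_iff Bex_def atLeastAtMost_iff by blast
      then show "u \<in> log_sector k B s"
      proof cases
        case 1
        then show ?thesis using kx[OF 1(2)] pi3[of "m * T"] T1 TB that by (auto simp: log_sector_def)
      next
        case 2
        then show ?thesis using kx[of x0] pi3[of y] x0 TB that by (auto simp: log_sector_def)
      qed
    qed
  qed
  have Q_compact: "compact (Q s)" for s
    unfolding Q_def Complex_eq by (intro compact_Un compact_continuous_image continuous_intros) auto
  have "\<exists>K. \<forall>u\<in>Q s. norm (F u) \<le> K \<and> norm (G u) \<le> K" if s: "s \<in> {1, -1}" for s
  proof -
    have "compact (F ` Q s)" "compact (G ` Q s)"
      using holomorphic_on_imp_continuous_on[OF holomorphic_on_subset[OF F[OF s] Q_sub[OF s]]]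
        holomorphic_on_imp_continuous_on[OF holomorphic_on_subset[OF G[OF s] Q_sub[OF s]]]
      by (auto intro!: compact_continuous_image Q_compact)
    then obtain K1 K2 where "\<forall>y\<in>F ` Q s. norm y \<le> K1" "\<forall>y\<in>G ` Q s. norm y \<le> K2"
      by (meson bounded_iff compact_imp_bounded)
    then show ?thesis by (intro exI[of _ "max K1 K2"]) (auto simp: le_max_iff_disj)
  qed
  from this[of 1] this[of "-1"] obtain K1 K2 where
    "\<forall>u\<in>Q 1. norm (F u) \<le> K1 \<and> norm (G u) \<le> K1" "\<forall>u\<in>Q (-1). norm (F u) \<le> K2 \<and> norm (G u) \<le> K2"
    by auto
  then have "\<forall>s\<in>{1, -1}. \<forall>u\<in>Q s. norm (F u) \<le> max K1 K2 \<and> norm (G u) \<le> max K1 K2"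
    by (auto simp: le_max_iff_disj)
  then obtain K where K: "\<And>s u. s \<in> {1, -1} \<Longrightarrow> u \<in> Q s \<Longrightarrow> norm (F u) \<le> K \<and> norm (G u) \<le> K"
    by blast
  \<comment> \<open>The factors bound, in this order, \<open>M n powr (1 - \<alpha> n)\<close>
    (together with the \<open>n\<close> in front of the exponential, once
    \<open>M n \<ge> 1\<close>), \<open>F\<close>, the exponential of \<open>v n * G u\<close>, and
    the decay on the far sides.\<close>
  define eps where "eps = (\<lambda>n. \<mu>1 * K * exp (v2 * K) * (real n * exp (- \<rho> * real n)))"
  have "(\<lambda>n. real n * exp (- \<rho> * real n)) \<longlonglongrightarrow> 0"
    using \<rho> by real_asymp
  then have eps: "eps \<longlonglongrightarrow> 0" unfolding eps_def by (rule tendsto_mult_right_zero)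
  have far_bound: "M n powr (1 - \<alpha> n) * norm (\<Phi> n u) \<le> eps n"
    if n: "n > 0" "M n \<ge> 1" and s: "s \<in> {1, -1}" and u: "u \<in> Q s" and Hu: "v n * Re (H u) - Re u \<le> - \<rho>" for n s u
  proof -
    have K': "norm (F u) \<le> K" "norm (G u) \<le> K" using K[OF s u] by auto
    have K0: "K \<ge> 0" using K'(1) norm_ge_zero[of "F u"] by linarith
    have "Re (of_real (v n) * G u + of_nat n * (of_real (v n) * H u) - of_nat n * u) =
        v n * Re (G u) + real n * (v n * Re (H u) - Re u)" by (simp add: algebra_simps)
    also have "\<dots> \<le> v2 * K + real n * (- \<rho>)"
    proof (intro add_mono mult_left_mono Hu)
      have "v n * Re (G u) \<le> v n * K" using K'(2) complex_Re_le_cmod[of "G u"] v0[of n] by (intro mult_left_mono) auto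
      also have "\<dots> \<le> v2 * K" using v(2)[of n] K0 by (intro mult_right_mono)
      finally show "v n * Re (G u) \<le> v2 * K" .
    qed simp
    finally have "norm (exp (of_real (v n) * G u + of_nat n * (of_real (v n) * H u) - of_nat n * u)) \<le> exp (v2 * K + real n * (- \<rho>))"
      by (simp only: norm_exp_eq_Re exp_le_cancel_iff)
    then have "norm (\<Phi> n u) \<le> K * exp (v2 * K + real n * (- \<rho>))"
      unfolding \<Phi>_def norm_mult using K'(1) K0 by (intro mult_mono) auto
    moreover have "M n powr (1 - \<alpha> n) \<le> real n * \<mu>1"
    proof -
      have "M n powr (1 - \<alpha> n) \<le> M n powr 1" using n \<alpha>(1)[of n] by (intro powr_mono) auto
      then show ?thesis using M_le[of n] n by simp
    qed
    moreover have "real n * \<mu>1 \<ge> 0" using M_le[of n] n by linarith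
    ultimately have "M n powr (1 - \<alpha> n) * norm (\<Phi> n u) \<le> (real n * \<mu>1) * (K * exp (v2 * K + real n * (- \<rho>)))"
      by (intro mult_mono) auto
    also have "\<dots> = eps n" by (simp add: eps_def exp_diff exp_minus divide_inverse mult_ac)
    finally show ?thesis .
  qed
  have far_ev: "\<forall>\<^sub>F n in sequentially. \<forall>s\<in>{1, -1}.
       (\<forall>x\<in>{x0..T}. M n powr (1 - \<alpha> n) * norm (\<Phi> n (Complex x (s * (m * T)))) \<le> eps n) \<and>
       (\<forall>y\<in>{m * T..pi}. M n powr (1 - \<alpha> n) * norm (\<Phi> n (Complex x0 (s * y))) \<le> eps n)"
  proof -
    have "\<forall>\<^sub>F n in sequentially. M n \<ge> 1" using M by (auto simp: filterlim_at_top)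
    then show ?thesis using eventually_gt_at_top[of 0]
    proof eventually_elim
      case (elim n)
      have vn: "v n \<in> {v1..v2}" using v by simp
      show ?case
      proof (intro ballI conjI)
        fix s x assume s: "s \<in> {1, -1::real}" and x: "x \<in> {x0..T}"
        show "M n powr (1 - \<alpha> n) * norm (\<Phi> n (Complex x (s * (m * T)))) \<le> eps n"
          using far'(1)[OF s vn x] x by (intro far_bound[OF elim(2,1) s]) (auto simp: Q_def)
      next
        fix s y assume s: "s \<in> {1, -1::real}" and y: "y \<in> {m * T..pi}"
        show "M n powr (1 - \<alpha> n) * norm (\<Phi> n (Complex x0 (s * y))) \<le> eps n"
          using far'(2)[OF s vn y] y by (intro far_bound[OF elim(2,1) s]) (auto simp: Q_def)
      qed
    qed
  qed
  have hol: "\<Phi> n holomorphic_on log_sector k B s" if "s \<in> {1, -1}" for n s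
    unfolding \<Phi>_def by (intro holomorphic_intros F G H that)
  have perPhi: "\<Phi> n (u + 2 * pi * \<i>) = \<Phi> n u" for n u
  proof -
    have "exp (of_nat n * (2 * pi * \<i>)) = exp (2 * pi * \<i>) ^ n" by (rule exp_of_nat_mult)
    then have "exp (of_nat n * (2 * pi * \<i>)) = 1" by simp
    then have "exp (x - of_nat n * (u + 2 * pi * \<i>)) = exp (x - of_nat n * u)" for x
      by (simp add: exp_diff exp_add distrib_left)
    then show ?thesis unfolding \<Phi>_def by (simp only: per)
  qed
  show ?thesis
    by (rule hankel_limit[where b = "1 / 2", OF k hol perPhi M \<alpha> T(1) TB(1) T1[unfolded m_def] x0
          near_lim[unfolded m_def] _ _ near_bound[unfolded m_def] eps far_ev[unfolded m_def]]) simp_all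
qed

section \<open>Hankel's formula and the far part of the contour\<close>

lemma zcoeff_one_minus_powr:
  "zcoeff n (\<lambda>z. (1 - z) powr c) = (-1) ^ n * (c gchoose n)"
proof -
  have "((\<lambda>x. (1 + x) powr c) \<circ> (\<lambda>x. - x)) has_fps_expansion (fps_binomial c oo (- fps_X))"
    by (intro has_fps_expansion_compose fps_expansion_intros) auto
  then have "(\<lambda>z. (1 - z) powr c) has_fps_expansion (fps_binomial c oo (- fps_X))"
    by (simp add: o_def)
  from fps_nth_fps_expansion[OF this, of n] show ?thesis
    by (simp add: zcoeff_def fps_compose_uminus' fps_binomial_nth)
qed

text \<open>Hankel's formula, obtained by evaluating the coefficients of \<open>(1 - z) powr (- \<alpha>)\<close>
  asymptotically in two ways.\<close>

lemma hankel_eq: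
  assumes k: "k > 0" and \<alpha>: "\<alpha> > 0"
  shows "hankel (k + 1) \<alpha> = 2 * pi * \<i> / of_real (Gamma \<alpha>)"
proof -
  define F where "F = (\<lambda>z::complex. (1 - z) powr (- of_real \<alpha>))"
  \<comment> \<open>With \<open>c = 0\<close> and \<open>v = 1\<close> the scale is
    \<open>M n = n\<close>. The choice \<open>B = 1\<close> is arbitrary among positive values, as
    \<open>F\<close> is holomorphic off its cut.\<close>
  have "(\<lambda>n. of_real ((real n * (1 - 1 * 0)) powr (1 - (1 * 0 + \<alpha>))) * contour_integral
      (linepath (Complex (- 1 / (real n * (1 - 1 * 0))) (- pi)) (Complex (- 1 / (real n * (1 - 1 * 0))) pi))
      (\<lambda>u. F (exp u) * exp (of_real 1 * 0 + of_nat n * (of_real 1 * 0) - of_nat n * u)) - hankel (k + 1) (1 * 0 + \<alpha>)) \<longlonglongrightarrow> 0"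
  proof (rule hankel_limit_exp[where v = "\<lambda>_. 1" and F = "\<lambda>u. F (exp u)" and G = "\<lambda>_. 0" and H = "\<lambda>_. 0"
        and c = 0 and \<theta> = 0 and \<beta> = \<alpha> and B = 1 and ?v1.0 = 1 and ?v2.0 = 1 and ?\<mu>0.0 = 1 and k = k])
    fix s :: real assume s: "s \<in> {1, -1}"
    have nz: "1 - exp u \<notin> \<real>\<^sub>\<le>\<^sub>0" if "u \<in> log_sector k 1 s" for u
      using exp_log_sector_notin_nonpos[OF that _ k] s by auto
    then show "(\<lambda>u. F (exp u)) holomorphic_on log_sector k 1 s"
      unfolding F_def by (intro holomorphic_intros) auto
    have "F (exp u) * (1 - exp u) powr of_real \<alpha> = 1" if "u \<in> log_sector k 1 s" for u
    proof -
      have "1 - exp u \<noteq> 0" using nz[OF that] by auto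
      then have "(1 - exp u) powr of_real \<alpha> \<noteq> 0" by (simp only: powr_eq_0_iff not_False_eq_True)
      then show ?thesis by (simp add: F_def powr_minus)
    qed
    then have "\<forall>\<^sub>F u in at 0 within log_sector k 1 s. F (exp u) * (1 - exp u) powr of_real \<alpha> = 1"
      by (auto simp: eventually_at_filter)
    then show "((\<lambda>u. F (exp u) * (1 - exp u) powr of_real \<alpha>) \<longlongrightarrow> 1) (at 0 within log_sector k 1 s)"
      by (rule tendsto_eventually)
  next
    fix T0 :: real assume T0: "T0 > 0"
    show "\<exists>T x0 \<rho>. 0 < T \<and> T < T0 \<and> 0 \<le> x0 \<and> x0 < T \<and> 0 < \<rho> \<and>
       (\<forall>s\<in>{1, -1}. \<forall>w\<in>{1..1}. (\<forall>x\<in>{x0..T}. w * Re 0 - x \<le> - \<rho>) \<and>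
         (\<forall>y\<in>{(k + 1) * T..pi}. w * Re 0 - x0 \<le> - \<rho>))"
      \<comment> \<open>As \<open>H = 0\<close>, the only gain is \<open>- x \<le> - x0\<close>. So
        the vertical side is placed at a positive abscissa, and \<open>\<rho> = x0\<close>.\<close>
      by (rule exI[of _ "T0 / 2"], rule exI[of _ "T0 / 4"], rule exI[of _ "T0 / 4"]) (use T0 in auto)
  qed (use k \<alpha> in \<open>auto simp: exp_add\<close>)
  then have lim: "(\<lambda>n. of_real (real n powr (1 - \<alpha>)) * contour_integral
      (linepath (Complex (- 1 / real n) (- pi)) (Complex (- 1 / real n) pi))
      (\<lambda>u. F (exp u) * exp (- of_nat n * u)) - hankel (k + 1) \<alpha>) \<longlonglongrightarrow> 0" by simp
  have hol: "F holomorphic_on ball 0 1"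
  proof -
    have "1 - z \<notin> \<real>\<^sub>\<le>\<^sub>0" if "z \<in> ball 0 1" for z :: complex
      using that complex_Re_le_cmod[of z] by (auto simp: complex_nonpos_Reals_iff)
    then show ?thesis unfolding F_def by (intro holomorphic_intros) auto
  qed
  have eq: "contour_integral (linepath (Complex (- 1 / real n) (- pi)) (Complex (- 1 / real n) pi))
      (\<lambda>u. F (exp u) * exp (- of_nat n * u)) = 2 * pi * \<i> * zcoeff n F" if "n > 0" for n
    using contour_integral_unique[OF zcoeff_contour_integral[OF hol, of "- 1 / real n" n]] that by simp
  \<comment> \<open>The known asymptotics of binomial coefficients give the limit of the normalised
    contour integral; since \<open>hankel (k + 1) \<alpha>\<close> is constant in \<open>n\<close>,
    this determines it.\<close>
  have "(\<lambda>n. 2 * pi * \<i> * ((- of_real \<alpha> gchoose n) / ((-1) ^ n / exp ((- of_real \<alpha> + 1) * of_real (ln (real n))))))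
     \<longlonglongrightarrow> 2 * pi * \<i> * inverse (Gamma (- (- complex_of_real \<alpha>)))"
    by (intro tendsto_intros gbinomial_asymptotic)
  then have "(\<lambda>n. of_real (real n powr (1 - \<alpha>)) * contour_integral
      (linepath (Complex (- 1 / real n) (- pi)) (Complex (- 1 / real n) pi))
      (\<lambda>u. F (exp u) * exp (- of_nat n * u))) \<longlonglongrightarrow> 2 * pi * \<i> * inverse (Gamma (- (- complex_of_real \<alpha>)))"
  proof (rule Lim_transform_eventually)
    show "\<forall>\<^sub>F n in sequentially. 2 * pi * \<i> * ((- of_real \<alpha> gchoose n) / ((-1) ^ n / exp ((- of_real \<alpha> + 1) * of_real (ln (real n))))) =
      of_real (real n powr (1 - \<alpha>)) * contour_integral
      (linepath (Complex (- 1 / real n) (- pi)) (Complex (- 1 / real n) pi))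
      (\<lambda>u. F (exp u) * exp (- of_nat n * u))"
      using eventually_gt_at_top[of 0]
    proof eventually_elim
      case (elim n)
      have "exp ((- of_real \<alpha> + 1) * of_real (ln (real n))) = complex_of_real (real n powr (1 - \<alpha>))"
        using elim by (simp add: powr_def flip: exp_of_real)
      moreover have "x / ((-1) ^ n / y) = (-1) ^ n * x * y" for x y :: complex
        by (cases "even n") auto
      ultimately show ?case
        unfolding eq[OF elim] unfolding F_def zcoeff_one_minus_powr by (simp add: mult_ac)
    qed
  qed
  from tendsto_diff[OF this lim] show ?thesis
    by (simp add: LIMSEQ_const_iff Gamma_complex_of_real divide_inverse)
qed

text \<open>The vertical side is the imaginary axis (\<open>x0 = 0\<close>), where
  \<open>neg\<close> and compactness give a gap \<open>\<rho>0\<close>. On the horizontal side the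
  bound \<open>\<epsilon> * norm u\<close> for the error is too weak: it is of order
  \<open>\<epsilon> * T\<close>, while the gap depends on \<open>T\<close> and may be much smaller.
  Instead the growth of the error from the axis to abscissa \<open>x\<close> is bounded by
  \<open>\<delta> * x\<close>, which is absorbed because
  \<open>w * (c + \<delta>) \<le> 1\<close>.\<close>

lemma far_estimate:
  fixes H :: "complex \<Rightarrow> complex"
  assumes k: "k > 0" and B: "B > 0"
    and H: "\<And>s. s \<in> {1, -1} \<Longrightarrow> H holomorphic_on log_sector k B s"
    and H_lim: "\<And>s. s \<in> {1, -1} \<Longrightarrow> ((\<lambda>u. (H u - of_real c * u) / u) \<longlongrightarrow> 0) (at 0 within log_sector k B s)"
    and neg: "\<And>s y. s \<in> {1, -1} \<Longrightarrow> 0 < y \<Longrightarrow> y \<le> pi \<Longrightarrow> Re (H (Complex 0 (s * y))) < 0"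
    and v: "0 < v1" "v1 \<le> v2" and \<mu>: "\<mu>0 > 0" "\<And>w. w \<in> {v1..v2} \<Longrightarrow> \<mu>0 \<le> 1 - w * c"
    and T0: "T0 > 0"
  shows "\<exists>T x0 \<rho>. 0 < T \<and> T < T0 \<and> 0 \<le> x0 \<and> x0 < T \<and> \<rho> > 0 \<and>
       (\<forall>s\<in>{1, -1}. \<forall>w\<in>{v1..v2}.
         (\<forall>x\<in>{x0..T}. w * Re (H (Complex x (s * ((k + 1) * T)))) - x \<le> - \<rho>) \<and>
         (\<forall>y\<in>{(k + 1) * T..pi}. w * Re (H (Complex x0 (s * y))) - x0 \<le> - \<rho>))"
proof -
  define m where "m = k + 1"
  have m: "m > 1" using k by (simp add: m_def)
  define e where "e = (\<lambda>u. H u - of_real c * u)"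
  \<comment> \<open>With \<open>norm (e u) \<le> \<epsilon> * ((m + 2) * T)\<close> on circles of
    radius \<open>T / (2 * m)\<close>, the Cauchy estimate yields
    \<open>2 * m * (m + 2) * \<epsilon> = \<mu>0 / (v2 + 1)\<close>, the \<open>\<delta>\<close>
    below, and then \<open>w * \<delta> \<le> \<mu>0 \<le> 1 - w * c\<close>.\<close>
  define \<epsilon> where "\<epsilon> = \<mu>0 / (2 * m * (m + 2) * (v2 + 1))"
  have \<epsilon>: "\<epsilon> > 0" using \<mu> v m by (simp add: \<epsilon>_def)
  have "\<exists>r>0. \<forall>u\<in>log_sector k B s. norm u < r \<longrightarrow> norm (e u) \<le> \<epsilon> * norm u" if s: "s \<in> {1, -1}" for s
  proof -
    have "\<forall>\<^sub>F u in at 0 within log_sector k B s. dist (e u / u) 0 < \<epsilon>"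
      using H_lim[OF s] \<epsilon> unfolding e_def by (rule tendstoD)
    then obtain r where r: "r > 0" "\<And>u. u \<in> log_sector k B s \<Longrightarrow> u \<noteq> 0 \<Longrightarrow> dist u 0 < r \<Longrightarrow> dist (e u / u) 0 < \<epsilon>"
      unfolding eventually_at by metis
    have "norm (e u) \<le> \<epsilon> * norm u" if "u \<in> log_sector k B s" "norm u < r" for u
    proof -
      have "u \<noteq> 0" using that(1) by (auto simp: log_sector_def)
      then show ?thesis using r(2)[of u] that by (simp add: norm_divide field_simps)
    qed
    then show ?thesis using r(1) by blast
  qed
  from this[of 1] this[of "-1"] obtain r1 r2 where r: "r1 > 0" "r2 > 0"
    "\<forall>u\<in>log_sector k B 1. norm u < r1 \<longrightarrow> norm (e u) \<le> \<epsilon> * norm u"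
    "\<forall>u\<in>log_sector k B (-1). norm u < r2 \<longrightarrow> norm (e u) \<le> \<epsilon> * norm u" by auto
  define r where "r = min r1 r2"
  have r0: "r > 0" using r by (simp add: r_def)
  have small: "norm (e u) \<le> \<epsilon> * norm u" if "s \<in> {1, -1}" "u \<in> log_sector k B s" "norm u < r" for s u
    using that r(3,4) by (auto simp: r_def)
  define T where "T = min (T0 / 2) (min (B / 4) (min (pi / (2 * m)) (r / (2 * (m + 2)))))"
  have "T \<le> T0 / 2" "T \<le> B / 4" "T \<le> pi / (2 * m)" "T \<le> r / (2 * (m + 2))"
    by (simp_all only: T_def min_le_iff_disj order_refl simp_thms)
  moreover have T: "T > 0" using T0 B m r0 by (auto simp: T_def)
  ultimately have T1: "T < T0" "2 * T < B" "m * T \<le> pi / 2" and T2: "(m + 2) * T < r"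
    using m r0 T0 B by (auto simp: field_simps)
  have T3: "m * T \<le> pi" using T1(3) pi_gt_zero by linarith
  \<comment> \<open>Here \<open>m = k + 1\<close> enters: the point with abscissa
    \<open>T + T / m\<close> and height \<open>m * T - T / m\<close> lies on the slanted edge, so
    open discs of radius \<open>T / m\<close> about the horizontal side stay in the sector.\<close>
  have kmT: "k * T + k * T / m = m * T - T / m" using m by (simp add: m_def field_simps)
  have Tm: "0 < T / m" "T / m \<le> T" using T m by (auto simp: field_simps)
  have ball: "u \<in> log_sector k B s" "norm u \<le> (m + 2) * T"
    if s: "s \<in> {1, -1}" and x: "0 \<le> x" "x \<le> T" and u: "dist (Complex x (s * (m * T))) u < T / m" for s x u
  proof -
    define u0 where "u0 = Complex x (s * (m * T))"
    have "\<bar>Re u - x\<bar> < T / m" "\<bar>Im u - s * (m * T)\<bar> < T / m"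
      using u abs_Re_le_cmod[of "u - u0"] abs_Im_le_cmod[of "u - u0"]
      by (auto simp: dist_norm norm_minus_commute u0_def)
    then have re: "Re u < x + T / m" and im: "m * T - T / m < s * Im u" "s * Im u < m * T + T / m"
      using s by auto
    have "k * Re u < k * (x + T / m)" using re k by simp
    also have "\<dots> \<le> k * (T + T / m)" using x k by simp
    also have "\<dots> = m * T - T / m" using kmT by (simp add: distrib_left)
    finally have "k * Re u < s * Im u" using im by simp
    moreover have "Re u < B" using re x Tm T1 by linarith
    moreover have "T \<le> m * T" using m T by simp
    then have "s * Im u < 3 * pi / 2" using im Tm T1 pi_gt_zero by linarith
    ultimately show "u \<in> log_sector k B s" by (simp add: log_sector_def)
    have "norm u0 \<le> \<bar>x\<bar> + \<bar>s * (m * T)\<bar>" using cmod_le[of u0] by (simp add: u0_def)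
    also have "\<dots> \<le> T + m * T" using x s m T by (auto simp: abs_mult)
    finally have "norm u0 \<le> T + m * T" .
    moreover have "norm u \<le> norm u0 + dist u0 u" using norm_triangle_sub[of u u0] by (simp add: dist_norm norm_minus_commute)
    ultimately show "norm u \<le> (m + 2) * T" using u Tm by (simp add: u0_def distrib_right)
  qed
  define \<delta> where "\<delta> = \<mu>0 / (v2 + 1)"
  have e_hol: "e holomorphic_on log_sector k B s" if "s \<in> {1, -1}" for s
    unfolding e_def by (intro holomorphic_intros H that)
  have deriv: "norm (deriv e (Complex x (s * (m * T)))) \<le> \<delta>"
    if s: "s \<in> {1, -1}" and x: "0 \<le> x" "x \<le> T" for s x
  proof -
    let ?u = "Complex x (s * (m * T))"
    have sub: "cball ?u (T / (2 * m)) \<subseteq> log_sector k B s"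
      using ball(1)[OF s x] Tm by (auto simp: field_simps)
    have "norm ((deriv ^^ 1) e ?u) \<le> fact 1 * (\<epsilon> * ((m + 2) * T)) / (T / (2 * m)) ^ 1"
    proof (rule Cauchy_inequality)
      show "e holomorphic_on ball ?u (T / (2 * m))"
        by (rule holomorphic_on_subset[OF e_hol[OF s]]) (use sub ball_subset_cball in blast)
      show "continuous_on (cball ?u (T / (2 * m))) e"
        by (rule holomorphic_on_imp_continuous_on[OF holomorphic_on_subset[OF e_hol[OF s] sub]])
      show "0 < T / (2 * m)" using T m by simp
      fix u assume "norm (?u - u) = T / (2 * m)"
      then have "dist ?u u < T / m" using T m by (simp add: dist_norm field_simps)
      note b = ball[OF s x this]
      have "norm (e u) \<le> \<epsilon> * norm u" using small[OF s b(1)] b(2) T2 by simp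
      also have "\<dots> \<le> \<epsilon> * ((m + 2) * T)" using b(2) \<epsilon> by (intro mult_left_mono) auto
      finally show "norm (e u) \<le> \<epsilon> * ((m + 2) * T)" .
    qed
    also have "\<dots> = \<epsilon> * (2 * m * (m + 2))" using T m by (simp add: field_simps)
    also have "\<dots> = \<delta>" using m v by (simp add: \<epsilon>_def \<delta>_def)
    finally show ?thesis by simp
  qed
  have horiz: "norm (e (Complex x (s * (m * T))) - e (Complex 0 (s * (m * T)))) \<le> \<delta> * x"
    if s: "s \<in> {1, -1}" and x: "0 \<le> x" "x \<le> T" for s x
  proof -
    let ?S = "closed_segment (Complex 0 (s * (m * T))) (Complex x (s * (m * T)))"
    have "norm (e (Complex x (s * (m * T))) - e (Complex 0 (s * (m * T)))) \<le> \<delta> * norm (Complex x (s * (m * T)) - Complex 0 (s * (m * T)))"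
    proof (rule field_differentiable_bound[of ?S e "deriv e"])
      fix z assume z: "z \<in> ?S"
      then have z': "z = Complex (Re z) (s * (m * T))" "0 \<le> Re z" "Re z \<le> T"
        using x by (auto simp: closed_segment_same_Im complex_eq_iff closed_segment_eq_real_ivl split: if_splits)
      show "norm (deriv e z) \<le> \<delta>" using deriv[OF s z'(2,3)] z'(1) by simp
      have "z \<in> log_sector k B s" using ball(1)[OF s z'(2,3), of z] z'(1) Tm by simp
      then show "(e has_field_derivative deriv e z) (at z within ?S)"
        using holomorphic_derivI[OF e_hol[OF s] open_log_sector] has_field_derivative_at_within by blast
    qed auto
    also have "Complex x (s * (m * T)) - Complex 0 (s * (m * T)) = of_real x" by (simp add: complex_eq_iff)
    finally show ?thesis using x by simp
  qed
  have "\<exists>\<rho>>0. \<forall>y\<in>{m * T..pi}. Re (H (Complex 0 (s * y))) \<le> - \<rho>" if s: "s \<in> {1, -1}" for s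
  proof -
    let ?h = "\<lambda>y. Re (H (Complex 0 (s * y)))"
    have "continuous_on {m * T..pi} ?h"
    proof (rule continuous_on_Re, rule continuous_on_compose2[OF holomorphic_on_imp_continuous_on[OF H[OF s]]])
      show "continuous_on {m * T..pi} (\<lambda>y. Complex 0 (s * y))"
        unfolding Complex_eq by (intro continuous_intros)
      have "0 < m * T" using m T by simp
      then have "0 < y \<and> y < 3 * pi / 2" if "y \<in> {m * T..pi}" for y
        using that pi_gt_zero by (auto simp del: pi_gt_zero)
      then show "(\<lambda>y. Complex 0 (s * y)) ` {m * T..pi} \<subseteq> log_sector k B s"
        using s B by (auto simp: log_sector_def)
    qed
    moreover have "{m * T..pi} \<noteq> {}" using T3 by auto
    ultimately obtain y0 where y0: "y0 \<in> {m * T..pi}" "\<And>y. y \<in> {m * T..pi} \<Longrightarrow> ?h y \<le> ?h y0"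
      using continuous_attains_sup[OF compact_Icc, of "m * T" pi ?h] by blast
    have "0 < m * T" using m T by simp
    then have "?h y0 < 0" using y0(1) by (intro neg[OF s]) auto
    then show ?thesis using y0(2) by (intro exI[of _ "- ?h y0"]) auto
  qed
  from this[of 1] this[of "-1"] obtain \<rho>1 \<rho>2 where \<rho>: "\<rho>1 > 0" "\<rho>2 > 0"
    "\<forall>y\<in>{m * T..pi}. Re (H (Complex 0 (1 * y))) \<le> - \<rho>1" "\<forall>y\<in>{m * T..pi}. Re (H (Complex 0 (-1 * y))) \<le> - \<rho>2"
    by auto
  define \<rho>0 where "\<rho>0 = min \<rho>1 \<rho>2"
  have \<rho>0: "\<rho>0 > 0" using \<rho> by (simp add: \<rho>0_def)
  \<comment> \<open>The gap has to survive multiplication by \<open>w\<close>; this is where the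
    lower bound \<open>v1 > 0\<close> enters.\<close>
  have strict: "w * Re (H (Complex 0 (s * y))) \<le> - (v1 * \<rho>0)"
    if s: "s \<in> {1, -1}" and y: "y \<in> {m * T..pi}" and w: "w \<in> {v1..v2}" for s y w
  proof -
    have "Re (H (Complex 0 (s * y))) \<le> - \<rho>0"
      using s \<rho>(3,4)[rule_format, OF y] by (auto simp: \<rho>0_def)
    then have "w * Re (H (Complex 0 (s * y))) \<le> w * (- \<rho>0)" using w v by (intro mult_left_mono) auto
    also have "\<dots> \<le> v1 * (- \<rho>0)" using w \<rho>0 by (intro mult_right_mono_neg) auto
    finally show ?thesis by simp
  qed
  have seg: "w * Re (H (Complex x (s * (m * T)))) - x \<le> - (v1 * \<rho>0)"
    if s: "s \<in> {1, -1}" and x: "x \<in> {0..T}" and w: "w \<in> {v1..v2}" for s x w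
  proof -
    let ?u = "Complex x (s * (m * T))" and ?a = "Complex 0 (s * (m * T))"
    have "Re (e ?u) - Re (e ?a) \<le> \<delta> * x"
      using horiz[OF s, of x] x complex_Re_le_cmod[of "e ?u - e ?a"] by (auto simp: algebra_simps)
    then have "Re (H ?u) \<le> Re (H ?a) + (c + \<delta>) * x" by (simp add: e_def algebra_simps)
    then have "w * Re (H ?u) \<le> w * (Re (H ?a) + (c + \<delta>) * x)" using w v by (intro mult_left_mono) auto
    moreover have "w * \<delta> \<le> \<mu>0"
    proof -
      have "w * \<delta> \<le> (v2 + 1) * \<delta>" using w v \<mu> by (intro mult_right_mono) (auto simp: \<delta>_def)
      then show ?thesis using v by (simp add: \<delta>_def)
    qed
    then have "(w * \<delta> + w * c - 1) * x \<le> 0" using \<mu>(2)[OF w] x by (intro mult_nonpos_nonneg) auto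
    moreover have "w * Re (H ?a) \<le> - (v1 * \<rho>0)" using T3 by (intro strict s w) auto
    ultimately show ?thesis by (simp add: algebra_simps)
  qed
  show ?thesis unfolding m_def[symmetric]
    using T T1(1) \<rho>0 v seg strict by (intro exI[of _ T] exI[of _ 0] exI[of _ "v1 * \<rho>0"]) auto
qed

section \<open>Behaviour near and on the circle of convergence\<close>

lemma tendsto_0_if_bigo_powr:
  fixes g :: "complex \<Rightarrow> complex" and \<delta> R :: real
  assumes g: "g \<in> O[at (of_real R) within D](\<lambda>z. (1 - z / of_real R) powr of_real \<delta>)" and \<delta>: "\<delta> > 0" and R: "R > 0"
  shows "(g \<longlongrightarrow> 0) (at (of_real R) within D)"
proof -
  obtain C where C: "\<forall>\<^sub>F z in at (of_real R) within D. norm (g z) \<le> C * norm ((1 - z / of_real R) powr of_real \<delta>)"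
    using g by (auto elim: landau_o.bigE)
  have "((\<lambda>z. norm (1 - z / complex_of_real R)) \<longlongrightarrow> norm (1 - complex_of_real R / of_real R)) (at (of_real R) within D)"
    using R by (intro tendsto_intros) auto
  then have "((\<lambda>z. norm (1 - z / complex_of_real R)) \<longlongrightarrow> 0) (at (of_real R) within D)" using R by simp
  then have "((\<lambda>z. C * norm (1 - z / complex_of_real R) powr \<delta>) \<longlongrightarrow> C * 0 powr \<delta>) (at (of_real R) within D)"
    using \<delta> by (intro tendsto_mult tendsto_const tendsto_powr2) auto
  then have "((\<lambda>z. C * norm (1 - z / complex_of_real R) powr \<delta>) \<longlongrightarrow> 0) (at (of_real R) within D)" using \<delta> by simp
  then show ?thesis
    by (rule Lim_null_comparison[rotated]) (use C in \<open>simp add: norm_powr_real_powr'\<close>)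
qed

text \<open>Division costs one power of \<open>1 - z / R\<close>, and the power
  \<open>\<delta> > 0\<close> remains. In this form the expansion of \<open>g\<^sub>\<kappa>\<close>
  turns into an error \<open>o(u)\<close>.\<close>

lemma tendsto_0_divide_if_bigo_powr:
  fixes g :: "complex \<Rightarrow> complex" and \<delta> R :: real
  assumes g: "g \<in> O[at (of_real R) within D](\<lambda>z. (1 - z / of_real R) powr of_real (1 + \<delta>))" and \<delta>: "\<delta> > 0" and R: "R > 0"
  shows "((\<lambda>z. g z / (1 - z / of_real R)) \<longlongrightarrow> 0) (at (of_real R) within D)"
proof (rule tendsto_0_if_bigo_powr[OF _ \<delta> R])
  obtain C where "\<forall>\<^sub>F z in at (of_real R) within D. norm (g z) \<le> C * norm ((1 - z / of_real R) powr of_real (1 + \<delta>))"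
    using g by (auto elim: landau_o.bigE)
  then have "\<forall>\<^sub>F z in at (of_real R) within D. norm (g z / (1 - z / of_real R)) \<le> C * norm ((1 - z / of_real R) powr of_real \<delta>)"
    using eventually_neq_at_within[of "complex_of_real R" "complex_of_real R" D]
  proof eventually_elim
    case (elim z)
    have "1 - z / of_real R \<noteq> 0" using elim(2) R by (auto simp: field_simps)
    define x where "x = norm (1 - z / of_real R)"
    have x: "x > 0" using \<open>1 - z / of_real R \<noteq> 0\<close> unfolding x_def by simp
    have pw: "norm ((1 - z / of_real R) powr of_real a) = x powr a" for a
      by (simp add: norm_powr_real_powr' x_def)
    have "norm (g z) \<le> C * x powr \<delta> * x"
      using elim(1) x unfolding pw by (simp add: powr_add mult_ac)
    then have "norm (g z) / x \<le> C * x powr \<delta>" using x by (simp add: pos_divide_le_eq)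
    then show ?case unfolding pw norm_divide x_def .
  qed
  then show "(\<lambda>z. g z / (1 - z / of_real R)) \<in> O[at (of_real R) within D](\<lambda>z. (1 - z / of_real R) powr of_real \<delta>)"
    by (rule bigoI)
qed

text \<open>The positive \<open>n\<close> with \<open>cos (n * y) = 1\<close>, if any, are multiples
  of the least one, \<open>d\<close>, by division with remainder; and \<open>d > 1\<close> because
  \<open>cos y \<noteq> 1\<close>. If they contained the whole support of \<open>\<kappa>\<close>,
  then \<open>d\<close> would contradict the assumption.\<close>

lemma non_arith_cos_neq_1:
  fixes \<kappa> :: "nat \<Rightarrow> real"
  assumes "\<not> (\<exists>j0::nat. j0 > 1 \<and> (\<forall>j\<ge>1. \<kappa> j \<noteq> 0 \<longrightarrow> j0 dvd j))" and y: "0 < y" "y \<le> pi"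
  shows "\<exists>j\<ge>1. \<kappa> j \<noteq> 0 \<and> cos (real j * y) \<noteq> 1"
proof (rule ccontr)
  assume "\<not> (\<exists>j\<ge>1. \<kappa> j \<noteq> 0 \<and> cos (real j * y) \<noteq> 1)"
  then have all: "cos (real j * y) = 1" if "j \<ge> 1" "\<kappa> j \<noteq> 0" for j using that by blast
  define P where "P = (\<lambda>n::nat. n \<ge> 1 \<and> cos (real n * y) = 1)"
  \<comment> \<open>If \<open>\<kappa>\<close> vanished at all positive indices, 2 would divide its
    empty support vacuously. The existence of \<open>d\<close> rests on this.\<close>
  have "\<exists>j\<ge>1. \<kappa> j \<noteq> 0"
  proof (rule ccontr)
    assume "\<not> ?thesis"
    then have "(2::nat) > 1 \<and> (\<forall>j\<ge>1. \<kappa> j \<noteq> 0 \<longrightarrow> 2 dvd j)" by auto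
    then show False using assms(1) by (rule notE[rotated, OF exI])
  qed
  then have ex: "\<exists>n. P n" using all by (auto simp: P_def)
  define d where "d = (LEAST n. P n)"
  have d: "P d" unfolding d_def using ex by (rule LeastI_ex)
  have "cos y \<noteq> 1"
  proof -
    have "cos y < cos 0" using y by (intro cos_monotone_0_pi) auto
    then show ?thesis by simp
  qed
  then have "d \<noteq> 1" "d \<ge> 1" using d by (auto simp: P_def)
  then have "d > 1" by simp
  have "d dvd j" if j: "j \<ge> 1" "\<kappa> j \<noteq> 0" for j
  proof (rule ccontr)
    assume "\<not> d dvd j"
    then have r: "j mod d \<ge> 1" by (simp add: dvd_eq_mod_eq_0 Suc_le_eq)
    obtain a b :: int where ab: "real j * y = of_int a * (2 * pi)" "real d * y = of_int b * (2 * pi)"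
      using all[OF j] d by (auto simp: P_def cos_one_2pi_int)
    have "real (j mod d) * y = real j * y - real (j div d) * (real d * y)"
      by (subst (2) div_mult_mod_eq[of j d, symmetric]) (simp only: of_nat_add of_nat_mult, simp add: algebra_simps)
    also have "\<dots> = of_int (a - int (j div d) * b) * (2 * pi)" unfolding ab by (simp add: algebra_simps)
    finally have "cos (real (j mod d) * y) = 1"
      unfolding cos_one_2pi_int by (intro exI[of _ "a - int (j div d) * b"]) simp
    then have "P (j mod d)" using r by (simp add: P_def)
    then have "d \<le> j mod d" unfolding d_def by (rule Least_le)
    moreover have "j mod d < d" using \<open>d > 1\<close> by simp
    ultimately show False by linarith
  qed
  with \<open>d > 1\<close> have "d > 1 \<and> (\<forall>j\<ge>1. \<kappa> j \<noteq> 0 \<longrightarrow> d dvd j)" by simp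
  then show False using assms(1) by (rule notE[rotated, OF exI])
qed

text \<open>All terms of the difference are nonnegative, so one index \<open>j\<close> may be kept.
  This explicit deficit survives the limit of \<open>r\<close> to \<open>R\<close>, where a mere
  strict inequality would not.\<close>

lemma Re_gser_le:
  assumes nonneg: "\<forall>j. \<kappa> j \<ge> 0" and rad: "conv_radius (\<lambda>j. \<kappa> j / real j) = ereal R" and r: "0 \<le> r" "r < R"
  shows "Re (gser \<kappa> (of_real r * cis y)) \<le> Re (gser \<kappa> (of_real r)) - \<kappa> j / real j * r ^ j * (1 - cos (real j * y))"
proof -
  define a where "a = (\<lambda>j. \<kappa> j / real j)"
  have sm: "summable (\<lambda>j. a j * r ^ j)"
    unfolding a_def using r rad by (intro summable_in_conv_radius) simp
  have cis: "(of_real r * cis y) ^ i = of_real (r ^ i) * cis (real i * y)" for i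
    by (simp add: power_mult_distrib Complex.DeMoivre)
  have g: "gser \<kappa> z = (\<Sum>i. complex_of_real (a i) * z ^ i)" for z by (simp add: gser_def a_def)
  have "norm (complex_of_real (a i) * (of_real r * cis y) ^ i) = a i * r ^ i" for i
  proof -
    have "a i \<ge> 0" using nonneg by (simp add: a_def)
    then show ?thesis using r by (simp add: norm_mult norm_power)
  qed
  then have "summable (\<lambda>i. norm (complex_of_real (a i) * (of_real r * cis y) ^ i))" using sm by simp
  then have "(\<lambda>i. complex_of_real (a i) * (of_real r * cis y) ^ i) sums gser \<kappa> (of_real r * cis y)"
    unfolding g by (rule summable_sums[OF summable_norm_cancel])
  from sums_Re[OF this] have 1: "(\<lambda>i. a i * r ^ i * cos (real i * y)) sums Re (gser \<kappa> (of_real r * cis y))"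
    unfolding cis by (simp add: mult.assoc)
  have "(\<lambda>i. complex_of_real (a i * r ^ i)) sums of_real (\<Sum>i. a i * r ^ i)"
    by (intro sums_of_real summable_sums sm)
  then have "gser \<kappa> (of_real r) = of_real (\<Sum>i. a i * r ^ i)"
    unfolding g of_real_mult of_real_power by (rule sums_unique[symmetric])
  then have 2: "(\<lambda>i. a i * r ^ i) sums Re (gser \<kappa> (of_real r))" using summable_sums[OF sm] by simp
  have 3: "(\<lambda>i. a i * r ^ i * (1 - cos (real i * y))) sums (Re (gser \<kappa> (of_real r)) - Re (gser \<kappa> (of_real r * cis y)))"
    using sums_diff[OF 2 1] unfolding right_diff_distrib mult_1_right .
  have "(\<Sum>i\<in>{j}. a i * r ^ i * (1 - cos (real i * y))) \<le> (\<Sum>i. a i * r ^ i * (1 - cos (real i * y)))"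
  proof (rule sum_le_suminf[OF sums_summable[OF 3]])
    show "0 \<le> a i * r ^ i * (1 - cos (real i * y))" for i
      using nonneg r by (intro mult_nonneg_nonneg) (auto simp: a_def)
  qed simp
  also have "\<dots> = Re (gser \<kappa> (of_real r)) - Re (gser \<kappa> (of_real r * cis y))"
    by (rule sums_unique[OF 3, symmetric])
  finally have "a j * r ^ j * (1 - cos (real j * y)) \<le> Re (gser \<kappa> (of_real r)) - Re (gser \<kappa> (of_real r * cis y))"
    by simp
  then show ?thesis unfolding a_def by linarith
qed

section \<open>Coefficient asymptotics\<close>

text \<open>At each \<open>n\<close> choose a point violating the bound \<open>e\<close>, if there
  is one. Convergence along this single sequence says that eventually there is none.\<close>

lemma uniform_limit_if_sequences:
  fixes F :: "nat \<Rightarrow> 'a \<Rightarrow> 'b::metric_space"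
  assumes S: "S \<noteq> {}" and lim: "\<And>v. (\<And>n. v n \<in> S) \<Longrightarrow> (\<lambda>n. F n (v n)) \<longlonglongrightarrow> l"
  shows "uniform_limit S F (\<lambda>_. l) sequentially"
proof (rule uniform_limitI)
  fix e :: real assume e: "e > 0"
  obtain a where a: "a \<in> S" using S by blast
  define v where "v = (\<lambda>n. if \<exists>x\<in>S. dist (F n x) l \<ge> e then SOME x. x \<in> S \<and> dist (F n x) l \<ge> e else a)"
  have v: "v n \<in> S \<and> ((\<exists>x\<in>S. dist (F n x) l \<ge> e) \<longrightarrow> dist (F n (v n)) l \<ge> e)" for n
  proof (cases "\<exists>x\<in>S. dist (F n x) l \<ge> e")
    case True
    then have "\<exists>x. x \<in> S \<and> dist (F n x) l \<ge> e" by blast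
    from someI_ex[OF this] True show ?thesis by (simp add: v_def)
  next
    case False
    then show ?thesis using a by (simp add: v_def)
  qed
  have "v n \<in> S" for n using v by blast
  then have "\<forall>\<^sub>F n in sequentially. dist (F n (v n)) l < e" by (intro tendstoD[OF lim e])
  then show "\<forall>\<^sub>F n in sequentially. \<forall>x\<in>S. dist (F n x) l < e"
  proof eventually_elim
    case (elim n)
    then have "\<not> (\<exists>x\<in>S. dist (F n x) l \<ge> e)" using v[of n] by linarith
    then show ?case by (simp add: not_le)
  qed
qed

text \<open>On the circle \<open>H\<close> is given by continuation, not by the series. So the
  inequality is proved at \<open>R * exp x\<close> for \<open>x < 0\<close> and carried over as
  \<open>x\<close> tends to 0 from the left: \<open>Re (H x)\<close> tends to 0 by
  \<open>H_lim\<close>, and the kept term tends to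
  \<open>\<kappa> j / j * R ^ j * d > 0\<close>.\<close>

lemma Re_neg_on_circle:
  fixes H :: "complex \<Rightarrow> complex" and \<kappa> :: "nat \<Rightarrow> real"
  assumes nonneg: "\<forall>j. \<kappa> j \<ge> 0" and rad: "conv_radius (\<lambda>j. \<kappa> j / real j) = ereal R" and R: "R > 0"
    and non_arith: "\<not> (\<exists>j0::nat. j0 > 1 \<and> (\<forall>j\<ge>1. \<kappa> j \<noteq> 0 \<longrightarrow> j0 dvd j))"
    and k: "k > 0" and B: "B > 0" and s: "s \<in> {1, -1}" and y: "0 < y" "y \<le> pi"
    and H: "H holomorphic_on log_sector k B s"
    and H_lim: "((\<lambda>u. (H u - of_real c * u) / u) \<longlongrightarrow> 0) (at 0 within log_sector k B s)"
    and H_eq: "\<And>u. Re u < 0 \<Longrightarrow> H u = gser \<kappa> (of_real R * exp u) - of_real b"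
  shows "Re (H (Complex 0 (s * y))) < 0"
proof -
  obtain j where j: "j \<ge> 1" "\<kappa> j \<noteq> 0" "cos (real j * y) \<noteq> 1"
    using non_arith_cos_neq_1[OF non_arith y] by blast
  define d where "d = 1 - cos (real j * y)"
  have d: "d > 0" using j(3) cos_le_one[of "real j * y"] unfolding d_def by linarith
  have in_sector: "Complex 0 (s * y) \<in> log_sector k B s"
    using y s B by (auto simp: log_sector_def intro: le_less_trans[of y pi])
  have 1: "((\<lambda>x. Re (H (Complex x (s * y)))) \<longlongrightarrow> Re (H (Complex 0 (s * y)))) (at_left 0)"
  proof (intro tendsto_Re)
    have "isCont H (Complex 0 (s * y))"
      using holomorphic_on_imp_continuous_on[OF H] in_sector open_log_sector
      by (simp add: continuous_on_eq_continuous_at)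
    moreover have "((\<lambda>x. Complex x (s * y)) \<longlongrightarrow> Complex 0 (s * y)) (at_left 0)"
      unfolding Complex_eq by (intro tendsto_intros)
    ultimately show "((\<lambda>x. H (Complex x (s * y))) \<longlongrightarrow> H (Complex 0 (s * y))) (at_left 0)"
      by (rule isCont_tendsto_compose)
  qed
  have 2: "((\<lambda>x. Re (H (of_real x)) - \<kappa> j / real j * (R * exp x) ^ j * d) \<longlongrightarrow> Re 0 - \<kappa> j / real j * (R * exp 0) ^ j * d) (at_left 0)"
  proof (intro tendsto_intros)
    have "((\<lambda>u. (H u - of_real c * u) / u * u + of_real c * u) \<longlongrightarrow> 0 * 0 + of_real c * 0) (at 0 within log_sector k B s)"
      by (intro tendsto_intros H_lim)
    then have "((\<lambda>u. (H u - of_real c * u) / u * u + of_real c * u) \<longlongrightarrow> 0) (at 0 within log_sector k B s)" by simp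
    moreover have "filterlim complex_of_real (at 0 within log_sector k B s) (at_left 0)"
      unfolding filterlim_at
    proof
      show "\<forall>\<^sub>F x in at_left 0. complex_of_real x \<in> log_sector k B s \<and> complex_of_real x \<noteq> 0"
        using eventually_at_left_real[of "-1" 0]
      proof (rule eventually_mono)
        fix x :: real assume x: "x \<in> {-1<..<0}"
        then have "k * x < 0" using k by (simp add: mult_pos_neg)
        then show "complex_of_real x \<in> log_sector k B s \<and> complex_of_real x \<noteq> 0"
          using x B by (auto simp: log_sector_def)
      qed simp
      show "(complex_of_real \<longlongrightarrow> 0) (at_left 0)"
        using tendsto_of_real[OF tendsto_ident_at, of 0 "{..<0::real}"] by simp
    qed
    ultimately have "((\<lambda>x. (H (of_real x) - of_real c * of_real x) / of_real x * of_real x + of_real c * of_real x) \<longlongrightarrow> 0) (at_left 0)"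
      by (rule filterlim_compose)
    then show "((\<lambda>x. H (complex_of_real x)) \<longlongrightarrow> 0) (at_left 0)"
    proof (rule Lim_transform_eventually)
      show "\<forall>\<^sub>F x in at_left 0. (H (of_real x) - of_real c * of_real x) / of_real x * of_real x + of_real c * of_real x = H (complex_of_real x)"
        using eventually_at_left_real[of "-1" 0] by (rule eventually_mono) auto
    qed
  qed
  have "Re (H (Complex 0 (s * y))) \<le> Re 0 - \<kappa> j / real j * (R * exp 0) ^ j * d"
  proof (rule tendsto_le[OF _ 2 1])
    show "\<forall>\<^sub>F x in at_left 0. Re (H (Complex x (s * y))) \<le> Re (H (of_real x)) - \<kappa> j / real j * (R * exp x) ^ j * d"
      using eventually_at_left_real[of "-1" 0]
    proof (rule eventually_mono)
      fix x :: real assume "x \<in> {-1<..<0}"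
      then have x: "x < 0" by simp
      have "of_real R * exp (Complex x (s * y)) = of_real (R * exp x) * cis (s * y)"
        by (simp add: exp_eq_polar)
      moreover have "of_real R * exp (complex_of_real x) = of_real (R * exp x)" by (simp add: exp_of_real)
      moreover have "cos (real j * (s * y)) = cos (real j * y)" using s by auto
      ultimately show "Re (H (Complex x (s * y))) \<le> Re (H (of_real x)) - \<kappa> j / real j * (R * exp x) ^ j * d"
        using Re_gser_le[OF nonneg rad, of "R * exp x" "s * y" j] x R by (simp add: H_eq d_def mult.assoc)
    qed simp
  qed simp
  moreover have "\<kappa> j / real j * (R * exp 0) ^ j * d > 0"
    using j nonneg[rule_format, of j] R d by (intro mult_pos_pos divide_pos_pos) auto
  ultimately show ?thesis by simp
qed

text \<open>Here \<open>v\<close> is a sequence, which is the form needed for uniformity. The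
  interval may degenerate to a point, which gives the case \<open>v = 1\<close> without a
  neighbourhood.\<close>

lemma coefficient_asymptotics:
  fixes \<theta> \<kappa> :: "nat \<Rightarrow> real" and v :: "nat \<Rightarrow> real"
    and R \<eta> \<phi> \<theta>s \<delta> \<beta> gkR c v1 v2 :: real
    and gth gka f :: "complex \<Rightarrow> complex"
  assumes kappa_nonneg: "\<forall>j. \<kappa> j \<ge> 0"
    and non_arith: "\<not> (\<exists>j0::nat. j0 > 1 \<and> (\<forall>j\<ge>1. \<kappa> j \<noteq> 0 \<longrightarrow> j0 dvd j))"
    and R_pos: "R > 0"
    and rad_kappa: "conv_radius (\<lambda>j. \<kappa> j / real j) = ereal R"
    and eta: "\<eta> > 0" and phi: "0 < \<phi>" "\<phi> < pi / 2"
    and gth_hol: "gth holomorphic_on Delta0 R \<eta> \<phi>"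
    and gka_hol: "gka holomorphic_on Delta0 R \<eta> \<phi>"
    and gka_ext: "\<forall>z\<in>ball 0 R. gka z = gser \<kappa> z"
    and thetas: "\<theta>s \<ge> 0" and delta: "\<delta> > 0"
    and gth_asym: "(\<lambda>z. gth z - (- complex_of_real \<theta>s * ln (1 - z / complex_of_real R)))
        \<in> O[(at (complex_of_real R) within Delta0 R \<eta> \<phi>)](\<lambda>z. (1 - z / complex_of_real R) powr complex_of_real \<delta>)"
    and gka_asym: "(\<lambda>z. gka z - (complex_of_real gkR - complex_of_real c * (1 - z / complex_of_real R)))
        \<in> O[(at (complex_of_real R) within Delta0 R \<eta> \<phi>)](\<lambda>z. (1 - z / complex_of_real R) powr complex_of_real (1 + \<delta>))"
    and f_hol: "f holomorphic_on Delta0 R \<eta> \<phi>"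
    and beta: "\<beta> \<ge> 0"
    and f_asym: "(\<lambda>z. f z * (1 - z / complex_of_real R) powr complex_of_real \<beta> - 1)
        \<in> O[(at (complex_of_real R) within Delta0 R \<eta> \<phi>)](\<lambda>z. (1 - z / complex_of_real R) powr complex_of_real \<delta>)"
    and v: "0 < v1" "\<And>n. v n \<in> {v1..v2}" "v2 * c < 1" "\<forall>w\<in>{v1..v2}. w * \<theta>s + \<beta> > 0"
  shows "(\<lambda>N. zcoeff N (\<lambda>z. f z * exp (complex_of_real (v N) * (gth z + of_nat N * gka z)))
                   / complex_of_real (exp (real N * v N * gkR)
                        * (real N * (1 - v N * c)) powr (v N * \<theta>s + \<beta> - 1)
                        / (R ^ N * Gamma (v N * \<theta>s + \<beta>)))) \<longlonglongrightarrow> 1"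
proof -
  define k where "k = tan \<phi>"
  define B where "B = ln (norm (1 + complex_of_real \<eta> * exp (\<i> * complex_of_real \<phi>)))"
  have k: "k > 0" unfolding k_def using phi by (intro tan_gt_zero) auto
  have B: "B > 0" unfolding B_def by (rule ball_subset_Delta0(2)[OF R_pos eta phi])
  define F where "F = (\<lambda>u. f (of_real R * exp u))"
  define G where "G = (\<lambda>u. gth (of_real R * exp u))"
  define H where "H = (\<lambda>u. gka (of_real R * exp u) - of_real gkR)"
  have mem: "of_real R * exp u \<in> Delta0 R \<eta> \<phi>" if "u \<in> log_sector k B s" "s \<in> {1, -1}" for u s
    using exp_log_sector_in_Delta0[OF R_pos eta phi] that unfolding k_def B_def by auto
  have comp: "(\<lambda>u. g (of_real R * exp u)) holomorphic_on log_sector k B s"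
    if "g holomorphic_on Delta0 R \<eta> \<phi>" "s \<in> {1, -1}" for g s
  proof -
    have "g \<circ> (\<lambda>u. of_real R * exp u) holomorphic_on log_sector k B s"
      by (rule holomorphic_on_compose_gen[OF _ that(1)]) (use mem[OF _ that(2)] in \<open>auto intro!: holomorphic_intros\<close>)
    then show ?thesis by (simp add: o_def)
  qed
  have lim: "filterlim (\<lambda>u. of_real R * exp u) (at (of_real R) within Delta0 R \<eta> \<phi>) (at 0 within log_sector k B s)"
    if s: "s \<in> {1, -1}" for s
    unfolding filterlim_at
  proof
    have "of_real R * exp u \<in> Delta0 R \<eta> \<phi> \<and> of_real R * exp u \<noteq> complex_of_real R" if "u \<in> log_sector k B s" for u
      using mem[OF that s] by (auto simp: Delta0_def)
    then show "\<forall>\<^sub>F u in at 0 within log_sector k B s. of_real R * exp u \<in> Delta0 R \<eta> \<phi> \<and> of_real R * exp u \<noteq> complex_of_real R"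
      by (simp add: eventually_at_filter)
    have "((\<lambda>u. of_real R * exp u) \<longlongrightarrow> of_real R * exp 0) (at 0 within log_sector k B s)"
      by (intro tendsto_intros)
    then show "((\<lambda>u. of_real R * exp u) \<longlongrightarrow> complex_of_real R) (at 0 within log_sector k B s)" by simp
  qed
  have s_eq: "1 - complex_of_real R * exp u / of_real R = 1 - exp u" for u using R_pos by simp
  have F_lim: "((\<lambda>u. F u * (1 - exp u) powr of_real \<beta>) \<longlongrightarrow> 1) (at 0 within log_sector k B s)"
    if s: "s \<in> {1, -1}" for s
    using filterlim_compose[OF tendsto_0_if_bigo_powr[OF f_asym delta R_pos] lim[OF s]]
    unfolding s_eq F_def[symmetric] by (simp add: F_def LIM_zero_iff)
  have G_lim: "((\<lambda>u. G u + of_real \<theta>s * Ln (1 - exp u)) \<longlongrightarrow> 0) (at 0 within log_sector k B s)"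
    if s: "s \<in> {1, -1}" for s
    using filterlim_compose[OF tendsto_0_if_bigo_powr[OF gth_asym delta R_pos] lim[OF s]]
    unfolding s_eq by (simp add: G_def)
  have H_lim: "((\<lambda>u. (H u - of_real c * u) / u) \<longlongrightarrow> 0) (at 0 within log_sector k B s)"
    if s: "s \<in> {1, -1}" for s
  proof -
    \<comment> \<open>The expansion is in powers of \<open>1 - z / R = 1 - exp u\<close>; its linear
      term is converted to \<open>u\<close> by means of \<open>(exp u - 1) / u\<close> tending to
      1.\<close>
    define q where "q = (\<lambda>u. (H u + of_real c * (1 - exp u)) / (1 - exp u))"
    have q: "(q \<longlongrightarrow> 0) (at 0 within log_sector k B s)"
      using filterlim_compose[OF tendsto_0_divide_if_bigo_powr[OF gka_asym delta R_pos] lim[OF s]]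
      unfolding s_eq by (simp add: q_def H_def algebra_simps)
    have e: "((\<lambda>u::complex. (exp u - 1) / u) \<longlongrightarrow> 1) (at 0 within log_sector k B s)"
      by (rule tendsto_mono[OF at_le[OF subset_UNIV] lim_exp_minus_1])
    have "((\<lambda>u. - q u * ((exp u - 1) / u) + of_real c * ((exp u - 1) / u - 1)) \<longlongrightarrow> - 0 * 1 + of_real c * (1 - 1)) (at 0 within log_sector k B s)"
      by (intro tendsto_intros q e)
    then have "((\<lambda>u. - q u * ((exp u - 1) / u) + of_real c * ((exp u - 1) / u - 1)) \<longlongrightarrow> 0) (at 0 within log_sector k B s)"
      by simp
    then show ?thesis
    proof (rule Lim_transform_eventually)
      have "- q u * ((exp u - 1) / u) + of_real c * ((exp u - 1) / u - 1) = (H u - of_real c * u) / u"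
        if u: "u \<in> log_sector k B s" "u \<noteq> 0" for u
      proof -
        define t where "t = 1 - exp u"
        have "t \<noteq> 0" using exp_log_sector_notin_nonpos[OF u(1) _ k] s by (auto simp: t_def)
        moreover have eu: "exp u = 1 - t" by (simp add: t_def)
        ultimately show ?thesis using u(2) unfolding q_def eu by (simp add: field_simps)
      qed
      then show "\<forall>\<^sub>F u in at 0 within log_sector k B s. - q u * ((exp u - 1) / u) + of_real c * ((exp u - 1) / u - 1) = (H u - of_real c * u) / u"
        by (simp add: eventually_at_filter)
    qed
  qed
  have F: "F holomorphic_on log_sector k B s" and G: "G holomorphic_on log_sector k B s"
    and H: "H holomorphic_on log_sector k B s" if s: "s \<in> {1, -1}" for s
    unfolding F_def G_def H_def by (intro holomorphic_intros comp f_hol gth_hol gka_hol s)+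
  have per: "F (u + 2 * pi * \<i>) = F u" "G (u + 2 * pi * \<i>) = G u" "H (u + 2 * pi * \<i>) = H u" for u
    by (auto simp: F_def G_def H_def exp_add)
  have H_eq: "H u = gser \<kappa> (of_real R * exp u) - of_real gkR" if "Re u < 0" for u
    using gka_ext R_pos that by (simp add: H_def norm_mult)
  have neg: "Re (H (Complex 0 (s * y))) < 0" if "s \<in> {1, -1}" "0 < y" "y \<le> pi" for s y
    by (rule Re_neg_on_circle[OF kappa_nonneg rad_kappa R_pos non_arith k B that H H_lim H_eq]) (use that in auto)
  \<comment> \<open>\<open>1 - w * c\<close> is affine in \<open>w\<close>, so its minimum over the
    interval is attained at an end point, whatever the sign of \<open>c\<close>.\<close>
  define \<mu>0 where "\<mu>0 = min (1 - v1 * c) (1 - v2 * c)"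
  have v12: "v1 \<le> v2" using v(2)[of 0] by simp
  have v1c: "v1 * c < 1"
  proof (cases "c \<ge> 0")
    case True
    then have "v1 * c \<le> v2 * c" using v12 by (intro mult_right_mono)
    then show ?thesis using v(3) by simp
  next
    case False
    then have "v1 * c < 0" using v(1) by (simp add: mult_pos_neg)
    then show ?thesis by simp
  qed
  have \<mu>0: "\<mu>0 > 0" using v1c v(3) by (simp add: \<mu>0_def)
  have \<mu>: "\<mu>0 \<le> 1 - w * c" if w: "w \<in> {v1..v2}" for w
  proof (cases "c \<ge> 0")
    case True
    then have "w * c \<le> v2 * c" using w by (intro mult_right_mono) auto
    then show ?thesis by (simp add: \<mu>0_def)
  next
    case False
    then have "w * c \<le> v1 * c" using w by (intro mult_right_mono_neg) auto
    then show ?thesis by (simp add: \<mu>0_def)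
  qed
  define \<alpha> where "\<alpha> = (\<lambda>n. v n * \<theta>s + \<beta>)"
  define M where "M = (\<lambda>n. real n * (1 - v n * c))"
  define \<Phi> where "\<Phi> = (\<lambda>n u. F u * exp (of_real (v n) * G u + of_nat n * (of_real (v n) * H u) - of_nat n * u))"
  have lim0: "(\<lambda>n. of_real (M n powr (1 - \<alpha> n)) * contour_integral
      (linepath (Complex (- 1 / M n) (- pi)) (Complex (- 1 / M n) pi)) (\<Phi> n) - hankel (k + 1) (\<alpha> n)) \<longlonglongrightarrow> 0"
    unfolding M_def \<alpha>_def \<Phi>_def
  proof (rule hankel_limit_exp[OF k B F G H per F_lim G_lim H_lim])
    show "v1 \<le> v n" "v n \<le> v2" for n using v(2)[of n] by auto
    show "\<mu>0 \<le> 1 - v n * c" for n by (rule \<mu>[OF v(2)])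
    show "\<exists>T x0 \<rho>. 0 < T \<and> T < T0 \<and> 0 \<le> x0 \<and> x0 < T \<and> \<rho> > 0 \<and>
       (\<forall>s\<in>{1, -1}. \<forall>w\<in>{v1..v2}.
         (\<forall>x\<in>{x0..T}. w * Re (H (Complex x (s * ((k + 1) * T)))) - x \<le> - \<rho>) \<and>
         (\<forall>y\<in>{(k + 1) * T..pi}. w * Re (H (Complex x0 (s * y))) - x0 \<le> - \<rho>))" if "T0 > 0" for T0
      by (rule far_estimate[OF k B H H_lim neg v(1) v12 \<mu>0 \<mu> that])
  qed (use v(1) \<mu>0 thetas beta in simp_all)
  define Z where "Z = (\<lambda>n. zcoeff n (\<lambda>z. f z * exp (complex_of_real (v n) * (gth z + of_nat n * gka z))))"
  have int: "contour_integral (linepath (Complex (- 1 / M n) (- pi)) (Complex (- 1 / M n) pi)) (\<Phi> n) =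
     of_real (exp (- (real n * v n * gkR))) * (2 * pi * \<i> * of_real (R ^ n) * Z n)" if n: "n > 0" for n
  proof -
    have M: "- 1 / M n < 0" using n \<mu>0 \<mu>[OF v(2)[of n]] by (simp add: M_def)
    have hol: "(\<lambda>z. f z * exp (complex_of_real (v n) * (gth z + of_nat n * gka z))) holomorphic_on ball 0 R"
      by (intro holomorphic_intros holomorphic_on_subset[OF f_hol] holomorphic_on_subset[OF gth_hol]
          holomorphic_on_subset[OF gka_hol] ball_subset_Delta0[OF R_pos eta phi])
    have "\<Phi> n u = of_real (exp (- (real n * v n * gkR))) *
       (f (of_real R * exp u) * exp (of_real (v n) * (gth (of_real R * exp u) + of_nat n * gka (of_real R * exp u)))
          * exp (- of_nat n * u))" for u
      by (simp add: \<Phi>_def F_def G_def H_def algebra_simps flip: exp_of_real exp_add)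
    then have "\<Phi> n = (\<lambda>u. of_real (exp (- (real n * v n * gkR))) *
       (f (of_real R * exp u) * exp (of_real (v n) * (gth (of_real R * exp u) + of_nat n * gka (of_real R * exp u)))
          * exp (- of_nat n * u)))" by blast
    then show ?thesis unfolding Z_def
      using contour_integral_unique[OF has_contour_integral_lmul[OF zcoeff_contour_integral[OF hol R_pos M, of n]]]
      by simp
  qed
  have \<alpha>pos: "\<alpha> n > 0" for n using v(2)[of n] v(4) by (simp add: \<alpha>_def)
  \<comment> \<open>\<open>Gamma\<close> is bounded on the compact range of positive exponents.
    Multiplying the difference in \<open>lim0\<close> by
    \<open>Gamma (\<alpha> n) / (2 * pi * \<i>)\<close> therefore keeps the limit 0 and turns the
    difference into the desired ratio minus 1.\<close>
  have "compact ((\<lambda>w. Gamma (w * \<theta>s + \<beta>)) ` {v1..v2})"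
  proof (rule compact_continuous_image)
    have "{0<..} \<inter> \<int>\<^sub>\<le>\<^sub>0 = ({} :: real set)" by (auto elim!: nonpos_Ints_cases)
    then show "continuous_on {v1..v2} (\<lambda>w. Gamma (w * \<theta>s + \<beta>))"
      by (rule continuous_on_compose2[OF continuous_on_Gamma])
        (use v(4) in \<open>auto intro!: continuous_intros\<close>)
  qed simp
  then have "bounded ((\<lambda>w. Gamma (w * \<theta>s + \<beta>)) ` {v1..v2})" by (rule compact_imp_bounded)
  then obtain C where "\<forall>x\<in>(\<lambda>w. Gamma (w * \<theta>s + \<beta>)) ` {v1..v2}. norm x \<le> C"
    unfolding bounded_iff ..
  then have C: "norm (Gamma (w * \<theta>s + \<beta>)) \<le> C" if "w \<in> {v1..v2}" for w using that by simp
  have "(\<lambda>n. of_real (Gamma (\<alpha> n)) / (2 * pi * \<i>) * (of_real (M n powr (1 - \<alpha> n)) * contour_integral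
      (linepath (Complex (- 1 / M n) (- pi)) (Complex (- 1 / M n) pi)) (\<Phi> n) - hankel (k + 1) (\<alpha> n))) \<longlonglongrightarrow> 0"
  proof (rule tendsto_bounded_mult_zero[OF lim0, where C = "C / (2 * pi)"])
    show "norm (of_real (Gamma (\<alpha> n)) / (2 * pi * \<i>)) \<le> C / (2 * pi)" for n
      using C[OF v(2)[of n]] by (simp add: norm_divide norm_mult \<alpha>_def divide_right_mono)
  qed
  then have "(\<lambda>n. of_real (Gamma (\<alpha> n)) / (2 * pi * \<i>) * (of_real (M n powr (1 - \<alpha> n)) * contour_integral
      (linepath (Complex (- 1 / M n) (- pi)) (Complex (- 1 / M n) pi)) (\<Phi> n) - hankel (k + 1) (\<alpha> n)) + 1) \<longlonglongrightarrow> 0 + 1"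
    by (intro tendsto_add tendsto_const)
  then have "(\<lambda>n. of_real (Gamma (\<alpha> n)) / (2 * pi * \<i>) * (of_real (M n powr (1 - \<alpha> n)) * contour_integral
      (linepath (Complex (- 1 / M n) (- pi)) (Complex (- 1 / M n) pi)) (\<Phi> n) - hankel (k + 1) (\<alpha> n)) + 1) \<longlonglongrightarrow> 1"
    by simp
  then show ?thesis unfolding Z_def[symmetric] M_def[symmetric] \<alpha>_def[symmetric]
  proof (rule Lim_transform_eventually)
    show "\<forall>\<^sub>F n in sequentially. of_real (Gamma (\<alpha> n)) / (2 * pi * \<i>) * (of_real (M n powr (1 - \<alpha> n)) * contour_integral
      (linepath (Complex (- 1 / M n) (- pi)) (Complex (- 1 / M n) pi)) (\<Phi> n) - hankel (k + 1) (\<alpha> n)) + 1 =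
      zcoeff n (\<lambda>z. f z * exp (complex_of_real (v n) * (gth z + of_nat n * gka z))) / complex_of_real (exp (real n * v n * gkR)
         * (real n * (1 - v n * c)) powr (v n * \<theta>s + \<beta> - 1) / (R ^ n * Gamma (v n * \<theta>s + \<beta>)))"
      using eventually_gt_at_top[of 0]
    proof eventually_elim
      case (elim n)
      have M: "M n > 0" using elim \<mu>0 \<mu>[OF v(2)[of n]] by (simp add: M_def)
      define g where "g = Gamma (\<alpha> n)"
      define P where "P = M n powr (\<alpha> n - 1)"
      define E where "E = exp (real n * v n * gkR)"
      have g: "g > 0" unfolding g_def by (rule Gamma_real_pos[OF \<alpha>pos])
      have P: "P > 0" "M n powr (1 - \<alpha> n) = 1 / P"
        using M by (simp_all add: P_def powr_minus_divide[symmetric])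
      have E: "E > 0" "exp (- (real n * v n * gkR)) = 1 / E" by (simp_all add: E_def exp_minus inverse_eq_divide)
      have RR: "R ^ n > 0" using R_pos by simp
      have ident: "g / p * (1 / P * (1 / E * (p * r * Z)) - p / g) + 1 = Z / (E * P / (r * g))"
        if "g \<noteq> 0" "p \<noteq> 0" for g p P E r Z :: complex
        using that by (simp add: right_diff_distrib mult_ac)
      have "of_real g / (2 * pi * \<i>) * (of_real (1 / P) * (of_real (1 / E) * (2 * pi * \<i> * of_real (R ^ n) * Z n)) - 2 * pi * \<i> / of_real g) + 1
         = Z n / complex_of_real (E * P / (R ^ n * g))"
        unfolding of_real_divide of_real_mult of_real_1 by (rule ident) (use g in auto)
      then show ?case
        unfolding int[OF elim] hankel_eq[OF k \<alpha>pos] P(2) E(2) g_def[symmetric]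
        by (simp only: Z_def E_def P_def g_def \<alpha>_def M_def)
    qed
  qed
qed

theorem theorem3p5:
  fixes \<theta> \<kappa> :: "nat \<Rightarrow> real"
    and R \<eta> \<phi> \<theta>s \<delta> \<beta> gkR c :: real
    and gth gka f :: "complex \<Rightarrow> complex"
  assumes theta_nonneg: "\<forall>j. \<theta> j \<ge> 0"
    and kappa_nonneg: "\<forall>j. \<kappa> j \<ge> 0"
    and non_arith: "\<not> (\<exists>j0::nat. j0 > 1 \<and> (\<forall>j\<ge>1. \<kappa> j \<noteq> 0 \<longrightarrow> j0 dvd j))"
    and kappa_pos: "\<exists>j\<ge>2. \<kappa> j > 0"
    and R_pos: "R > 0"
    and rad_theta: "conv_radius (\<lambda>j. \<theta> j / real j) = ereal R"
    and rad_kappa: "conv_radius (\<lambda>j. \<kappa> j / real j) = ereal R"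
    and eta: "\<eta> > 0" and phi: "0 < \<phi>" "\<phi> < pi / 2"
    and gth_hol: "gth holomorphic_on Delta0 R \<eta> \<phi>"
    and gth_ext: "\<forall>z\<in>ball 0 R. gth z = gser \<theta> z"
    and gka_hol: "gka holomorphic_on Delta0 R \<eta> \<phi>"
    and gka_ext: "\<forall>z\<in>ball 0 R. gka z = gser \<kappa> z"
    and c_def: "((\<lambda>r. complex_of_real r * deriv (gser \<kappa>) (complex_of_real r))
                   \<longlongrightarrow> complex_of_real c) (at_left R)"
    and c_lt1: "c < 1"
    and thetas: "\<theta>s \<ge> 0" and delta: "\<delta> > 0"
    and gth_asym: "(\<lambda>z. gth z - (- complex_of_real \<theta>s * ln (1 - z / complex_of_real R)))
        \<in> O[(at (complex_of_real R) within Delta0 R \<eta> \<phi>)](\<lambda>z. (1 - z / complex_of_real R) powr complex_of_real \<delta>)"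
    and gka_asym: "(\<lambda>z. gka z - (complex_of_real gkR - complex_of_real c * (1 - z / complex_of_real R)))
        \<in> O[(at (complex_of_real R) within Delta0 R \<eta> \<phi>)](\<lambda>z. (1 - z / complex_of_real R) powr complex_of_real (1 + \<delta>))"
    and f_hol: "f holomorphic_on Delta0 R \<eta> \<phi>"
    and beta: "\<beta> \<ge> 0"
    and f_asym: "(\<lambda>z. f z * (1 - z / complex_of_real R) powr complex_of_real \<beta> - 1)
        \<in> O[(at (complex_of_real R) within Delta0 R \<eta> \<phi>)](\<lambda>z. (1 - z / complex_of_real R) powr complex_of_real \<delta>)"
  shows "(\<forall>v1 v2. 0 < v1 \<and> v1 < 1 \<and> 1 < v2 \<and> v2 * c < 1
            \<and> (\<forall>v\<in>{v1..v2}. v * \<theta>s + \<beta> > 0) \<longrightarrow>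
          uniform_limit {v1..v2}
            (\<lambda>N v. zcoeff N (\<lambda>z. f z * exp (complex_of_real v * (gth z + of_nat N * gka z)))
                   / complex_of_real (exp (real N * v * gkR)
                        * (real N * (1 - v * c)) powr (v * \<theta>s + \<beta> - 1)
                        / (R ^ N * Gamma (v * \<theta>s + \<beta>))))
            (\<lambda>v. 1) sequentially)
       \<and> (\<theta>s > 0 \<longrightarrow>
          (\<lambda>N. HN \<theta> \<kappa> N) \<sim>[sequentially]
            (\<lambda>N. exp (real N * gkR) * (real N * (1 - c)) powr (\<theta>s - 1)
                 / (R ^ N * Gamma \<theta>s)))"
proof (intro conjI allI impI; (elim conjE)?)
  fix v1 v2 :: real
  assume v: "0 < v1" "v1 < 1" "1 < v2" "v2 * c < 1" "\<forall>v\<in>{v1..v2}. v * \<theta>s + \<beta> > 0"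
  show "uniform_limit {v1..v2}
            (\<lambda>N v. zcoeff N (\<lambda>z. f z * exp (complex_of_real v * (gth z + of_nat N * gka z)))
                   / complex_of_real (exp (real N * v * gkR)
                        * (real N * (1 - v * c)) powr (v * \<theta>s + \<beta> - 1)
                        / (R ^ N * Gamma (v * \<theta>s + \<beta>))))
            (\<lambda>v. 1) sequentially"
  proof (rule uniform_limit_if_sequences)
    show "{v1..v2} \<noteq> {}" using v(2,3) by simp
  next
    fix w :: "nat \<Rightarrow> real" assume w: "\<And>n. w n \<in> {v1..v2}"
    show "(\<lambda>N. zcoeff N (\<lambda>z. f z * exp (complex_of_real (w N) * (gth z + of_nat N * gka z)))
                   / complex_of_real (exp (real N * w N * gkR)
                        * (real N * (1 - w N * c)) powr (w N * \<theta>s + \<beta> - 1)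
                        / (R ^ N * Gamma (w N * \<theta>s + \<beta>)))) \<longlonglongrightarrow> 1"
      by (rule coefficient_asymptotics[OF kappa_nonneg non_arith R_pos rad_kappa eta phi gth_hol gka_hol gka_ext
            thetas delta gth_asym gka_asym f_hol beta f_asym v(1) w v(4,5)])
  qed
next
  assume ths: "\<theta>s > 0"
  define D where "D = (\<lambda>N. exp (real N * gkR) * (real N * (1 - c)) powr (\<theta>s - 1) / (R ^ N * Gamma \<theta>s))"
  have one: "(\<lambda>z. 1 * (1 - z / complex_of_real R) powr complex_of_real 0 - 1)
        \<in> O[(at (complex_of_real R) within Delta0 R \<eta> \<phi>)](\<lambda>z. (1 - z / complex_of_real R) powr complex_of_real \<delta>)"
  proof (rule bigoI[where c = 0])
    show "\<forall>\<^sub>F z in at (complex_of_real R) within Delta0 R \<eta> \<phi>.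
       norm (1 * (1 - z / complex_of_real R) powr complex_of_real 0 - 1) \<le> 0 * norm ((1 - z / complex_of_real R) powr complex_of_real \<delta>)"
      \<comment> \<open>At \<open>z = R\<close> the convention \<open>0 powr 0 = 0\<close> would
        give -1, so this point has to be excluded explicitly.\<close>
      using eventually_neq_at_within[of "complex_of_real R" "complex_of_real R"]
      by eventually_elim (use R_pos in \<open>auto simp: field_simps\<close>)
  qed
  have "(\<lambda>N. zcoeff N (\<lambda>z. 1 * exp (complex_of_real 1 * (gth z + of_nat N * gka z)))
                   / complex_of_real (exp (real N * 1 * gkR)
                        * (real N * (1 - 1 * c)) powr (1 * \<theta>s + 0 - 1)
                        / (R ^ N * Gamma (1 * \<theta>s + 0)))) \<longlonglongrightarrow> 1"
    by (rule coefficient_asymptotics[OF kappa_nonneg non_arith R_pos rad_kappa eta phi gth_hol gka_hol gka_ext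
          thetas delta gth_asym gka_asym holomorphic_on_const order_refl one, where ?v1.0 = 1 and ?v2.0 = 1])
      (use ths c_lt1 in auto)
  moreover have "zcoeff N (\<lambda>z. 1 * exp (complex_of_real 1 * (gth z + of_nat N * gka z))) = of_real (HN \<theta> \<kappa> N)" for N
  proof -
    \<comment> \<open>The coefficient depends only on the germ at 0, where the continuations agree
      with the series.\<close>
    have "\<forall>\<^sub>F z in nhds 0. z \<in> ball (0::complex) R" using R_pos by (intro eventually_nhds_in_open) auto
    then have "\<forall>\<^sub>F z in nhds 0. 1 * exp (complex_of_real 1 * (gth z + of_nat N * gka z)) = exp (gser \<theta> z + of_nat N * gser \<kappa> z)"
      by eventually_elim (simp add: gth_ext gka_ext)
    then have "zcoeff N (\<lambda>z. 1 * exp (complex_of_real 1 * (gth z + of_nat N * gka z))) = zcoeff N (\<lambda>z. exp (gser \<theta> z + of_nat N * gser \<kappa> z))"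
      unfolding zcoeff_def by (intro arg_cong2[where f = "(/)"] higher_deriv_cong_ev refl)
    then show ?thesis using HN_eq_zcoeff[OF rad_theta rad_kappa R_pos] by simp
  qed
  ultimately have "(\<lambda>N. complex_of_real (HN \<theta> \<kappa> N / D N)) \<longlonglongrightarrow> complex_of_real 1"
    by (simp add: D_def)
  then have "(\<lambda>N. HN \<theta> \<kappa> N / D N) \<longlonglongrightarrow> 1" by (simp only: tendsto_of_real_iff)
  then show "(\<lambda>N. HN \<theta> \<kappa> N) \<sim>[sequentially] (\<lambda>N. exp (real N * gkR) * (real N * (1 - c)) powr (\<theta>s - 1) / (R ^ N * Gamma \<theta>s))"
    unfolding D_def by (rule asymp_equivI')
qed

end
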